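(* There exists a universal constant $c>0$ such that the following holds. Let $n\ge 2$, let $K\subset\mathbb{R}^n$ be a convex body with $|K|=|D_n|$, and let $\varepsilon\in(0,1)$. Then there exist at most $$c\,\frac{n^{13}\log^3 n}{\varepsilon^{\gamma}},\qquad \gamma=4+\frac{2}{\log n},$$ Steiner symmetrizations (that is, a finite sequence of unit vectors $u_1,\dots,u_m\in S^{n-1}$ with $m\le c\,n^{13}\log^3 n/\varepsilon^{\gamma}$) transforming $K$ into a body $K'=S_{u_m}(\cdots S_{u_1}(K)\cdots)$ satisfying $$\frac{|K'\,\Delta\, D_n|}{|D_n|}<\varepsilon.$$
   Context: $\mathbb{R}^n$ carries its standard Euclidean structure, $D_n$ is the closed Euclidean unit ball centered at the origin, $S^{n-1}$ is its boundary, and $|\cdot|$ denotes Lebesgue measure of the appropriate dimension. A convex body is a compact convex set with nonempty interior. $A\Delta B$ is the symmetric difference of $A$ and $B$, and $\log$ is the natural logarithm. For $u\in S^{n-1}$ let $H=\{x:\langle x,u\rangle=0\}$ and write each $x\in\mathbb{R}^n$ uniquely as $x=y+tu$, denoted $(y,t)$, with $y\in H$, $t\in\mathbb{R}$. The Steiner symmetral of a compact convex set $K$ with respect to $u$ is $$S_u(K)=\left\{(y,t)\,:\,K\cap(y+\mathbb{R}u)\neq\emptyset,\ |t|\le\frac{|K\cap(y+\mathbb{R}u)|}{2}\right\},$$ where $|K\cap(y+\mathbb{R}u)|$ is the one-dimensional length. The constant $c$ does not depend on $n$, $K$ or $\varepsilon$. *)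

theory Defs
  imports "HOL-Analysis.Analysis"
begin

(* The dimension has to be quantified inside a formula, below a constant that does not
   depend on it, so it cannot be a type. The n-dimensional Euclidean space is therefore the
   set of extensional functions {..<n} \<rightarrow>\<^sub>E UNIV; this is both the topspace of the
   library's product topology and the space of the library's product measure. Points are
   built with restrict, (\<lambda>i\<in>{..<n}. ...), and two of them are equal iff their first n
   coordinates agree. *)

abbreviation Rn :: "nat \<Rightarrow> (nat \<Rightarrow> real) set" where
  "Rn n \<equiv> {..<n} \<rightarrow>\<^sub>E UNIV"

abbreviation Rn_top :: "nat \<Rightarrow> (nat \<Rightarrow> real) topology" where
  "Rn_top n \<equiv> product_topology (\<lambda>_. euclideanreal) {..<n}"

(* Borel Lebesgue measure. It is only applied to compact sets and to symmetric differences
   of two compact sets; these are Borel, so the completion would give the same values. *)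
definition vol :: "nat \<Rightarrow> (nat \<Rightarrow> real) set \<Rightarrow> real" where
  "vol n A = measure (Pi\<^sub>M {..<n} (\<lambda>_. lborel)) A"

definition inner_Rn :: "nat \<Rightarrow> (nat \<Rightarrow> real) \<Rightarrow> (nat \<Rightarrow> real) \<Rightarrow> real" where
  "inner_Rn n x y = (\<Sum>i<n. x i * y i)"

definition unit_ball_Rn :: "nat \<Rightarrow> (nat \<Rightarrow> real) set" where
  "unit_ball_Rn n = {x \<in> Rn n. L2_set x {..<n} \<le> 1}"

definition unit_sphere_Rn :: "nat \<Rightarrow> (nat \<Rightarrow> real) set" where
  "unit_sphere_Rn n = {x \<in> Rn n. L2_set x {..<n} = 1}"

definition convex_Rn :: "nat \<Rightarrow> (nat \<Rightarrow> real) set \<Rightarrow> bool" where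
  "convex_Rn n A \<longleftrightarrow>
     (\<forall>x\<in>A. \<forall>y\<in>A. \<forall>s\<ge>0. \<forall>t\<ge>0. s + t = 1 \<longrightarrow> (\<lambda>i\<in>{..<n}. s * x i + t * y i) \<in> A)"

definition convex_body :: "nat \<Rightarrow> (nat \<Rightarrow> real) set \<Rightarrow> bool" where
  "convex_body n K \<longleftrightarrow>
     compactin (Rn_top n) K \<and> convex_Rn n K \<and> Rn_top n interior_of K \<noteq> {}"

definition line_point :: "nat \<Rightarrow> (nat \<Rightarrow> real) \<Rightarrow> (nat \<Rightarrow> real) \<Rightarrow> real \<Rightarrow> (nat \<Rightarrow> real)" where
  "line_point n u y t = (\<lambda>i\<in>{..<n}. y i + t * u i)"

(* For a unit vector u, the map t \<mapsto> y + t u is an isometry onto the line y + Ru, so the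
   length of a section of K by this line is the measure of its set of parameters. *)
definition chord :: "nat \<Rightarrow> (nat \<Rightarrow> real) \<Rightarrow> (nat \<Rightarrow> real) set \<Rightarrow> (nat \<Rightarrow> real) \<Rightarrow> real set" where
  "chord n u K y = {t. line_point n u y t \<in> K}"

definition steiner :: "nat \<Rightarrow> (nat \<Rightarrow> real) \<Rightarrow> (nat \<Rightarrow> real) set \<Rightarrow> (nat \<Rightarrow> real) set" where
  "steiner n u K =
     {line_point n u y t | y t. y \<in> Rn n \<and> inner_Rn n y u = 0 \<and>
        chord n u K y \<noteq> {} \<and> \<bar>t\<bar> \<le> measure lborel (chord n u K y) / 2}"

(* The head of the list is the first direction used:
   steiner_seq n [u1, ..., um] K = steiner n um (... (steiner n u1 K)). *)
definition steiner_seq :: "nat \<Rightarrow> (nat \<Rightarrow> real) list \<Rightarrow> (nat \<Rightarrow> real) set \<Rightarrow> (nat \<Rightarrow> real) set" where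
  "steiner_seq n us K = fold (steiner n) us K"

end

theory Submission
  imports Defs
begin

text \<open>
  The proof runs in two phases. First, symmetrizing along the coordinate axes makes $K$
  unconditional, hence sandwiched between two homothetic axis-parallel ellipsoids with ratio $n$;
  at most $n$ further symmetrizations in suitable coordinate planes turn these ellipsoids into
  balls, so $n^{-1} D_n \subseteq K \subseteq n D_n$. Secondly, the moment
  $\int_K |x|^2 dx \le n^2 |D_n|$ decreases under symmetrization, and in some direction it
  decreases by at least a constant times $\varepsilon^4 n^{-8} |D_n|$ as long as
  $|K \Delta D_n| \ge \varepsilon |D_n|$. Indeed, a small decrease in direction $u$ means that the
  chords parallel to $u$ are almost centred, so $K$ is almost invariant under the reflection in
  $u^\perp$; and a body almost invariant under every reflection is close to its average over the
  rotations, which is radial. This average is built in $n$ steps, each using a single random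
  reflection. In total $O(n^{10} / \varepsilon^4)$ symmetrizations suffice.
\<close>

section \<open>Lebesgue measure on the space of extensional functions\<close>

text \<open>A chord of length l whose midpoint lies at distance m from the mirror hyperplane loses
  l*m^2 of moment, while the part of it not covered by its mirror image has length min(l, 2m). Short
  chords can thus be very asymmetric at almost no gain. They are controlled through the lines that
  meet (1 - lam)K: the ball of radius r in K makes the chords on them at least 2*r*lam long, and all
  other chords lie in K - (1 - lam)K, of volume at most n*lam*|K|. Here the inner radius is needed;
  the outer one bounds the initial moment. This is why the body is first put between two balls of
  polynomial radii. The rotation average avoids Haar measure on the orthogonal group. Lebesgue
  measure on the unit ball is invariant under reflections, and a random vector from it supplies the
  reflection for one step; n steps cost a factor n in the distance to K. Constants: the asymmetry
  threshold e = \<epsilon>/(16n) gives the decrease e^4|D_n|/(32n^4), and n^2|D_n| divided by it is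
  2^21 n^10/\<epsilon>^4.\<close>

abbreviation leb :: "nat \<Rightarrow> (nat \<Rightarrow> real) measure" where
  "leb n \<equiv> Pi\<^sub>M {..<n} (\<lambda>_. lborel)"

definition dil :: "nat \<Rightarrow> real \<Rightarrow> (nat \<Rightarrow> real) \<Rightarrow> (nat \<Rightarrow> real)" where
  "dil n c x = (\<lambda>i\<in>{..<n}. c * x i)"

(* For z = 0 this is the identity, because of x/0 = 0. *)
definition reflect :: "nat \<Rightarrow> (nat \<Rightarrow> real) \<Rightarrow> (nat \<Rightarrow> real) \<Rightarrow> (nat \<Rightarrow> real)" where
  "reflect n z x = line_point n z x (- 2 * inner_Rn n x z / inner_Rn n z z)"

definition ball_Rn :: "nat \<Rightarrow> real \<Rightarrow> (nat \<Rightarrow> real) set" where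
  "ball_Rn n r = {x \<in> Rn n. inner_Rn n x x \<le> r\<^sup>2}"

section \<open>Algebra of lines, dilations and reflections\<close>

lemma line_point_in_Rn [simp]: "line_point n u x t \<in> Rn n"
  by (simp add: line_point_def)

lemma dil_in_Rn [simp]: "dil n c x \<in> Rn n"
  by (simp add: dil_def)

lemma reflect_in_Rn [simp]: "reflect n z x \<in> Rn n"
  by (simp add: reflect_def)

lemma Rn_eqI: "x \<in> Rn n \<Longrightarrow> y \<in> Rn n \<Longrightarrow> (\<And>i. i < n \<Longrightarrow> x i = y i) \<Longrightarrow> x = y"
  by (metis PiE_ext lessThan_iff)

lemma line_point_nth [simp]: "i < n \<Longrightarrow> line_point n u x t i = x i + t * u i"
  by (simp add: line_point_def)

lemma dil_nth [simp]: "i < n \<Longrightarrow> dil n c x i = c * x i"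
  by (simp add: dil_def)

lemma reflect_nth: "i < n \<Longrightarrow> reflect n z x i = x i - 2 * inner_Rn n x z / inner_Rn n z z * z i"
  by (simp add: reflect_def)

lemma inner_Rn_commute: "inner_Rn n x y = inner_Rn n y x"
  by (simp add: inner_Rn_def mult.commute)

lemma inner_line_point_left [simp]:
  "inner_Rn n (line_point n u x t) y = inner_Rn n x y + t * inner_Rn n u y"
  by (simp add: inner_Rn_def sum_distrib_left sum.distrib[symmetric] algebra_simps)

lemma inner_line_point_right [simp]:
  "inner_Rn n y (line_point n u x t) = inner_Rn n y x + t * inner_Rn n y u"
  by (simp add: inner_Rn_def sum_distrib_left sum.distrib[symmetric] algebra_simps)

lemma inner_dil_left [simp]: "inner_Rn n (dil n c x) y = c * inner_Rn n x y"
  by (simp add: inner_Rn_def sum_distrib_left algebra_simps)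

lemma inner_dil_right [simp]: "inner_Rn n y (dil n c x) = c * inner_Rn n y x"
  by (simp add: inner_Rn_def sum_distrib_left algebra_simps)

lemma inner_Rn_nonneg [simp]: "inner_Rn n x x \<ge> 0"
  by (simp add: inner_Rn_def sum_nonneg)

lemma inner_Rn_eq_0: "inner_Rn n x x = 0 \<longleftrightarrow> (\<forall>i<n. x i = 0)"
  by (auto simp: inner_Rn_def sum_nonneg_eq_0_iff)

lemma unit_sphere_iff: "u \<in> unit_sphere_Rn n \<longleftrightarrow> u \<in> Rn n \<and> inner_Rn n u u = 1"
  by (auto simp: unit_sphere_Rn_def L2_set_def inner_Rn_def power2_eq_square)

lemma unit_ball_eq: "unit_ball_Rn n = ball_Rn n 1"
  by (auto simp: unit_ball_Rn_def ball_Rn_def L2_set_def inner_Rn_def power2_eq_square)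

lemma line_point_line_point [simp]:
  "line_point n u (line_point n u x s) t = line_point n u x (s + t)"
  by (auto simp: line_point_def algebra_simps)

lemma line_point_0: "x \<in> Rn n \<Longrightarrow> line_point n u x 0 = x"
  by (rule Rn_eqI[of _ n]) simp_all

lemma inner_reflect_left:
  "inner_Rn n (reflect n z x) y = inner_Rn n x y - 2 * inner_Rn n x z / inner_Rn n z z * inner_Rn n z y"
  by (simp add: reflect_def)

lemma inner_reflect_reflect: "inner_Rn n (reflect n z x) (reflect n z y) = inner_Rn n x y"
proof (cases "inner_Rn n z z = 0")
  case True
  then show ?thesis by (simp add: reflect_def)
next
  case False
  define s where "s = - 2 * inner_Rn n x z / inner_Rn n z z"
  define t where "t = - 2 * inner_Rn n y z / inner_Rn n z z"
  have "inner_Rn n (reflect n z x) (reflect n z y)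
      = inner_Rn n x y + t * inner_Rn n x z + s * (inner_Rn n y z + t * inner_Rn n z z)"
    by (simp add: reflect_def s_def t_def inner_Rn_commute[of n z y] algebra_simps)
  moreover have "t * inner_Rn n z z = - 2 * inner_Rn n y z" "t * inner_Rn n x z = s * inner_Rn n y z"
    using False by (simp_all add: s_def t_def)
  ultimately show ?thesis by simp
qed

lemma inner_reflect_swap: "inner_Rn n (reflect n z x) y = inner_Rn n x (reflect n z y)"
  by (simp add: reflect_def inner_Rn_commute[of n z y])

lemma reflect_reflect: "x \<in> Rn n \<Longrightarrow> reflect n z (reflect n z x) = x"
proof (rule Rn_eqI[of _ n])
  fix i assume i: "i < n" and "x \<in> Rn n"
  show "reflect n z (reflect n z x) i = x i"
    by (cases "inner_Rn n z z = 0") (simp_all add: reflect_nth i inner_reflect_left)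
qed auto

lemma reflect_dil: "reflect n z (dil n c x) = dil n c (reflect n z x)"
  by (rule Rn_eqI[of _ n]) (simp_all add: reflect_nth right_diff_distrib)

lemma reflect_unit: "inner_Rn n u u = 1 \<Longrightarrow> reflect n u x = line_point n u x (- 2 * inner_Rn n x u)"
  by (simp add: reflect_def)

text \<open>On a line parallel to u the reflection acts on the parameter alone, as a flip of the
  real line, so mirror images of chords become mirror images of intervals.\<close>

lemma reflect_line_point:
  assumes "inner_Rn n u u = 1"
  shows "reflect n u (line_point n u x s) = line_point n u x (- 2 * inner_Rn n x u - s)"
  by (simp add: reflect_unit assms minus_diff_commute)

text \<open>The vectors produced later by \<open>hdir\<close> are not normalized; this makes slicing
  along unit vectors available for them.\<close>

lemma reflect_normalize:
  assumes "inner_Rn n z z \<noteq> 0"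
  shows "reflect n z x = reflect n (dil n (1 / sqrt (inner_Rn n z z)) z) x"
    and "inner_Rn n (dil n (1 / sqrt (inner_Rn n z z)) z) (dil n (1 / sqrt (inner_Rn n z z)) z) = 1"
proof -
  have *: "sqrt (inner_Rn n z z) * sqrt (inner_Rn n z z) = inner_Rn n z z" by simp
  show 1: "inner_Rn n (dil n (1 / sqrt (inner_Rn n z z)) z) (dil n (1 / sqrt (inner_Rn n z z)) z) = 1"
    using assms * by (simp add: field_simps)
  show "reflect n z x = reflect n (dil n (1 / sqrt (inner_Rn n z z)) z) x"
    using assms by (intro Rn_eqI[of _ n]) (simp_all add: reflect_nth 1 field_simps)
qed

lemma Cauchy_Schwarz_Rn: "(inner_Rn n x y)\<^sup>2 \<le> inner_Rn n x x * inner_Rn n y y"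
  using Cauchy_Schwarz_ineq_sum[of x y "{..<n}"] by (simp add: inner_Rn_def power2_eq_square)

section \<open>Measurability, affine substitutions and slicing by parallel lines\<close>

lemma space_leb: "space (leb n) = Rn n"
  by (simp add: space_PiM)

lemma measurable_coord: "i < n \<Longrightarrow> (\<lambda>x. x i) \<in> borel_measurable (leb n)"
  using measurable_component_singleton[of i "{..<n}" "\<lambda>_. lborel"] by simp

lemma measurable_inner_Rn [measurable (raw)]:
  assumes "f \<in> M \<rightarrow>\<^sub>M leb n" "g \<in> M \<rightarrow>\<^sub>M leb n"
  shows "(\<lambda>w. inner_Rn n (f w) (g w)) \<in> borel_measurable M"
proof -
  have "(\<lambda>w. f w i) \<in> borel_measurable M" "(\<lambda>w. g w i) \<in> borel_measurable M" if "i < n" for i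
    using measurable_compose[OF assms(1) measurable_coord[OF that]]
      measurable_compose[OF assms(2) measurable_coord[OF that]] by auto
  then show ?thesis unfolding inner_Rn_def by (intro borel_measurable_sum borel_measurable_times) auto
qed

lemma measurable_to_leb:
  assumes "\<And>i. i < n \<Longrightarrow> (\<lambda>w. f w i) \<in> borel_measurable M"
  shows "(\<lambda>w. \<lambda>i\<in>{..<n}. f w i) \<in> M \<rightarrow>\<^sub>M leb n"
  using assms by (intro measurable_restrict) auto

lemma measurable_line_point [measurable (raw)]:
  assumes "f \<in> M \<rightarrow>\<^sub>M leb n" "g \<in> M \<rightarrow>\<^sub>M leb n" "h \<in> borel_measurable M"
  shows "(\<lambda>w. line_point n (f w) (g w) (h w)) \<in> M \<rightarrow>\<^sub>M leb n"
  unfolding line_point_def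
proof (rule measurable_to_leb)
  fix i assume "i < n"
  then have [measurable]: "(\<lambda>w. f w i) \<in> borel_measurable M" "(\<lambda>w. g w i) \<in> borel_measurable M"
    using measurable_compose[OF assms(1) measurable_coord[of i]]
      measurable_compose[OF assms(2) measurable_coord[of i]] by auto
  note assms(3)[measurable]
  show "(\<lambda>w. g w i + h w * f w i) \<in> borel_measurable M" by measurable
qed

lemma measurable_dil [measurable (raw)]:
  assumes "g \<in> M \<rightarrow>\<^sub>M leb n" "h \<in> borel_measurable M"
  shows "(\<lambda>w. dil n (h w) (g w)) \<in> M \<rightarrow>\<^sub>M leb n"
  unfolding dil_def
proof (rule measurable_to_leb)
  fix i assume "i < n"
  then have [measurable]: "(\<lambda>w. g w i) \<in> borel_measurable M"
    using measurable_compose[OF assms(1) measurable_coord[of i]] by auto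
  note assms(2)[measurable]
  show "(\<lambda>w. h w * g w i) \<in> borel_measurable M" by measurable
qed

lemma measurable_reflect [measurable (raw)]:
  assumes [measurable]: "f \<in> M \<rightarrow>\<^sub>M leb n" "g \<in> M \<rightarrow>\<^sub>M leb n"
  shows "(\<lambda>w. reflect n (f w) (g w)) \<in> M \<rightarrow>\<^sub>M leb n"
  unfolding reflect_def by measurable

lemma measurable_const_leb: "u \<in> Rn n \<Longrightarrow> (\<lambda>w. u) \<in> M \<rightarrow>\<^sub>M leb n"
  by (intro measurable_const) (simp add: space_leb)

lemma sigma_finite_leb: "sigma_finite_measure (leb n)"
proof -
  interpret product_sigma_finite "\<lambda>_::nat. lborel :: real measure" ..
  show ?thesis by (rule sigma_finite) simp
qed

lemma ball_measurable [measurable]: "ball_Rn n r \<in> sets (leb n)"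
proof -
  have "ball_Rn n r = {x \<in> space (leb n). inner_Rn n x x \<le> r\<^sup>2}"
    by (auto simp: ball_Rn_def space_leb)
  also have "\<dots> \<in> sets (leb n)" by measurable
  finally show ?thesis .
qed

text \<open>A product measure is determined by its values on boxes, and on a box the claim splits
  into one-dimensional substitutions t \<mapsto> a i + c * t. All coordinates carry the same factor
  c, so the Jacobian is just c^n.\<close>

lemma leb_affine:
  assumes c: "c > 0"
  shows "density (distr (leb n) (leb n) (\<lambda>x. \<lambda>i\<in>{..<n}. a i + c * x i)) (\<lambda>_. ennreal (c ^ n)) = leb n"
    (is "density (distr _ _ ?g) _ = _")
proof -
  interpret product_sigma_finite "\<lambda>_::nat. lborel :: real measure" ..
  have coord: "(\<lambda>x. a i + c * x i) \<in> borel_measurable (leb n)" if "i < n" for i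
    using measurable_coord[OF that] by (intro borel_measurable_add borel_measurable_times) auto
  have m: "?g \<in> leb n \<rightarrow>\<^sub>M leb n" by (rule measurable_to_leb) (rule coord)
  show ?thesis
  proof (rule PiM_eqI)
    fix A :: "nat \<Rightarrow> real set" assume A: "\<And>i. i \<in> {..<n} \<Longrightarrow> A i \<in> sets lborel"
    have A': "PiE {..<n} A \<in> sets (leb n)" using A by (intro sets_PiM_I_finite) auto
    let ?B = "\<lambda>i. (\<lambda>t. a i + c * t) -` A i"
    have B: "?B i \<in> sets lborel" if "i < n" for i
      using A[of i] that measurable_sets[of "\<lambda>t. a i + c * t" lborel lborel "A i"] by simp
    have pre: "?g -` (PiE {..<n} A) \<inter> space (leb n) = PiE {..<n} ?B"
      by (auto simp: space_leb PiE_iff extensional_def)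
    have one: "emeasure lborel (A i) = ennreal c * emeasure lborel (?B i)" if "i < n" for i
    proof -
      have "emeasure lborel (A i) = (\<integral>\<^sup>+x. indicator (A i) x \<partial>lborel)" using A that by simp
      also have "\<dots> = ennreal \<bar>c\<bar> * (\<integral>\<^sup>+x. indicator (A i) (a i + c * x) \<partial>lborel)"
        using A[of i] that c by (intro nn_integral_real_affine) auto
      also have "(\<integral>\<^sup>+x. indicator (A i) (a i + c * x) \<partial>lborel) = (\<integral>\<^sup>+x. indicator (?B i) x \<partial>lborel)"
        by (intro nn_integral_cong) (auto simp: indicator_def)
      also have "\<dots> = emeasure lborel (?B i)" using B[OF that] by simp
      finally show ?thesis using c by simp
    qed
    have "emeasure (density (distr (leb n) (leb n) ?g) (\<lambda>_. ennreal (c ^ n))) (PiE {..<n} A)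
       = ennreal (c ^ n) * emeasure (leb n) (PiE {..<n} ?B)"
      using A' m by (simp add: emeasure_density_const emeasure_distr pre)
    also have "emeasure (leb n) (PiE {..<n} ?B) = (\<Prod>i\<in>{..<n}. emeasure lborel (?B i))"
      using B by (intro emeasure_PiM) auto
    also have "ennreal (c ^ n) * (\<Prod>i\<in>{..<n}. emeasure lborel (?B i))
        = (\<Prod>i\<in>{..<n}. ennreal c) * (\<Prod>i\<in>{..<n}. emeasure lborel (?B i))"
      using c by (simp add: ennreal_power)
    also have "\<dots> = (\<Prod>i\<in>{..<n}. emeasure lborel (A i))"
      by (subst prod.distrib[symmetric]) (simp add: one)
    finally show "emeasure (density (distr (leb n) (leb n) ?g) (\<lambda>_. ennreal (c ^ n))) (PiE {..<n} A)
       = (\<Prod>i\<in>{..<n}. emeasure lborel (A i))" .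
  qed simp_all
qed

lemma nn_integral_leb_affine:
  assumes c: "c > 0" and F: "F \<in> borel_measurable (leb n)"
  shows "(\<integral>\<^sup>+x. F x \<partial>leb n) = ennreal (c ^ n) * (\<integral>\<^sup>+x. F (\<lambda>i\<in>{..<n}. a i + c * x i) \<partial>leb n)"
proof -
  let ?g = "\<lambda>x. \<lambda>i\<in>{..<n}. a i + c * x i"
  have coord: "(\<lambda>x. a i + c * x i) \<in> borel_measurable (leb n)" if "i < n" for i
    using measurable_coord[OF that] by (intro borel_measurable_add borel_measurable_times) auto
  have m: "?g \<in> leb n \<rightarrow>\<^sub>M leb n" by (rule measurable_to_leb) (rule coord)
  have Fd: "F \<in> borel_measurable (distr (leb n) (leb n) ?g)" using F by simp
  have "(\<integral>\<^sup>+x. F x \<partial>leb n) = (\<integral>\<^sup>+x. F x \<partial>density (distr (leb n) (leb n) ?g) (\<lambda>_. ennreal (c ^ n)))"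
    by (simp only: leb_affine[OF c])
  also have "\<dots> = (\<integral>\<^sup>+x. ennreal (c ^ n) * F x \<partial>distr (leb n) (leb n) ?g)"
    by (rule nn_integral_density) (use Fd in auto)
  also have "\<dots> = ennreal (c ^ n) * (\<integral>\<^sup>+x. F x \<partial>distr (leb n) (leb n) ?g)"
    by (rule nn_integral_cmult[OF Fd])
  also have "(\<integral>\<^sup>+x. F x \<partial>distr (leb n) (leb n) ?g) = (\<integral>\<^sup>+x. F (?g x) \<partial>leb n)"
    by (rule nn_integral_distr[OF m Fd])
  finally show ?thesis .
qed

lemma nn_integral_leb_dil:
  assumes "c > 0" and "F \<in> borel_measurable (leb n)"
  shows "(\<integral>\<^sup>+x. F x \<partial>leb n) = ennreal (c ^ n) * (\<integral>\<^sup>+x. F (dil n c x) \<partial>leb n)"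
  using nn_integral_leb_affine[OF assms, of "\<lambda>_. 0"] by (simp add: dil_def)

lemma nn_integral_leb_line_point:
  assumes "F \<in> borel_measurable (leb n)"
  shows "(\<integral>\<^sup>+x. F (line_point n u x s) \<partial>leb n) = (\<integral>\<^sup>+x. F x \<partial>leb n)"
  using nn_integral_leb_affine[OF zero_less_one assms, of "\<lambda>i. s * u i"]
  by (simp add: line_point_def add.commute)

(* Slicing R^n by the lines parallel to u: the weight on the base points has total mass one
   along each line, so no transversal hyperplane has to be chosen. *)
lemma nn_integral_lines:
  assumes u: "u \<in> Rn n" "inner_Rn n u u = 1" and F [measurable]: "F \<in> borel_measurable (leb n)"
  shows "(\<integral>\<^sup>+x. F x \<partial>leb n) =
    (\<integral>\<^sup>+x. indicator {0..1} (inner_Rn n x u) * (\<integral>\<^sup>+s. F (line_point n u x s) \<partial>lborel) \<partial>leb n)"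
proof -
  interpret L: sigma_finite_measure "leb n" by (rule sigma_finite_leb)
  interpret P: pair_sigma_finite "leb n" "lborel :: real measure" ..
  have ind: "(\<lambda>w. indicator {0..1} (g w) :: ennreal) \<in> borel_measurable M"
    if [measurable]: "g \<in> borel_measurable M" for g :: "'b \<Rightarrow> real" and M
    by measurable
  have m1: "(\<lambda>(x, s). indicator {0..1} (inner_Rn n x u) * F (line_point n u x s)) \<in> borel_measurable (leb n \<Otimes>\<^sub>M lborel)"
    unfolding split_def
    by (intro borel_measurable_times_ennreal ind measurable_inner_Rn measurable_fst
        measurable_const_leb[OF u(1)] measurable_compose[OF measurable_line_point F] measurable_snd'') auto
  have m2: "(\<lambda>(x, s). indicator {0..1} (inner_Rn n x u - s) * F x) \<in> borel_measurable (leb n \<Otimes>\<^sub>M lborel)"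
    unfolding split_def
    by (intro borel_measurable_times_ennreal ind borel_measurable_diff measurable_inner_Rn measurable_fst
        measurable_const_leb[OF u(1)] measurable_compose[OF measurable_fst F] measurable_snd'') auto
  have m3: "(\<lambda>x. indicator {0..1} (inner_Rn n x u - s) * F x) \<in> borel_measurable (leb n)" for s
    by (intro borel_measurable_times_ennreal ind borel_measurable_diff measurable_inner_Rn
        measurable_const_leb[OF u(1)] F measurable_ident_sets) auto
  have m4: "(\<lambda>s. F (line_point n u x s)) \<in> borel_measurable lborel" if "x \<in> Rn n" for x
    by (intro measurable_compose[OF measurable_line_point F] measurable_const_leb u that) auto
  have w: "(\<integral>\<^sup>+s. indicator {0..1} (a - s) \<partial>lborel) = (1::ennreal)" for a :: real
  proof -
    have "(\<integral>\<^sup>+s. indicator {0..1} (a - s) \<partial>lborel) = (\<integral>\<^sup>+s. indicator {a-1..a} s \<partial>(lborel :: real measure))"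
      by (intro nn_integral_cong) (auto simp: indicator_def)
    then show ?thesis by simp
  qed
  have "(\<integral>\<^sup>+x. indicator {0..1} (inner_Rn n x u) * (\<integral>\<^sup>+s. F (line_point n u x s) \<partial>lborel) \<partial>leb n)
     = (\<integral>\<^sup>+x. (\<integral>\<^sup>+s. indicator {0..1} (inner_Rn n x u) * F (line_point n u x s) \<partial>lborel) \<partial>leb n)"
    by (intro nn_integral_cong nn_integral_cmult[symmetric] m4) (simp add: space_leb)
  also have "\<dots> = (\<integral>\<^sup>+s. (\<integral>\<^sup>+x. indicator {0..1} (inner_Rn n x u) * F (line_point n u x s) \<partial>leb n) \<partial>lborel)"
    by (rule P.Fubini'[symmetric, OF m1])
  \<comment> \<open>Invariance under translation by s*u moves the parameter s from the argument of F
    into the weight, where it can be integrated out first.\<close>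
  also have "\<dots> = (\<integral>\<^sup>+s. (\<integral>\<^sup>+x. indicator {0..1} (inner_Rn n x u - s) * F x \<partial>leb n) \<partial>lborel)"
  proof (rule nn_integral_cong)
    fix s :: real
    show "(\<integral>\<^sup>+x. indicator {0..1} (inner_Rn n x u) * F (line_point n u x s) \<partial>leb n)
        = (\<integral>\<^sup>+x. indicator {0..1} (inner_Rn n x u - s) * F x \<partial>leb n)"
      using nn_integral_leb_line_point[OF m3, of u s s] u by simp
  qed
  also have "\<dots> = (\<integral>\<^sup>+x. (\<integral>\<^sup>+s. indicator {0..1} (inner_Rn n x u - s) * F x \<partial>lborel) \<partial>leb n)"
    by (rule P.Fubini'[OF m2])
  also have "\<dots> = (\<integral>\<^sup>+x. F x \<partial>leb n)"
    by (intro nn_integral_cong) (subst nn_integral_multc, simp_all add: w)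
  finally show ?thesis ..
qed


text \<open>Slicing by lines in the direction of z reduces this to the invariance of length under a
  flip of the real line; the weight in \<open>nn_integral_lines\<close> depends only on the base
  point and is the same for both integrands.\<close>

lemma nn_integral_reflect:
  assumes z: "z \<in> Rn n" and F: "F \<in> borel_measurable (leb n)"
  shows "(\<integral>\<^sup>+x. F (reflect n z x) \<partial>leb n) = (\<integral>\<^sup>+x. F x \<partial>leb n)"
proof (cases "inner_Rn n z z = 0")
  case True
  then have "z i = 0" if "i < n" for i using that by (simp add: inner_Rn_eq_0)
  then have "reflect n z x = x" if "x \<in> Rn n" for x
    using that by (intro Rn_eqI[of _ n]) (simp_all add: reflect_nth)
  then show ?thesis by (intro nn_integral_cong) (simp add: space_leb)
next
  case False
  define u where "u = dil n (1 / sqrt (inner_Rn n z z)) z"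
  have u: "u \<in> Rn n" "inner_Rn n u u = 1" and zu: "reflect n z = reflect n u"
    using reflect_normalize[OF False] by (auto simp: u_def)
  have Fl: "(\<lambda>s. F (line_point n u x s)) \<in> borel_measurable borel" if "x \<in> Rn n" for x
    by (rule measurable_compose[OF _ F]) (intro measurable_line_point measurable_const_leb u that measurable_ident_sets refl)
  have "(\<integral>\<^sup>+s. F (reflect n u (line_point n u x s)) \<partial>lborel) = (\<integral>\<^sup>+s. F (line_point n u x s) \<partial>lborel)"
    if "x \<in> Rn n" for x
    using u nn_integral_real_affine[OF Fl[OF that], of "-1" "- 2 * inner_Rn n x u"]
    by (simp add: reflect_line_point)
  then have "(\<integral>\<^sup>+x. F (reflect n u x) \<partial>leb n) = (\<integral>\<^sup>+x. F x \<partial>leb n)"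
    using nn_integral_lines[OF u F] nn_integral_lines[OF u measurable_compose[OF measurable_reflect F], of "\<lambda>_. u" "\<lambda>x. x"]
    by (simp add: measurable_const_leb u space_leb cong: nn_integral_cong_simp)
  then show ?thesis by (simp add: zu)
qed

lemma distr_reflect:
  assumes "z \<in> Rn n"
  shows "distr (leb n) (leb n) (reflect n z) = leb n"
proof (rule measure_eqI)
  fix A assume "A \<in> sets (distr (leb n) (leb n) (reflect n z))"
  then have A: "A \<in> sets (leb n)" by simp
  have m: "reflect n z \<in> leb n \<rightarrow>\<^sub>M leb n"
    using measurable_reflect[OF measurable_const_leb[OF assms] measurable_ident_sets[OF refl]] by simp
  have "emeasure (distr (leb n) (leb n) (reflect n z)) A = (\<integral>\<^sup>+x. indicator A x \<partial>distr (leb n) (leb n) (reflect n z))"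
    using A by simp
  also have "\<dots> = (\<integral>\<^sup>+x. indicator A (reflect n z x) \<partial>leb n)"
    by (rule nn_integral_distr[OF m]) (use A in simp)
  also have "\<dots> = emeasure (leb n) A"
    using nn_integral_reflect[OF assms, of "indicator A"] A by simp
  finally show "emeasure (distr (leb n) (leb n) (reflect n z)) A = emeasure (leb n) A" .
qed simp

section \<open>Symmetrization of convex bodies\<close>

lemma continuous_map_coord:
  assumes "continuous_map X (Rn_top n) f" "i < n"
  shows "continuous_map X euclideanreal (\<lambda>w. f w i)"
  using assms by (simp add: continuous_map_componentwise)

lemma continuous_map_line_point:
  assumes "continuous_map X (Rn_top n) f" "continuous_map X (Rn_top n) g"
    "continuous_map X euclideanreal h"
  shows "continuous_map X (Rn_top n) (\<lambda>w. line_point n (f w) (g w) (h w))"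
  using assms by (auto simp: continuous_map_componentwise line_point_def
      intro!: continuous_map_add continuous_map_real_mult)

lemma continuous_map_const_real: "continuous_map X euclideanreal (\<lambda>_. c)"
  by (simp add: continuous_map_const)

lemma continuous_map_inner:
  assumes "continuous_map X (Rn_top n) f" "continuous_map X (Rn_top n) g"
  shows "continuous_map X euclideanreal (\<lambda>w. inner_Rn n (f w) (g w))"
  unfolding inner_Rn_def
  by (intro continuous_map_sum continuous_map_real_mult continuous_map_coord[OF assms(1)]
      continuous_map_coord[OF assms(2)]) auto

lemma continuous_map_const_Rn: "u \<in> Rn n \<Longrightarrow> continuous_map X (Rn_top n) (\<lambda>_. u)"
  by simp

lemma compactin_bounded:
  assumes "compactin (Rn_top n) K"
  obtains R where "R > 0" "K \<subseteq> ball_Rn n R"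
proof -
  have sub: "K \<subseteq> Rn n" using compactin_subset_topspace[OF assms] by simp
  have "compactin euclideanreal ((\<lambda>x. inner_Rn n x x) ` K)"
    by (rule image_compactin[OF assms]) (intro continuous_map_inner continuous_map_id[unfolded id_def])
  then have "bounded ((\<lambda>x. inner_Rn n x x) ` K)" by (simp add: compact_imp_bounded)
  then obtain B where B: "\<And>x. x \<in> K \<Longrightarrow> \<bar>inner_Rn n x x\<bar> \<le> B"
    unfolding bounded_iff by auto
  have "inner_Rn n x x \<le> (\<bar>B\<bar> + 1)\<^sup>2" if "x \<in> K" for x
  proof -
    have "inner_Rn n x x \<le> \<bar>B\<bar>" using B[OF that] by linarith
    also have "\<dots> \<le> (\<bar>B\<bar> + 1)\<^sup>2" by (simp add: power2_eq_square algebra_simps)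
    finally show ?thesis .
  qed
  then show ?thesis using sub by (intro that[of "\<bar>B\<bar> + 1"]) (auto simp: ball_Rn_def)
qed

lemma compactin_closedin:
  "compactin (Rn_top n) K \<Longrightarrow> closedin (Rn_top n) K"
  by (rule compactin_imp_closedin) (simp_all add: Hausdorff_space_product_topology)

text \<open>Borel sets and the product sigma-algebra are matched on the space of all functions on
  the natural numbers. K is carried there by restriction, which is continuous, and brought back by
  extension with zeros, which is measurable.\<close>

lemma closedin_measurable:
  assumes "closedin (Rn_top n) K"
  shows "K \<in> sets (leb n)"
proof -
  let ?ext = "\<lambda>x (i::nat). if i < n then x i else (0::real)"
  have c: "continuous_map euclidean (Rn_top n) (\<lambda>f. restrict f {..<n})"
    by (auto simp: continuous_map_componentwise intro: continuous_on_product_coordinates)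
  have "closedin euclidean {f \<in> topspace euclidean. restrict f {..<n} \<in> K}"
    by (rule closedin_continuous_map_preimage[OF c assms])
  then have "{f. restrict f {..<n} \<in> K} \<in> sets borel" by simp
  then have "{f. restrict f {..<n} \<in> K} \<in> sets (Pi\<^sub>M UNIV (\<lambda>_::nat. borel :: real measure))"
    by (simp add: sets_PiM_equal_borel)
  moreover have "?ext \<in> leb n \<rightarrow>\<^sub>M Pi\<^sub>M UNIV (\<lambda>_. borel)"
  proof (rule measurable_PiM_single')
    show "(\<lambda>x. ?ext x i) \<in> leb n \<rightarrow>\<^sub>M borel" for i
      using measurable_coord[of i n] by (cases "i < n") auto
  qed auto
  ultimately have "?ext -` {f. restrict f {..<n} \<in> K} \<inter> space (leb n) \<in> sets (leb n)"
    by (rule measurable_sets[rotated])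
  also have "?ext -` {f. restrict f {..<n} \<in> K} \<inter> space (leb n) = K"
  proof -
    have "restrict (?ext x) {..<n} = x" if "x \<in> Rn n" for x
      using that by (intro Rn_eqI[of _ n]) simp_all
    then show ?thesis using closedin_subset[OF assms] by (auto simp: space_leb)
  qed
  finally show ?thesis .
qed

lemma compactin_measurable: "compactin (Rn_top n) K \<Longrightarrow> K \<in> sets (leb n)"
  by (intro closedin_measurable compactin_closedin)

lemma ball_subset_box: "ball_Rn n r \<subseteq> PiE {..<n} (\<lambda>_. {-\<bar>r\<bar>..\<bar>r\<bar>})"
proof
  fix x assume x: "x \<in> ball_Rn n r"
  have "\<bar>x i\<bar> \<le> \<bar>r\<bar>" if "i < n" for i
  proof -
    have "(x i)\<^sup>2 \<le> (\<Sum>j<n. x j * x j)"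
      unfolding power2_eq_square by (rule member_le_sum) (use that in auto)
    also have "\<dots> \<le> r\<^sup>2" using x by (simp add: ball_Rn_def inner_Rn_def)
    finally show ?thesis by (simp add: abs_le_square_iff)
  qed
  then show "x \<in> PiE {..<n} (\<lambda>_. {-\<bar>r\<bar>..\<bar>r\<bar>})"
    using x by (auto simp: ball_Rn_def PiE_iff abs_le_iff) (meson abs_le_iff minus_le_iff)+
qed

text \<open>Nonempty interior in metric form, as a closed ball about x0;
  \<open>line_point n x0 x (-1)\<close> is the difference x - x0. In this form the property can be
  followed through a symmetrization.\<close>

definition has_ball :: "nat \<Rightarrow> (nat \<Rightarrow> real) set \<Rightarrow> bool" where
  "has_ball n K \<longleftrightarrow> (\<exists>x0\<in>Rn n. \<exists>r>0. \<forall>x\<in>Rn n.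
     inner_Rn n (line_point n x0 x (-1)) (line_point n x0 x (-1)) \<le> r\<^sup>2 \<longrightarrow> x \<in> K)"

lemma interior_nonempty_iff:
  assumes "K \<subseteq> Rn n"
  shows "Rn_top n interior_of K \<noteq> {} \<longleftrightarrow> has_ball n K"
proof
  assume "Rn_top n interior_of K \<noteq> {}"
  then obtain x0 T where T: "openin (Rn_top n) T" "x0 \<in> T" "T \<subseteq> K"
    unfolding interior_of_def by blast
  then obtain U where U: "\<And>i. i < n \<Longrightarrow> open (U i)" "x0 \<in> PiE {..<n} U" "PiE {..<n} U \<subseteq> T"
    using T(1,2) unfolding openin_product_topology_alt by (metis lessThan_iff open_openin)
  have "\<exists>e>0. \<forall>y. \<bar>y - x0 i\<bar> < e \<longrightarrow> y \<in> U i" if "i < n" for i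
    using U that by (metis PiE_mem dist_real_def lessThan_iff open_dist)
  then obtain e where e: "\<And>i. i < n \<Longrightarrow> e i > 0" "\<And>i y. i < n \<Longrightarrow> \<bar>y - x0 i\<bar> < e i \<Longrightarrow> y \<in> U i"
    by metis
  define r where "r = Min (insert 1 (e ` {..<n})) / 2"
  have r: "r > 0" using e(1) by (auto simp: r_def)
  have re: "r < e i" if "i < n" for i
  proof -
    have "Min (insert 1 (e ` {..<n})) \<le> e i" using that by simp
    then show ?thesis using e(1)[OF that] r by (simp add: r_def)
  qed
  have "x \<in> K" if x: "x \<in> Rn n" and d: "inner_Rn n (line_point n x0 x (-1)) (line_point n x0 x (-1)) \<le> r\<^sup>2" for x
  proof -
    have "x i \<in> U i" if "i < n" for i
    proof -
      have "(x i - x0 i)\<^sup>2 \<le> (\<Sum>j<n. (x j - x0 j)\<^sup>2)" by (rule member_le_sum) (use that in auto)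
      also have "\<dots> \<le> r\<^sup>2" using d by (simp add: inner_Rn_def power2_eq_square)
      finally have "\<bar>x i - x0 i\<bar> \<le> r" using r by (simp add: abs_le_square_iff[symmetric])
      then show ?thesis using re[OF that] e(2)[OF that] by force
    qed
    then have "x \<in> PiE {..<n} U" using x by (auto simp: PiE_iff)
    then show ?thesis using U T by auto
  qed
  then show "has_ball n K"
    unfolding has_ball_def using r T assms by blast
next
  assume "has_ball n K"
  then obtain x0 r where x0: "x0 \<in> Rn n" and r: "r > 0" and
    "\<forall>x\<in>Rn n. inner_Rn n (line_point n x0 x (-1)) (line_point n x0 x (-1)) \<le> r\<^sup>2 \<longrightarrow> x \<in> K"
    unfolding has_ball_def by blast
  then have K: "x \<in> K"
    if "x \<in> Rn n" "inner_Rn n (line_point n x0 x (-1)) (line_point n x0 x (-1)) \<le> r\<^sup>2" for x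
    using that by blast
  let ?f = "\<lambda>x. inner_Rn n (line_point n x0 x (-1)) (line_point n x0 x (-1))"
  let ?T = "{x \<in> topspace (Rn_top n). ?f x \<in> {..<r\<^sup>2}}"
  have "continuous_map (Rn_top n) euclideanreal ?f"
    by (intro continuous_map_inner continuous_map_line_point continuous_map_id[unfolded id_def]
        continuous_map_const_Rn x0 continuous_map_const_real)
  then have "openin (Rn_top n) ?T"
    by (rule openin_continuous_map_preimage) simp
  moreover have "x0 \<in> ?T" using x0 r by (simp add: inner_Rn_def)
  moreover have "?T \<subseteq> K" using K by auto
  ultimately have "x0 \<in> Rn_top n interior_of K" unfolding interior_of_def by blast
  then show "Rn_top n interior_of K \<noteq> {}" by auto
qed

lemma convex_bodyD:
  assumes "convex_body n K"
  shows "compactin (Rn_top n) K" "convex_Rn n K" "K \<subseteq> Rn n" "K \<in> sets (leb n)" "has_ball n K"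
  using assms compactin_subset_topspace[of "Rn_top n" K]
  by (auto simp: convex_body_def compactin_measurable interior_nonempty_iff)

lemma convex_bodyI:
  assumes "compactin (Rn_top n) K" "convex_Rn n K" "has_ball n K"
  shows "convex_body n K"
  using assms compactin_subset_topspace[of "Rn_top n" K]
  by (auto simp: convex_body_def interior_nonempty_iff)

section \<open>Chords and the two-point form of the symmetral\<close>

lemma chord_cases:
  assumes K: "compactin (Rn_top n) K" "convex_Rn n K" and u: "u \<in> Rn n" "inner_Rn n u u = 1" and x: "x \<in> Rn n"
  obtains "chord n u K x = {}" | a b where "a \<le> b" "chord n u K x = {a..b}"
proof -
  have "continuous_map euclideanreal (Rn_top n) (\<lambda>t. line_point n u x t)"
    by (intro continuous_map_line_point continuous_map_const_Rn u x continuous_map_id[unfolded id_def])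
  from closedin_continuous_map_preimage[OF this compactin_closedin[OF K(1)]]
  have cl: "closed (chord n u K x)" by (simp add: chord_def)
  obtain R where R: "R > 0" "K \<subseteq> ball_Rn n R" by (rule compactin_bounded[OF K(1)])
  have "\<bar>t\<bar> \<le> R + \<bar>inner_Rn n x u\<bar>" if "t \<in> chord n u K x" for t
  proof -
    have "inner_Rn n (line_point n u x t) (line_point n u x t) \<le> R\<^sup>2"
      using that R by (auto simp: chord_def ball_Rn_def)
    moreover have "(inner_Rn n (line_point n u x t) u)\<^sup>2 \<le> inner_Rn n (line_point n u x t) (line_point n u x t)"
      using Cauchy_Schwarz_Rn[of n "line_point n u x t" u] u by simp
    moreover have "inner_Rn n (line_point n u x t) u = inner_Rn n x u + t" using u by simp
    ultimately have "(inner_Rn n x u + t)\<^sup>2 \<le> R\<^sup>2" by (metis order.trans)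
    then have "\<bar>inner_Rn n x u + t\<bar> \<le> R" using R(1) by (simp add: abs_le_square_iff[symmetric])
    then show ?thesis by linarith
  qed
  then have bd: "bounded (chord n u K x)" unfolding bounded_iff by (intro exI[of _ "R + \<bar>inner_Rn n x u\<bar>"]) auto
  have "convex (chord n u K x)"
  proof (rule convexI)
    fix s t a b :: real assume *: "s \<in> chord n u K x" "t \<in> chord n u K x" "a \<ge> 0" "b \<ge> 0" "a + b = 1"
    have "(\<lambda>i\<in>{..<n}. a * line_point n u x s i + b * line_point n u x t i) \<in> K"
      using * K(2) unfolding convex_Rn_def chord_def by blast
    moreover have "(\<lambda>i\<in>{..<n}. a * line_point n u x s i + b * line_point n u x t i)
        = line_point n u x (a * s + b * t)"
    proof (rule Rn_eqI[of _ n])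
      fix i assume i: "i < n"
      have "a * (x i + s * u i) + b * (x i + t * u i) = (a + b) * x i + (a * s + b * t) * u i"
        by (simp add: algebra_simps)
      then show "(\<lambda>i\<in>{..<n}. a * line_point n u x s i + b * line_point n u x t i) i
        = line_point n u x (a * s + b * t) i" using i *(5) by simp
    qed auto
    ultimately show "a *\<^sub>R s + b *\<^sub>R t \<in> chord n u K x" by (simp add: chord_def)
  qed
  then have "connected (chord n u K x)" by (rule convex_connected)
  moreover have "compact (chord n u K x)" using cl bd by (simp add: compact_eq_bounded_closed)
  ultimately obtain a b where ab: "chord n u K x = {a..b}"
    by (metis connected_compact_interval_1)
  then show ?thesis using that by (cases "a \<le> b") auto
qed

(* The chord-free form of the symmetral: K has two points on the line x + Ru whose distance is
   at least twice the distance of x from the hyperplane orthogonal to u. *)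
definition symm :: "nat \<Rightarrow> (nat \<Rightarrow> real) \<Rightarrow> (nat \<Rightarrow> real) set \<Rightarrow> (nat \<Rightarrow> real) set" where
  "symm n u K = {x \<in> Rn n. \<exists>a b. line_point n u x a \<in> K \<and> line_point n u x b \<in> K \<and>
     2 * \<bar>inner_Rn n x u\<bar> \<le> b - a}"

lemma symmI:
  "x \<in> Rn n \<Longrightarrow> line_point n u x a \<in> K \<Longrightarrow> line_point n u x b \<in> K \<Longrightarrow>
    2 * \<bar>inner_Rn n x u\<bar> \<le> b - a \<Longrightarrow> x \<in> symm n u K"
  unfolding symm_def by blast

lemma symmE:
  assumes "x \<in> symm n u K"
  obtains a b where "x \<in> Rn n" "line_point n u x a \<in> K" "line_point n u x b \<in> K"
    "2 * \<bar>inner_Rn n x u\<bar> \<le> b - a"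
  using assms unfolding symm_def by blast

lemma symm_mono: "K \<subseteq> L \<Longrightarrow> symm n u K \<subseteq> symm n u L"
  unfolding symm_def by blast

text \<open>Chords are compact intervals: the endpoints realize the length, and conversely two
  parameters in an interval are never farther apart than its length. This lets the rest of the proof
  work with \<open>symm\<close>, where no chord has to be measured.\<close>

lemma steiner_eq_symm:
  assumes K: "compactin (Rn_top n) K" "convex_Rn n K" and u: "u \<in> Rn n" "inner_Rn n u u = 1"
  shows "steiner n u K = symm n u K"
proof (intro set_eqI iffI)
  fix x assume "x \<in> steiner n u K"
  then obtain y t where x: "x = line_point n u y t" and y: "y \<in> Rn n" "inner_Rn n y u = 0"
    and ne: "chord n u K y \<noteq> {}" and t: "\<bar>t\<bar> \<le> measure lborel (chord n u K y) / 2"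
    by (auto simp: steiner_def)
  from ne obtain a b where ab: "a \<le> b" "chord n u K y = {a..b}"
    using chord_cases[OF K u y(1)] by blast
  have "line_point n u y a \<in> K" "line_point n u y b \<in> K"
    using ab by (auto simp: chord_def set_eq_iff)
  then have "line_point n u x (a - t) \<in> K" "line_point n u x (b - t) \<in> K" by (simp_all add: x)
  moreover have "2 * \<bar>inner_Rn n x u\<bar> \<le> (b - t) - (a - t)" using t ab u y by (simp add: x)
  moreover have "x \<in> Rn n" by (simp add: x)
  ultimately show "x \<in> symm n u K" unfolding symm_def by blast
next
  fix x assume "x \<in> symm n u K"
  then obtain a b where x: "x \<in> Rn n" and ab: "line_point n u x a \<in> K" "line_point n u x b \<in> K"
    "2 * \<bar>inner_Rn n x u\<bar> \<le> b - a" by (auto simp: symm_def)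
  define t where "t = inner_Rn n x u"
  define y where "y = line_point n u x (- t)"
  have y: "y \<in> Rn n" "inner_Rn n y u = 0" using u by (simp_all add: y_def t_def)
  have xy: "x = line_point n u y t" using x by (simp add: y_def line_point_0)
  have m: "a + t \<in> chord n u K y" "b + t \<in> chord n u K y"
    using ab by (simp_all add: chord_def y_def)
  then obtain c d where cd: "c \<le> d" "chord n u K y = {c..d}"
    using chord_cases[OF K u y(1)] by blast
  then have "b - a \<le> d - c" using m by auto
  then have "\<bar>t\<bar> \<le> measure lborel (chord n u K y) / 2" using cd ab(3) by (simp add: t_def)
  then show "x \<in> steiner n u K" unfolding steiner_def using xy y m by blast
qed

lemma convex_RnD:
  assumes "convex_Rn n K" "x \<in> K" "y \<in> K" "0 \<le> t" "t \<le> 1"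
  shows "(\<lambda>i\<in>{..<n}. (1 - t) * x i + t * y i) \<in> K"
  using assms unfolding convex_Rn_def by (metis diff_add_cancel diff_ge_0_iff_ge)

text \<open>The witnesses for x and those for y combine to witnesses for the convex combination,
  because |<x,u>| is a convex function of x. Concavity of the chord length is hidden in
  this.\<close>

lemma symm_convex:
  assumes K: "convex_Rn n K" and u: "u \<in> Rn n"
  shows "convex_Rn n (symm n u K)"
  unfolding convex_Rn_def
proof (intro ballI allI impI)
  fix x y s t assume xy: "x \<in> symm n u K" "y \<in> symm n u K" and st: "0 \<le> s" "0 \<le> t" "s + t = (1::real)"
  obtain a b where ab: "line_point n u x a \<in> K" "line_point n u x b \<in> K" "2 * \<bar>inner_Rn n x u\<bar> \<le> b - a"
    using xy(1) by (auto simp: symm_def)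
  obtain c d where cd: "line_point n u y c \<in> K" "line_point n u y d \<in> K" "2 * \<bar>inner_Rn n y u\<bar> \<le> d - c"
    using xy(2) by (auto simp: symm_def)
  let ?z = "\<lambda>i\<in>{..<n}. s * x i + t * y i"
  have *: "line_point n u ?z (s * a + t * c) \<in> K"
    if "line_point n u x a \<in> K" "line_point n u y c \<in> K" for a c
  proof -
    have "line_point n u ?z (s * a + t * c) = (\<lambda>i\<in>{..<n}. s * line_point n u x a i + t * line_point n u y c i)"
      by (rule Rn_eqI[of _ n]) (simp_all add: algebra_simps)
    then show ?thesis using K that st unfolding convex_Rn_def by metis
  qed
  have "inner_Rn n ?z u = s * inner_Rn n x u + t * inner_Rn n y u"
    by (simp add: inner_Rn_def sum_distrib_left sum.distrib[symmetric] algebra_simps)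
  then have "\<bar>inner_Rn n ?z u\<bar> \<le> s * \<bar>inner_Rn n x u\<bar> + t * \<bar>inner_Rn n y u\<bar>"
    using st abs_triangle_ineq[of "s * inner_Rn n x u" "t * inner_Rn n y u"] by (simp add: abs_mult)
  then have "2 * \<bar>inner_Rn n ?z u\<bar> \<le> s * (2 * \<bar>inner_Rn n x u\<bar>) + t * (2 * \<bar>inner_Rn n y u\<bar>)"
    by (simp add: algebra_simps)
  also have "\<dots> \<le> s * (b - a) + t * (d - c)"
    using ab(3) cd(3) st by (intro add_mono mult_left_mono) auto
  also have "\<dots> = (s * b + t * d) - (s * a + t * c)" by (simp add: algebra_simps)
  finally show "?z \<in> symm n u K"
    unfolding symm_def using *[OF ab(1) cd(1)] *[OF ab(2) cd(2)] by auto
qed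

text \<open>Triples (p, c, s) with p and p + c*u in K, 0 \<le> c \<le> 2R and |s| \<le> 1 form a
  compact set; sending such a triple to the point at signed height s*c/2 on the line p + Ru maps it
  continuously onto the symmetral. This replaces an argument about semicontinuity of the chord
  length.\<close>

lemma symm_compact:
  assumes K: "compactin (Rn_top n) K" and u: "u \<in> Rn n" "inner_Rn n u u = 1"
  shows "compactin (Rn_top n) (symm n u K)"
proof -
  obtain R where R: "R > 0" "K \<subseteq> ball_Rn n R" by (rule compactin_bounded[OF K])
  have sub: "K \<subseteq> Rn n" using compactin_subset_topspace[OF K] by simp
  let ?X = "prod_topology (Rn_top n) (prod_topology euclideanreal euclideanreal)"
  let ?B = "K \<times> ({0..2 * R} \<times> {-1..1::real})"
  let ?g = "\<lambda>w. line_point n u (fst w) (fst (snd w))"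
  let ?f = "\<lambda>w. line_point n u (fst w) (snd (snd w) * fst (snd w) / 2 - inner_Rn n (fst w) u)"
  have B: "compactin ?X ?B" using K by (simp add: compactin_Times compact_Times)
  have c1: "continuous_map ?X (Rn_top n) fst" by (rule continuous_map_fst)
  have c2: "continuous_map ?X euclideanreal (\<lambda>w. fst (snd w))"
    by (rule continuous_map_compose[OF continuous_map_snd continuous_map_fst, unfolded o_def])
  have c3: "continuous_map ?X euclideanreal (\<lambda>w. snd (snd w))"
    by (rule continuous_map_compose[OF continuous_map_snd continuous_map_snd, unfolded o_def])
  have cu: "continuous_map ?X (Rn_top n) (\<lambda>_. u)" by (rule continuous_map_const_Rn[OF u(1)])
  have cg: "continuous_map ?X (Rn_top n) ?g" by (intro continuous_map_line_point c1 c2 cu)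
  have "continuous_map ?X euclideanreal (\<lambda>w. snd (snd w) * fst (snd w) * (1/2) - inner_Rn n (fst w) u)"
    by (intro continuous_map_diff continuous_map_real_mult continuous_map_inner c1 c2 c3 cu continuous_map_const_real)
  then have cf: "continuous_map ?X (Rn_top n) ?f" by (intro continuous_map_line_point c1 cu) simp
  let ?C = "{w \<in> topspace ?X. ?g w \<in> K} \<inter> ?B"
  have "compactin ?X ?C"
    by (rule closed_Int_compactin[OF closedin_continuous_map_preimage[OF cg compactin_closedin[OF K]] B])
  then have "compactin (Rn_top n) (?f ` ?C)" by (rule image_compactin[OF _ cf])
  moreover have "?f ` ?C = symm n u K"
  proof (intro set_eqI iffI)
    fix x assume "x \<in> ?f ` ?C"
    then obtain p c s where p: "p \<in> K" "line_point n u p c \<in> K" "0 \<le> c" "\<bar>s\<bar> \<le> 1"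
      and x: "x = line_point n u p (s * c / 2 - inner_Rn n p u)" by (auto simp: abs_le_iff)
    define a where "a = inner_Rn n p u - s * c / 2"
    have "line_point n u x a = p" using p sub by (simp add: x a_def line_point_0 subsetD)
    moreover have "line_point n u x (a + c) = line_point n u p c" by (simp add: x a_def)
    moreover have "2 * \<bar>inner_Rn n x u\<bar> \<le> c"
    proof -
      have "2 * \<bar>inner_Rn n x u\<bar> = \<bar>s\<bar> * c" using u p by (simp add: x abs_mult)
      also have "\<dots> \<le> c" using p by (simp add: mult_left_le_one_le)
      finally show ?thesis .
    qed
    ultimately show "x \<in> symm n u K" using p by (intro symmI[of x n u a K "a + c"]) (simp_all add: x)
  next
    fix x assume "x \<in> symm n u K"
    then obtain a b where x: "x \<in> Rn n" and ab: "line_point n u x a \<in> K" "line_point n u x b \<in> K"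
      "2 * \<bar>inner_Rn n x u\<bar> \<le> b - a" by (auto simp: symm_def)
    define t where "t = inner_Rn n x u"
    \<comment> \<open>The height of x relative to half the distance of its witnesses. If b = a then
      t = 0, and x/0 = 0 gives a correct value s = 0.\<close>
    define s where "s = 2 * t / (b - a)"
    have tt: "(inner_Rn n (line_point n u x a) u) = t + a" "(inner_Rn n (line_point n u x b) u) = t + b"
      using u by (simp_all add: t_def)
    have bd: "\<bar>inner_Rn n p u\<bar> \<le> R" if "p \<in> K" for p
    proof -
      have "(inner_Rn n p u)\<^sup>2 \<le> R\<^sup>2"
        using Cauchy_Schwarz_Rn[of n p u] u R that by (force simp: ball_Rn_def)
      then show ?thesis using R(1) by (simp add: abs_le_square_iff[symmetric])
    qed
    have c: "0 \<le> b - a" "b - a \<le> 2 * R" using ab(3) bd[OF ab(1)] bd[OF ab(2)] tt by linarith+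
    have s: "\<bar>s\<bar> \<le> 1"
    proof (cases "b = a")
      case False
      then have "b - a > 0" using c by simp
      then show ?thesis using ab(3) by (simp add: s_def t_def abs_mult divide_le_eq_1_pos)
    qed (simp add: s_def)
    have sc: "s * (b - a) / 2 = t" using ab(3) by (cases "b = a") (simp_all add: s_def t_def)
    have "(line_point n u x a, b - a, s) \<in> ?C" using ab(1,2) c s by (simp add: abs_le_iff)
    moreover have "?f (line_point n u x a, b - a, s) = x"
      using sc tt x by (simp add: line_point_0)
    ultimately show "x \<in> ?f ` ?C" by (metis (no_types, lifting) image_eqI)
  qed
  ultimately show ?thesis by simp
qed

text \<open>Let y0 be the projection of x0 to the hyperplane and x = y0 + z with |z| \<le> r. Then
  x0 + z and x0 plus the mirror image of z lie in the given ball and on the line x + Ru, and they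
  are 2|<z,u>| = 2|<x,u>| apart: they are the witnesses.\<close>

lemma symm_has_ball:
  assumes K: "has_ball n K" and u: "u \<in> Rn n" "inner_Rn n u u = 1"
  shows "has_ball n (symm n u K)"
proof -
  obtain x0 r where x0: "x0 \<in> Rn n" and r: "r > 0" and
    "\<forall>x\<in>Rn n. inner_Rn n (line_point n x0 x (-1)) (line_point n x0 x (-1)) \<le> r\<^sup>2 \<longrightarrow> x \<in> K"
    using K unfolding has_ball_def by blast
  then have K: "x \<in> K"
    if "x \<in> Rn n" "inner_Rn n (line_point n x0 x (-1)) (line_point n x0 x (-1)) \<le> r\<^sup>2" for x
    using that by blast
  define c where "c = inner_Rn n x0 u"
  define y0 where "y0 = line_point n u x0 (- c)"
  have "x \<in> symm n u K"
    if x: "x \<in> Rn n" and d: "inner_Rn n (line_point n y0 x (-1)) (line_point n y0 x (-1)) \<le> r\<^sup>2" for x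
  proof -
    define t where "t = inner_Rn n x u"
    let ?z = "line_point n y0 x (-1)"
    have zu: "inner_Rn n ?z u = t" using u by (simp add: y0_def t_def c_def)
    have 1: "line_point n u x c \<in> K"
    proof (rule K)
      have "line_point n x0 (line_point n u x c) (-1) = ?z"
        by (rule Rn_eqI[of _ n]) (simp_all add: y0_def)
      then show "inner_Rn n (line_point n x0 (line_point n u x c) (-1)) (line_point n x0 (line_point n u x c) (-1)) \<le> r\<^sup>2"
        using d by simp
    qed simp
    have 2: "line_point n u x (c - 2 * t) \<in> K"
    proof (rule K)
      have "line_point n x0 (line_point n u x (c - 2 * t)) (-1) = reflect n u ?z"
      proof (rule Rn_eqI[of _ n])
        fix i assume i: "i < n"
        have "reflect n u ?z i = ?z i - 2 * t * u i"
          by (simp only: reflect_nth[OF i] zu u div_by_1)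
        then show "line_point n x0 (line_point n u x (c - 2 * t)) (-1) i = reflect n u ?z i"
          using i by (simp add: y0_def algebra_simps)
      qed simp_all
      then show "inner_Rn n (line_point n x0 (line_point n u x (c - 2 * t)) (-1))
          (line_point n x0 (line_point n u x (c - 2 * t)) (-1)) \<le> r\<^sup>2"
        using d by (simp only: inner_reflect_reflect)
    qed simp
    show ?thesis
    proof (cases "t \<ge> 0")
      case True
      then show ?thesis using 1 2 x by (intro symmI[of x n u "c - 2 * t" K c]) (simp_all add: t_def)
    next
      case False
      then show ?thesis using 1 2 x by (intro symmI[of x n u c K "c - 2 * t"]) (simp_all add: t_def)
    qed
  qed
  moreover have "y0 \<in> Rn n" by (simp add: y0_def)
  ultimately show ?thesis unfolding has_ball_def using r by blast
qed

lemma convex_body_symm: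
  assumes K: "convex_body n K" and u: "u \<in> Rn n" "inner_Rn n u u = 1"
  shows "convex_body n (symm n u K)"
  using convex_bodyD[OF K] u by (intro convex_bodyI symm_compact symm_convex symm_has_ball)

lemma steiner_convex_body:
  assumes "convex_body n K" "u \<in> unit_sphere_Rn n"
  shows "steiner n u K = symm n u K"
  using assms convex_bodyD[OF assms(1)] by (intro steiner_eq_symm) (auto simp: unit_sphere_iff)

lemma steiner_seq_convex_body:
  assumes "convex_body n K" "set us \<subseteq> unit_sphere_Rn n"
  shows "steiner_seq n us K = fold (symm n) us K \<and> convex_body n (fold (symm n) us K)"
  using assms
proof (induction us arbitrary: K)
  case Nil
  then show ?case by (simp add: steiner_seq_def)
next
  case (Cons u us)
  have "convex_body n (symm n u K)" using Cons.prems by (intro convex_body_symm) (auto simp: unit_sphere_iff)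
  from Cons.IH[OF this] show ?case using Cons.prems by (simp add: steiner_seq_def steiner_convex_body)
qed

section \<open>Decrease of the second moment\<close>

text \<open>With q = |x|^2 and c = <x,u> the integrand is |x + t*u|^2, written for the
  antiderivative as (q - c^2) + (t + c)^2. The first summand is the squared distance of the line
  from the origin, so a symmetrization changes only the cubic term.\<close>

lemma nn_integral_shifted_square:
  fixes a b c q :: real
  assumes "a \<le> b" "\<And>t. 0 \<le> q + 2 * c * t + t\<^sup>2"
  shows "(\<integral>\<^sup>+t. ennreal (q + 2 * c * t + t\<^sup>2) * indicator {a..b} t \<partial>lborel)
    = ennreal ((q - c\<^sup>2) * (b - a) + ((b + c) ^ 3 - (a + c) ^ 3) / 3)"
proof -
  define F where "F = (\<lambda>t. (q - c\<^sup>2) * t + (t + c) ^ 3 / 3)"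
  have d: "(F has_real_derivative (q + 2 * c * t + t\<^sup>2)) (at t within S)" for t S
    unfolding F_def by (rule derivative_eq_intros refl | simp)+ (simp add: power2_eq_square algebra_simps)
  have "(\<integral>\<^sup>+t. ennreal (q + 2 * c * t + t\<^sup>2) * indicator {a..b} t \<partial>lborel) = F b - F a"
    by (rule nn_integral_FTC_Icc) (use d assms in auto)
  also have "F b - F a = (q - c\<^sup>2) * (b - a) + ((b + c) ^ 3 - (a + c) ^ 3) / 3"
    by (simp add: F_def algebra_simps diff_divide_distrib)
  finally show ?thesis .
qed

text \<open>The mirror image in -c is the interval translated by -(a + b + 2c), hence what it leaves
  uncovered sits at one end and is no longer than the translation.\<close>

lemma emeasure_interval_minus_mirror:
  fixes a b c :: real
  assumes "a \<le> b"
  shows "emeasure lborel ({a..b} - {- 2 * c - b..- 2 * c - a}) \<le> ennreal (min (b - a) \<bar>a + b + 2 * c\<bar>)"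
proof -
  have 1: "emeasure lborel ({a..b} - {- 2 * c - b..- 2 * c - a}) \<le> ennreal (b - a)"
    using emeasure_mono[of "{a..b} - {- 2 * c - b..- 2 * c - a}" "{a..b}" lborel] assms by simp
  have 2: "emeasure lborel ({a..b} - {- 2 * c - b..- 2 * c - a}) \<le> ennreal \<bar>a + b + 2 * c\<bar>"
  proof (cases "a + b + 2 * c \<ge> 0")
    case True
    have "emeasure lborel ({a..b} - {- 2 * c - b..- 2 * c - a}) \<le> emeasure lborel {- 2 * c - a..b}"
      using True by (intro emeasure_mono) auto
    also have "\<dots> = ennreal \<bar>a + b + 2 * c\<bar>" using True by (simp add: algebra_simps)
    finally show ?thesis .
  next
    case False
    have "emeasure lborel ({a..b} - {- 2 * c - b..- 2 * c - a}) \<le> emeasure lborel {a..- 2 * c - b}"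
      using False by (intro emeasure_mono) auto
    also have "\<dots> = ennreal \<bar>a + b + 2 * c\<bar>" using False by simp
    finally show ?thesis .
  qed
  from 1 2 show ?thesis by (simp add: min_def)
qed

(* One chord: m = (a + b)/2 + c is the offset of its midpoint, and (b - a) m^2 is what the
   symmetrization takes off the second moment. For long chords the length 2|m| of the
   asymmetric part is absorbed by that gain through 2 kap s |m| \<le> (kap s)^2 + m^2. *)
lemma chord_moment_inequality:
  fixes a b c h m q s kap D :: real
  assumes "a \<le> b" "0 < s" "0 < kap"
    and h: "h = (b - a) / 2"
    and long: "D = b - a \<or> s \<le> b - a" and D: "0 \<le> D"
  shows "kap * s\<^sup>2 * min (b - a) \<bar>a + b + 2 * c\<bar> + ((q - c\<^sup>2) * (2 * h) + (h ^ 3 - (- h) ^ 3) / 3)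
    \<le> kap * s\<^sup>2 * D + kap\<^sup>2 * s\<^sup>2 * (b - a) + ((q - c\<^sup>2) * (b - a) + ((b + c) ^ 3 - (a + c) ^ 3) / 3)"
proof -
  define m where "m = (a + b) / 2 + c"
  have e: "b + c = m + h" "a + c = m - h" "b - a = 2 * h" "a + b + 2 * c = 2 * m"
    using h by (simp_all add: m_def field_simps)
  have h0: "h \<ge> 0" using assms by simp
  have cube: "((b + c) ^ 3 - (a + c) ^ 3) / 3 = 2 * h * m\<^sup>2 + (h ^ 3 - (- h) ^ 3) / 3"
    unfolding e by (simp add: power3_eq_cube power2_eq_square algebra_simps)
  have main: "kap * s\<^sup>2 * min (2 * h) (2 * \<bar>m\<bar>) \<le> kap * s\<^sup>2 * D + kap\<^sup>2 * s\<^sup>2 * (2 * h) + 2 * h * m\<^sup>2"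
  proof (cases "D = b - a")
    case True
    have "kap * s\<^sup>2 * min (2 * h) (2 * \<bar>m\<bar>) \<le> kap * s\<^sup>2 * D"
      using assms True e by (intro mult_left_mono) auto
    moreover have "0 \<le> kap\<^sup>2 * s\<^sup>2 * (2 * h)" "0 \<le> 2 * h * m\<^sup>2" using h0 by simp_all
    ultimately show ?thesis by linarith
  next
    case False
    then have sl: "s \<le> 2 * h" using long e by simp
    have "kap * s\<^sup>2 * min (2 * h) (2 * \<bar>m\<bar>) \<le> kap * s\<^sup>2 * (2 * \<bar>m\<bar>)"
      using assms by (intro mult_left_mono) auto
    also have "\<dots> = (2 * (kap * s) * \<bar>m\<bar>) * s" by (simp add: power2_eq_square algebra_simps)
    also have "\<dots> \<le> (2 * (kap * s) * \<bar>m\<bar>) * (2 * h)"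
      using assms sl by (intro mult_left_mono) auto
    also have "\<dots> \<le> ((kap * s)\<^sup>2 + m\<^sup>2) * (2 * h)"
    proof (rule mult_right_mono)
      show "2 * (kap * s) * \<bar>m\<bar> \<le> (kap * s)\<^sup>2 + m\<^sup>2"
        using sum_squares_bound[of "kap * s" "\<bar>m\<bar>"] by simp
    qed (use h0 in simp)
    also have "\<dots> = kap\<^sup>2 * s\<^sup>2 * (2 * h) + 2 * h * m\<^sup>2"
      by (simp add: power_mult_distrib algebra_simps)
    finally show ?thesis using D assms by (smt (verit) mult_nonneg_nonneg zero_le_power2)
  qed
  have "min (b - a) \<bar>a + b + 2 * c\<bar> = min (2 * h) (2 * \<bar>m\<bar>)" unfolding e by (simp add: abs_mult)
  then show ?thesis using main unfolding cube by (simp add: e)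
qed

text \<open>The new chord is centred at -c, the parameter where the line crosses the hyperplane
  orthogonal to u.\<close>

lemma chord_symm:
  assumes K: "chord n u K x = {a..b}" "a \<le> b" and x: "x \<in> Rn n" and u: "inner_Rn n u u = 1"
  defines "c \<equiv> inner_Rn n x u"
  shows "chord n u (symm n u K) x = {- c - (b - a) / 2..- c + (b - a) / 2}"
proof -
  have mem: "line_point n u x t \<in> K \<longleftrightarrow> a \<le> t \<and> t \<le> b" for t
    using K(1) by (auto simp: chord_def set_eq_iff)
  have "line_point n u x t \<in> symm n u K \<longleftrightarrow> 2 * \<bar>c + t\<bar> \<le> b - a" for t
  proof
    assume "line_point n u x t \<in> symm n u K"
    then obtain p q where "line_point n u x (t + p) \<in> K" "line_point n u x (t + q) \<in> K"
      "2 * \<bar>c + t\<bar> \<le> q - p" by (rule symmE) (simp add: c_def u)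
    then show "2 * \<bar>c + t\<bar> \<le> b - a" by (simp add: mem)
  next
    assume "2 * \<bar>c + t\<bar> \<le> b - a"
    then show "line_point n u x t \<in> symm n u K"
      by (intro symmI[of _ n u "a - t" K "b - t"]) (simp_all add: mem K c_def u)
  qed
  moreover have "2 * \<bar>c + t\<bar> \<le> b - a \<longleftrightarrow> - c - (b - a) / 2 \<le> t \<and> t \<le> - c + (b - a) / 2" for t
  proof -
    define h where "h = (b - a) / 2"
    have "2 * \<bar>c + t\<bar> \<le> b - a \<longleftrightarrow> \<bar>c + t\<bar> \<le> h" by (simp add: h_def mult.commute)
    also have "\<dots> \<longleftrightarrow> - c - h \<le> t \<and> t \<le> - c + h" unfolding abs_le_iff by auto
    finally show ?thesis by (simp only: h_def)
  qed
  ultimately show ?thesis unfolding chord_def by (simp add: set_eq_iff)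
qed

lemma chord_symm_empty: "chord n u K x = {} \<Longrightarrow> chord n u (symm n u K) x = {}"
  by (auto simp: chord_def elim!: symmE)

lemma indicator_line_point: "indicator A (line_point n u x t) = indicator (chord n u A x) t"
  by (simp add: indicator_def chord_def)

lemma nn_integral_lines_mono:
  assumes u: "u \<in> Rn n" "inner_Rn n u u = 1"
    and F: "F \<in> borel_measurable (leb n)" and G: "G \<in> borel_measurable (leb n)"
    and le: "\<And>x. x \<in> Rn n \<Longrightarrow> (\<integral>\<^sup>+s. F (line_point n u x s) \<partial>lborel) \<le> (\<integral>\<^sup>+s. G (line_point n u x s) \<partial>lborel)"
  shows "(\<integral>\<^sup>+x. F x \<partial>leb n) \<le> (\<integral>\<^sup>+x. G x \<partial>leb n)"
  unfolding nn_integral_lines[OF u F] nn_integral_lines[OF u G]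
  by (intro nn_integral_mono mult_left_mono le) (simp_all add: space_leb)

lemma emeasure_symm:
  assumes K: "convex_body n K" and u: "u \<in> Rn n" "inner_Rn n u u = 1"
  shows "emeasure (leb n) (symm n u K) = emeasure (leb n) K"
proof -
  note Kd = convex_bodyD[OF K] and Sd = convex_bodyD[OF convex_body_symm[OF K u]]
  have *: "(\<integral>\<^sup>+s. indicator (symm n u K) (line_point n u x s) \<partial>lborel)
      = (\<integral>\<^sup>+s. indicator K (line_point n u x s) \<partial>lborel)" if x: "x \<in> Rn n" for x
  proof (rule chord_cases[OF Kd(1,2) u x])
    assume "chord n u K x = {}"
    then show ?thesis using chord_symm_empty[of n u K x] by (simp add: indicator_line_point)
  next
    fix a b assume "a \<le> b" "chord n u K x = {a..b}"
    moreover have "emeasure lborel {- p - (b - a) / 2..(b - a) / 2 - p} = ennreal (b - a)" for p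
    proof -
      have "- p - (b - a) / 2 \<le> (b - a) / 2 - p" using \<open>a \<le> b\<close> by argo
      moreover have "(b - a) / 2 - p - (- p - (b - a) / 2) = b - a" by (simp add: field_simps)
      ultimately show ?thesis by (metis emeasure_lborel_Icc)
    qed
    ultimately have "emeasure lborel (chord n u (symm n u K) x) = emeasure lborel (chord n u K x)"
      using chord_symm[of n u K x a b, OF _ _ x u(2)] by simp
    then show ?thesis
      using \<open>chord n u K x = {a..b}\<close> chord_symm[of n u K x a b, OF _ _ x u(2)] \<open>a \<le> b\<close>
      by (simp add: indicator_line_point)
  qed
  have "(\<integral>\<^sup>+x. indicator (symm n u K) x \<partial>leb n) = (\<integral>\<^sup>+x. indicator K x \<partial>leb n)"
    using Kd Sd by (intro antisym nn_integral_lines_mono[OF u]) (simp_all add: *)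
  then show ?thesis using Kd Sd by simp
qed

definition moment :: "nat \<Rightarrow> (nat \<Rightarrow> real) set \<Rightarrow> ennreal" where
  "moment n A = (\<integral>\<^sup>+x. ennreal (inner_Rn n x x) * indicator A x \<partial>leb n)"

lemma measurable_inner_self [measurable]: "(\<lambda>x. inner_Rn n x x) \<in> borel_measurable (leb n)"
  by (intro measurable_inner_Rn measurable_ident_sets refl)

text \<open>By convexity (1 - lam)K + lam B \<subseteq> K for the ball B of radius r in K; this is
  applied in direction u. It makes every line that meets (1 - lam)K cut K in a chord of length at
  least 2*r*lam.\<close>

lemma line_point_in_body:
  assumes K: "convex_Rn n K" "ball_Rn n r \<subseteq> K" and u: "u \<in> Rn n" "inner_Rn n u u = 1"
    and lam: "0 < lam" "lam \<le> 1"
    and t: "line_point n u x t \<in> dil n (1 - lam) ` K" and s: "\<bar>s\<bar> \<le> lam * r" and "r > 0"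
  shows "line_point n u x (t + s) \<in> K"
proof -
  from t obtain k where k: "k \<in> K" "line_point n u x t = dil n (1 - lam) k" by auto
  have "(s / lam)\<^sup>2 \<le> r\<^sup>2"
    using s lam \<open>r > 0\<close> by (simp add: power2_le_iff_abs_le pos_divide_le_eq mult.commute)
  moreover have "inner_Rn n (dil n (s / lam) u) (dil n (s / lam) u) = (s / lam)\<^sup>2"
    using u by (simp add: power2_eq_square)
  ultimately have "dil n (s / lam) u \<in> ball_Rn n r" by (simp add: ball_Rn_def)
  then have "dil n (s / lam) u \<in> K" using K by blast
  then have "(\<lambda>i\<in>{..<n}. (1 - lam) * k i + lam * dil n (s / lam) u i) \<in> K"
    using K(1) k lam by (intro convex_RnD) simp_all
  also have "(\<lambda>i\<in>{..<n}. (1 - lam) * k i + lam * dil n (s / lam) u i) = line_point n u x (t + s)"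
  proof (rule Rn_eqI[of _ n])
    fix i assume i: "i < n"
    have "line_point n u x t i = (1 - lam) * k i" using i k by simp
    then show "(\<lambda>i\<in>{..<n}. (1 - lam) * k i + lam * dil n (s / lam) u i) i = line_point n u x (t + s) i"
      using i lam by (simp add: algebra_simps)
  qed simp_all
  finally show ?thesis .
qed

text \<open>The inequality for single chords, integrated over all lines parallel to u. Its two error
  terms come from the lines that miss (1 - lam)K and from absorbing |m| into m^2; lam and kap remain
  free so that both can be balanced against the asymmetry on the left.\<close>

lemma moment_symm:
  assumes K: "convex_body n K" "ball_Rn n r \<subseteq> K" "r > 0" and u: "u \<in> Rn n" "inner_Rn n u u = 1"
    and lam: "0 < lam" "lam \<le> 1" and kap: "0 < kap" and s: "s = 2 * r * lam"
    and L: "dil n (1 - lam) ` K \<in> sets (leb n)"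
  shows "ennreal (kap * s\<^sup>2) * emeasure (leb n) (K - {x \<in> Rn n. reflect n u x \<in> K}) + moment n (symm n u K)
    \<le> ennreal (kap * s\<^sup>2) * emeasure (leb n) (K - dil n (1 - lam) ` K)
      + ennreal (kap\<^sup>2 * s\<^sup>2) * emeasure (leb n) K + moment n K"
proof -
  note Kd = convex_bodyD[OF K(1)] and Sd = convex_bodyD[OF convex_body_symm[OF K(1) u]]
  let ?KR = "{x \<in> Rn n. reflect n u x \<in> K}" and ?L = "dil n (1 - lam) ` K"
  have s0: "s > 0" using s K lam by simp
  have KR: "?KR \<in> sets (leb n)"
  proof -
    have "reflect n u \<in> leb n \<rightarrow>\<^sub>M leb n"
      using measurable_reflect[OF measurable_const_leb[OF u(1)] measurable_ident_sets[OF refl]] by simp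
    from measurable_sets[OF this Kd(4)] show ?thesis
      by (simp add: space_leb vimage_def Int_def conj_commute)
  qed
  let ?F = "\<lambda>x. ennreal (kap * s\<^sup>2) * indicator (K - ?KR) x + ennreal (inner_Rn n x x) * indicator (symm n u K) x"
  let ?G = "\<lambda>x. ennreal (kap * s\<^sup>2) * indicator (K - ?L) x + ennreal (kap\<^sup>2 * s\<^sup>2) * indicator K x
      + ennreal (inner_Rn n x x) * indicator K x"
  have "(\<integral>\<^sup>+x. ?F x \<partial>leb n) \<le> (\<integral>\<^sup>+x. ?G x \<partial>leb n)"
  proof (rule nn_integral_lines_mono[OF u])
    show "?F \<in> borel_measurable (leb n)" "?G \<in> borel_measurable (leb n)"
      using Kd Sd KR L by measurable
  next
    fix x assume x: "x \<in> Rn n"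
    define c where "c = inner_Rn n x u"
    define q where "q = inner_Rn n x x"
    have qt: "inner_Rn n (line_point n u x t) (line_point n u x t) = q + 2 * c * t + t\<^sup>2" for t
      using u by (simp add: q_def c_def inner_Rn_commute[of n u x] power2_eq_square algebra_simps)
    have qt0: "0 \<le> q + 2 * c * t + t\<^sup>2" for t unfolding qt[symmetric] by (rule inner_Rn_nonneg)
    show "(\<integral>\<^sup>+t. ?F (line_point n u x t) \<partial>lborel) \<le> (\<integral>\<^sup>+t. ?G (line_point n u x t) \<partial>lborel)"
    proof (rule chord_cases[OF Kd(1,2) u x])
      assume "chord n u K x = {}"
      moreover have "chord n u (K - ?KR) x \<subseteq> chord n u K x" by (auto simp: chord_def)
      ultimately show ?thesis using chord_symm_empty[of n u K x] by (simp add: indicator_line_point)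
    next
      fix a b assume ab: "a \<le> b" "chord n u K x = {a..b}"
      have mem: "line_point n u x t \<in> K \<longleftrightarrow> a \<le> t \<and> t \<le> b" for t
        using ab(2) by (auto simp: chord_def set_eq_iff)
      define h where "h = (b - a) / 2"
      have cS: "chord n u (symm n u K) x = {- c - h..- c + h}"
        using chord_symm[OF ab(2,1) x u(2)] by (simp add: c_def h_def)
      have cKR: "chord n u (K - ?KR) x = {a..b} - {- 2 * c - b..- 2 * c - a}"
        by (auto simp: chord_def mem reflect_line_point u c_def)
      \<comment> \<open>A line that misses (1 - lam)K has its whole chord in K - (1 - lam)K, so its
        length can be charged to that set. On all other lines nothing is charged, and K contains two
        points of the line at distance 2*r*lam = s.\<close>
      define D where "D = (if chord n u ?L x = {} then b - a else 0)"
      have long: "D = b - a \<or> s \<le> b - a"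
      proof (cases "chord n u ?L x = {}")
        case False
        then obtain t where "line_point n u x t \<in> ?L" by (auto simp: chord_def)
        then have "line_point n u x (t + lam * r) \<in> K" "line_point n u x (t + - (lam * r)) \<in> K"
          using lam K(3) by (auto intro!: line_point_in_body[OF Kd(2) K(2) u lam _ _ K(3)] simp del: add_uminus_conv_diff)
        then have "t + lam * r \<le> b" "a \<le> t - lam * r" unfolding mem by simp_all
        moreover have "s = lam * r + lam * r" by (simp add: s)
        ultimately have "s \<le> b - a" by linarith
        then show ?thesis ..
      qed (simp add: D_def)
      have DL: "ennreal D \<le> (\<integral>\<^sup>+t. indicator (K - ?L) (line_point n u x t) \<partial>lborel)"
      proof (cases "chord n u ?L x = {}")
        case True
        then have "chord n u (K - ?L) x = {a..b}" using ab(2) by (auto simp: chord_def)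
        then show ?thesis using ab(1) by (simp add: indicator_line_point D_def True)
      qed (simp add: D_def)
      have sqS: "(\<integral>\<^sup>+t. ennreal (q + 2 * c * t + t\<^sup>2) * indicator {- c - h..- c + h} t \<partial>lborel)
          = ennreal ((q - c\<^sup>2) * (2 * h) + (h ^ 3 - (- h) ^ 3) / 3)"
      proof -
        have "h \<ge> 0" using ab(1) by (simp add: h_def)
        then have "- c - h \<le> - c + h" by simp
        moreover have "- c + h - (- c - h) = 2 * h" "- c + h + c = h" "- c - h + c = - h" by simp_all
        ultimately show ?thesis using nn_integral_shifted_square[of "- c - h" "- c + h" q c, OF _ qt0] by metis
      qed
      have "(\<integral>\<^sup>+t. ?F (line_point n u x t) \<partial>lborel)
          = ennreal (kap * s\<^sup>2) * emeasure lborel ({a..b} - {- 2 * c - b..- 2 * c - a})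
            + ennreal ((q - c\<^sup>2) * (2 * h) + (h ^ 3 - (- h) ^ 3) / 3)"
        unfolding indicator_line_point cS cKR qt by (simp add: nn_integral_add nn_integral_cmult sqS[simplified])
      also have "\<dots> \<le> ennreal (kap * s\<^sup>2) * ennreal (min (b - a) \<bar>a + b + 2 * c\<bar>)
            + ennreal ((q - c\<^sup>2) * (2 * h) + (h ^ 3 - (- h) ^ 3) / 3)"
        by (intro add_right_mono mult_left_mono emeasure_interval_minus_mirror ab) simp
      also have "\<dots> = ennreal (kap * s\<^sup>2 * min (b - a) \<bar>a + b + 2 * c\<bar> + ((q - c\<^sup>2) * (2 * h) + (h ^ 3 - (- h) ^ 3) / 3))"
      proof -
        have "0 \<le> q - c\<^sup>2" using qt0[of "- c"] by (simp add: power2_eq_square)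
        then show ?thesis using kap ab(1) by (simp add: ennreal_plus ennreal_mult h_def)
      qed
      also have "\<dots> \<le> ennreal (kap * s\<^sup>2 * D + kap\<^sup>2 * s\<^sup>2 * (b - a)
          + ((q - c\<^sup>2) * (b - a) + ((b + c) ^ 3 - (a + c) ^ 3) / 3))"
        using long ab(1) by (intro ennreal_leI chord_moment_inequality s0 kap) (auto simp: h_def D_def)
      also have "\<dots> \<le> ennreal (kap * s\<^sup>2) * ennreal D + ennreal (kap\<^sup>2 * s\<^sup>2) * ennreal (b - a)
          + ennreal ((q - c\<^sup>2) * (b - a) + ((b + c) ^ 3 - (a + c) ^ 3) / 3)"
      proof -
        have "0 \<le> q - c\<^sup>2" using qt0[of "- c"] by (simp add: power2_eq_square)
        moreover have "(a + c) ^ 3 \<le> (b + c) ^ 3" using ab(1) by (intro power_mono_odd) simp_all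
        ultimately show ?thesis using kap ab(1) by (simp add: ennreal_plus ennreal_mult D_def)
      qed
      also have "\<dots> \<le> ennreal (kap * s\<^sup>2) * (\<integral>\<^sup>+t. indicator (K - ?L) (line_point n u x t) \<partial>lborel)
          + ennreal (kap\<^sup>2 * s\<^sup>2) * ennreal (b - a)
          + ennreal ((q - c\<^sup>2) * (b - a) + ((b + c) ^ 3 - (a + c) ^ 3) / 3)"
        by (intro add_right_mono mult_left_mono DL) simp
      also have "\<dots> = (\<integral>\<^sup>+t. ?G (line_point n u x t) \<partial>lborel)"
      proof -
        have m: "(\<lambda>t. indicator (K - ?L) (line_point n u x t) :: ennreal) \<in> borel_measurable lborel"
          using Kd(4) L by (intro measurable_compose[OF measurable_line_point borel_measurable_indicator]
              measurable_const_leb u x) auto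
        show ?thesis
          unfolding indicator_line_point[of K] ab(2) qt
          using m ab(1) by (simp add: nn_integral_add nn_integral_cmult nn_integral_shifted_square[OF ab(1) qt0])
      qed
      finally show ?thesis .
    qed
  qed
  also have "(\<integral>\<^sup>+x. ?F x \<partial>leb n) = ennreal (kap * s\<^sup>2) * emeasure (leb n) (K - ?KR) + moment n (symm n u K)"
    using Kd Sd KR by (simp add: nn_integral_add nn_integral_cmult moment_def)
  also have "(\<integral>\<^sup>+x. ?G x \<partial>leb n) = ennreal (kap * s\<^sup>2) * emeasure (leb n) (K - ?L)
      + ennreal (kap\<^sup>2 * s\<^sup>2) * emeasure (leb n) K + moment n K"
    using Kd L by (simp add: nn_integral_add nn_integral_cmult moment_def)
  finally show ?thesis .
qed

section \<open>Bodies almost invariant under reflections\<close>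

lemma emeasure_ball_finite: "emeasure (leb n) (ball_Rn n r) < \<infinity>"
proof -
  interpret product_sigma_finite "\<lambda>_::nat. lborel :: real measure" ..
  have "emeasure (leb n) (ball_Rn n r) \<le> emeasure (leb n) (PiE {..<n} (\<lambda>_. {-\<bar>r\<bar>..\<bar>r\<bar>}))"
    by (intro emeasure_mono ball_subset_box sets_PiM_I_finite) simp_all
  also have "\<dots> = (\<Prod>i\<in>{..<n}. emeasure lborel {-\<bar>r\<bar>..\<bar>r\<bar>})"
    by (intro emeasure_PiM) simp_all
  also have "\<dots> < \<infinity>" by (simp add: power_less_top_ennreal)
  finally show ?thesis .
qed

text \<open>Projection away from the first m coordinates. The averaging step at level m takes place
  in its range and leaves those coordinates alone.\<close>

definition tail :: "nat \<Rightarrow> nat \<Rightarrow> (nat \<Rightarrow> real) \<Rightarrow> (nat \<Rightarrow> real)" where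
  "tail n m w = (\<lambda>i\<in>{..<n}. if m \<le> i then w i else 0)"

(* The reflection in this vector exchanges the m-th unit vector and the direction of tail n m w. *)
definition hdir :: "nat \<Rightarrow> nat \<Rightarrow> (nat \<Rightarrow> real) \<Rightarrow> (nat \<Rightarrow> real)" where
  "hdir n m w = (\<lambda>i\<in>{..<n}. tail n m w i - (if i = m then sqrt (inner_Rn n (tail n m w) (tail n m w)) else 0))"

lemma tail_in_Rn [simp]: "tail n m w \<in> Rn n" by (simp add: tail_def)
lemma hdir_in_Rn [simp]: "hdir n m w \<in> Rn n" by (simp add: hdir_def)

lemma tail_nth: "i < n \<Longrightarrow> tail n m w i = (if m \<le> i then w i else 0)"
  by (simp add: tail_def)

lemma hdir_nth: "i < n \<Longrightarrow> hdir n m w i = tail n m w i - (if i = m then sqrt (inner_Rn n (tail n m w) (tail n m w)) else 0)"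
  by (simp add: hdir_def)

lemma measurable_tail: "tail n m \<in> leb n \<rightarrow>\<^sub>M leb n"
  unfolding tail_def
proof (rule measurable_to_leb)
  fix i assume "i < n"
  then show "(\<lambda>w. if m \<le> i then w i else 0) \<in> borel_measurable (leb n)"
    by (cases "m \<le> i") (simp_all add: measurable_coord)
qed

lemma measurable_hdir: "hdir n m \<in> leb n \<rightarrow>\<^sub>M leb n"
  unfolding hdir_def
proof (rule measurable_to_leb)
  fix i assume i: "i < n"
  have "(\<lambda>w. tail n m w i) \<in> borel_measurable (leb n)"
    by (rule measurable_compose[OF measurable_tail measurable_coord[OF i]])
  moreover have "(\<lambda>w. sqrt (inner_Rn n (tail n m w) (tail n m w))) \<in> borel_measurable (leb n)"
    by (intro measurable_compose[OF _ borel_measurable_sqrt] measurable_inner_Rn measurable_tail)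
  ultimately show "(\<lambda>w. tail n m w i - (if i = m then sqrt (inner_Rn n (tail n m w) (tail n m w)) else 0))
      \<in> borel_measurable (leb n)"
    by (cases "i = m") simp_all
qed

lemma inner_unit_coord:
  assumes "m < n"
  shows "inner_Rn n y (\<lambda>i\<in>{..<n}. f i - (if i = m then c else 0)) = inner_Rn n y f - c * y m"
proof -
  have "inner_Rn n y (\<lambda>i\<in>{..<n}. f i - (if i = m then c else 0))
      = (\<Sum>i<n. y i * f i - (if i = m then c * y m else 0))"
    unfolding inner_Rn_def by (rule sum.cong) (auto simp: algebra_simps)
  also have "\<dots> = inner_Rn n y f - c * y m"
    using assms by (simp add: sum_subtractf inner_Rn_def)
  finally show ?thesis .
qed

text \<open>Let p be the tail of w. The vector \<open>hdir n m w\<close> is p - |p| e_m, a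
  difference of vectors of equal norm, so the reflection R exchanges p/|p| and e_m. The m-th
  coordinate of R y is therefore <R y, e_m> = <y, R e_m> = <y, p>/|p|.\<close>

lemma reflect_hdir:
  assumes m: "m < n" and t: "inner_Rn n (tail n m w) (tail n m w) \<noteq> 0"
  defines "\<nu> \<equiv> sqrt (inner_Rn n (tail n m w) (tail n m w))"
  shows "i < m \<Longrightarrow> reflect n (hdir n m w) y i = y i"
    and "reflect n (hdir n m w) y m = inner_Rn n y (tail n m w) / \<nu>"
proof -
  show "reflect n (hdir n m w) y i = y i" if "i < m"
    using m that by (simp add: reflect_nth hdir_nth tail_nth)
next
  let ?p = "tail n m w" and ?z = "hdir n m w"
  have nu: "\<nu> > 0" "\<nu>\<^sup>2 = inner_Rn n ?p ?p"
    using t inner_Rn_nonneg[of n ?p] by (auto simp: \<nu>_def simp del: inner_Rn_nonneg)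
  have yz: "inner_Rn n x ?z = inner_Rn n x ?p - \<nu> * x m" for x
    unfolding hdir_def \<nu>_def by (rule inner_unit_coord[OF m])
  have zm: "?z m = ?p m - \<nu>" using m by (simp add: hdir_nth \<nu>_def)
  have "inner_Rn n ?z ?z = inner_Rn n ?p ?z - \<nu> * ?z m"
    using yz[of ?z] by (simp add: inner_Rn_commute)
  also have "\<dots> = 2 * \<nu> * (\<nu> - ?p m)"
    unfolding yz[of ?p] zm nu(2)[symmetric] by (simp add: power2_eq_square algebra_simps)
  finally have zz: "inner_Rn n ?z ?z = 2 * \<nu> * (\<nu> - ?p m)" .
  show "reflect n ?z y m = inner_Rn n y ?p / \<nu>"
  \<comment> \<open>If p already points along e_m then \<open>hdir\<close> vanishes, the reflection
    is the identity, and the formula persists.\<close>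
  proof (cases "\<nu> = ?p m")
    case True
    then have z0: "inner_Rn n ?z ?z = 0" using zz by simp
    then have "?z i = 0" if "i < n" for i using that by (simp add: inner_Rn_eq_0)
    then have "inner_Rn n y ?z = 0" by (simp add: inner_Rn_def)
    then have "inner_Rn n y ?p = \<nu> * y m" using yz[of y] by simp
    moreover have "reflect n ?z y m = y m" using m z0 by (simp add: reflect_nth)
    ultimately show ?thesis using nu by simp
  next
    case False
    have "reflect n ?z y m = y m - 2 * (inner_Rn n y ?p - \<nu> * y m) / (2 * \<nu> * (\<nu> - ?p m)) * (?p m - \<nu>)"
      using m by (simp only: reflect_nth yz[of y] zz zm)
    also have "\<dots> = y m + (inner_Rn n y ?p - \<nu> * y m) / \<nu>"
    proof -
      have "2 * A / (2 * \<nu> * d) * (- d) = - (A / \<nu>)" if "d \<noteq> 0" for A d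
        using nu that by simp
      from this[of "\<nu> - ?p m" "inner_Rn n y ?p - \<nu> * y m"] show ?thesis using False by simp
    qed
    also have "\<dots> = inner_Rn n y ?p / \<nu>" using nu by (simp add: field_simps)
    finally show ?thesis .
  qed
qed

text \<open>For such u the reflection respects the splitting into the first m coordinates and the
  remaining ones.\<close>

lemma tail_reflect:
  assumes "\<And>i. i < m \<Longrightarrow> i < n \<Longrightarrow> u i = 0"
  shows "tail n m (reflect n u w) = reflect n u (tail n m w)"
proof (rule Rn_eqI[of _ n])
  have "inner_Rn n (tail n m w) u = inner_Rn n w u"
    unfolding inner_Rn_def by (rule sum.cong) (auto simp: tail_nth assms)
  then show "tail n m (reflect n u w) i = reflect n u (tail n m w) i" if "i < n" for i
    using that assms by (simp add: reflect_nth tail_nth)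
qed simp_all

text \<open>As x and y have equal norm, the hyperplane bisecting them passes through the origin.
  Reflections thus act transitively on spheres; if x = y, the convention for the zero vector still
  gives the claim.\<close>

lemma reflect_difference:
  assumes "x \<in> Rn n" "y \<in> Rn n" "inner_Rn n x x = inner_Rn n y y"
  shows "reflect n (line_point n y x (-1)) x = y"
proof (rule Rn_eqI[of _ n])
  fix i assume i: "i < n"
  let ?u = "line_point n y x (-1)"
  have uu: "inner_Rn n ?u ?u = 2 * inner_Rn n x ?u"
    using assms(3) inner_Rn_commute[of n x y] by simp
  show "reflect n ?u x i = y i"
  proof (cases "inner_Rn n ?u ?u = 0")
    case True
    then have "?u i = 0" using i by (simp only: inner_Rn_eq_0)
    then show ?thesis using True i by (simp add: reflect_nth)
  next
    case False
    then have "2 * inner_Rn n x ?u / inner_Rn n ?u ?u = 1" unfolding uu by simp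
    then show ?thesis using i by (simp only: reflect_nth) simp
  qed
qed (use assms in simp_all)

text \<open>Near invariance is measured in L1, which is stable under averaging, and for all z, so
  that the unnormalized vectors \<open>hdir\<close> can be inserted. Star-shapedness is what later
  makes the superlevel sets of a radial average comparable with balls.\<close>

locale near_invariant =
  fixes n :: nat and K :: "(nat \<Rightarrow> real) set" and \<delta> :: real
  assumes K_meas: "K \<in> sets (leb n)"
    and star: "\<And>x s. x \<in> K \<Longrightarrow> 0 \<le> s \<Longrightarrow> s \<le> 1 \<Longrightarrow> dil n s x \<in> K"
    and delta0: "0 \<le> \<delta>"
    and inv: "\<And>z. z \<in> Rn n \<Longrightarrow>
      (\<integral>\<^sup>+x. ennreal \<bar>indicator K (reflect n z x) - indicator K x\<bar> \<partial>leb n) \<le> ennreal \<delta>"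
begin

text \<open>f may depend only on the first m coordinates and on the norm. The recursion runs
  downwards: m = n imposes no symmetry, since a point is determined by its coordinates, m = 0 means
  radial, and n - m counts the averagings made so far, each of which adds \<delta> to the
  distance.\<close>

definition averaged :: "nat \<Rightarrow> ((nat \<Rightarrow> real) \<Rightarrow> real) \<Rightarrow> bool" where
  "averaged m f \<longleftrightarrow> f \<in> borel_measurable (leb n) \<and> (\<forall>x\<in>Rn n. 0 \<le> f x \<and> f x \<le> 1) \<and>
     (\<forall>x\<in>Rn n. \<forall>s. 0 \<le> s \<longrightarrow> s \<le> 1 \<longrightarrow> f x \<le> f (dil n s x)) \<and>
     (\<forall>x\<in>Rn n. \<forall>y\<in>Rn n. (\<forall>i<m. x i = y i) \<longrightarrow> inner_Rn n x x = inner_Rn n y y \<longrightarrow> f x = f y) \<and>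
     (\<integral>\<^sup>+x. ennreal \<bar>f x - indicator K x\<bar> \<partial>leb n) \<le> ennreal (real (n - m) * \<delta>)"

lemma averaged_indicator: "averaged n (indicator K)"
proof -
  have 1: "indicator K x = (indicator K y :: real)"
    if "x \<in> Rn n" "y \<in> Rn n" "\<forall>i<n. x i = y i" for x y
  proof -
    have "x = y" by (rule Rn_eqI[OF that(1,2)]) (use that(3) in blast)
    then show ?thesis by simp
  qed
  have 2: "indicator K x \<le> (indicator K (dil n s x) :: real)" if "0 \<le> s" "s \<le> 1" for x s
    using star[of x s] that by (simp add: indicator_def)
  show ?thesis unfolding averaged_def
  proof (intro conjI ballI allI impI)
    show "(indicator K :: _ \<Rightarrow> real) \<in> borel_measurable (leb n)" using K_meas by simp
  qed (rule 1 2 indicator_pos_le indicator_le_1 | assumption | simp)+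
qed

text \<open>g averages f over the reflections that turn the direction of a random tail into e_m. If
  x and y share m coordinates and the norm, the reflection T taking x to y fixes the first m
  coordinates of every vector and preserves the distribution of w; replacing w by T w carries the
  average at x into the average at y.\<close>

lemma averaged_step:
  assumes m: "m < n" and f: "averaged (Suc m) f"
  shows "\<exists>g. averaged m g"
proof -
  \<comment> \<open>The unit ball gives a finite measure invariant under reflections. Vectors with
    zero tail are left out because they determine no direction.\<close>
  define W where "W = {w \<in> Rn n. inner_Rn n w w \<le> 1 \<and> inner_Rn n (tail n m w) (tail n m w) \<noteq> 0}"
  define N where "N = uniform_measure (leb n) W"
  let ?H = "\<lambda>w x. reflect n (hdir n m w) x"
  have f_meas: "f \<in> borel_measurable (leb n)" and f01: "\<And>x. x \<in> Rn n \<Longrightarrow> 0 \<le> f x \<and> f x \<le> 1"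
    and f_star: "\<And>x s. x \<in> Rn n \<Longrightarrow> 0 \<le> s \<Longrightarrow> s \<le> 1 \<Longrightarrow> f x \<le> f (dil n s x)"
    and f_inv: "\<And>x y. x \<in> Rn n \<Longrightarrow> y \<in> Rn n \<Longrightarrow> (\<And>i. i < Suc m \<Longrightarrow> x i = y i) \<Longrightarrow>
        inner_Rn n x x = inner_Rn n y y \<Longrightarrow> f x = f y"
    and f_dist: "(\<integral>\<^sup>+x. ennreal \<bar>f x - indicator K x\<bar> \<partial>leb n) \<le> ennreal (real (n - Suc m) * \<delta>)"
    using f unfolding averaged_def by blast+
  have W: "W \<in> sets (leb n)"
  proof -
    have [measurable]: "(\<lambda>w. inner_Rn n (tail n m w) (tail n m w)) \<in> borel_measurable (leb n)"
      by (intro measurable_inner_Rn measurable_tail)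
    have "{w \<in> space (leb n). inner_Rn n w w \<le> 1 \<and> inner_Rn n (tail n m w) (tail n m w) \<noteq> 0} \<in> sets (leb n)"
      by measurable
    then show ?thesis by (simp add: W_def space_leb)
  qed
  have Wfin: "emeasure (leb n) W \<noteq> \<infinity>"
  proof -
    have "emeasure (leb n) W \<le> emeasure (leb n) (ball_Rn n 1)"
      by (intro emeasure_mono) (auto simp: W_def ball_Rn_def)
    then show ?thesis using emeasure_ball_finite[of n 1] by (auto simp: top_unique)
  qed
  have W0: "emeasure (leb n) W \<noteq> 0"
  proof -
    interpret product_sigma_finite "\<lambda>_::nat. lborel :: real measure" ..
    \<comment> \<open>On this cube every coordinate is positive, so the tail is nonzero, and w_i^2
      \<le> w_i \<le> 1/n keeps it inside the unit ball.\<close>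
    let ?B = "PiE {..<n} (\<lambda>_. {1 / (2 * real n)..1 / real n})"
    have "?B \<subseteq> W"
    proof
      fix w assume w: "w \<in> ?B"
      have wi: "1 / (2 * real n) \<le> w i" "w i \<le> 1 / real n" if "i < n" for i
        using PiE_mem[OF w, of i] that by simp_all
      have w0: "0 < w i" if "i < n" for i
      proof -
        have "0 < 1 / (2 * real n)" using that by simp
        then show ?thesis using wi(1)[OF that] by linarith
      qed
      have "inner_Rn n w w \<le> (\<Sum>i<n. 1 / real n)" unfolding inner_Rn_def
      proof (rule sum_mono)
        fix i assume i: "i \<in> {..<n}"
        have "w i * w i \<le> w i * 1"
        proof (rule mult_left_mono)
          have "1 / real n \<le> 1" using i by simp
          then show "w i \<le> 1" using wi(2)[of i] i by (meson lessThan_iff order_trans)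
        qed (use w0[of i] i in simp)
        then show "w i * w i \<le> 1 / real n" using wi(2)[of i] i by simp
      qed
      then have 1: "inner_Rn n w w \<le> 1" using m by simp
      have "tail n m w m \<noteq> 0" using w0[OF m] m by (simp add: tail_nth)
      then have "inner_Rn n (tail n m w) (tail n m w) \<noteq> 0" using m by (auto simp: inner_Rn_eq_0)
      moreover have "w \<in> Rn n" using w by (auto simp: PiE_def)
      ultimately show "w \<in> W" using 1 by (simp add: W_def)
    qed
    then have "emeasure (leb n) ?B \<le> emeasure (leb n) W" using W by (rule emeasure_mono)
    moreover have "emeasure (leb n) ?B = (\<Prod>i\<in>{..<n}. emeasure lborel {1 / (2 * real n)..1 / real n})"
      by (intro emeasure_PiM) simp_all
    moreover have "emeasure lborel {1 / (2 * real n)..1 / real n} \<noteq> 0"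
      using m by (simp add: field_simps)
    ultimately show ?thesis by auto
  qed
  have setsN: "sets N = sets (leb n)" and spaceN: "space N = Rn n"
    by (simp_all add: N_def space_leb)
  have N1: "emeasure N (space N) = 1"
    unfolding N_def using W W0 Wfin sets.sets_into_space[OF W]
    by (simp add: Int_absorb2 divide_eq_1_ennreal)
  interpret N: finite_measure N by standard (simp add: N1)
  interpret L: sigma_finite_measure "leb n" by (rule sigma_finite_leb)
  interpret P: pair_sigma_finite "leb n" N ..
  have W_ae: "AE w in N. w \<in> W" unfolding N_def by (rule AE_uniform_measureI[OF W]) simp
  have Hm2: "(\<lambda>p. ?H (snd p) (fst p)) \<in> leb n \<Otimes>\<^sub>M N \<rightarrow>\<^sub>M leb n"
  proof (intro measurable_reflect measurable_fst)
    have "snd \<in> leb n \<Otimes>\<^sub>M N \<rightarrow>\<^sub>M leb n" using measurable_snd[of "leb n" N] setsN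
      by (simp cong: measurable_cong_sets)
    then show "(\<lambda>p. hdir n m (snd p)) \<in> leb n \<Otimes>\<^sub>M N \<rightarrow>\<^sub>M leb n"
      by (rule measurable_compose[OF _ measurable_hdir])
  qed
  have Hmw: "(\<lambda>w. ?H w x) \<in> N \<rightarrow>\<^sub>M leb n" if "x \<in> Rn n" for x
    using measurable_reflect[OF measurable_hdir measurable_const_leb[OF that]] setsN
    by (simp cong: measurable_cong_sets)
  have Hmx: "(\<lambda>x. ?H w x) \<in> leb n \<rightarrow>\<^sub>M leb n" for w
    by (intro measurable_reflect measurable_const_leb measurable_ident_sets) simp_all
  have fHm: "(\<lambda>w. f (?H w x)) \<in> borel_measurable N" if "x \<in> Rn n" for x
    by (rule measurable_compose[OF Hmw[OF that] f_meas])
  have fHi: "integrable N (\<lambda>w. f (?H w x))" if "x \<in> Rn n" for x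
    using f01 by (intro N.integrable_const_bound[of _ 1] fHm that) (simp add: abs_le_iff order.trans[of _ 0])
  define g where "g = (\<lambda>x. \<integral>w. f (?H w x) \<partial>N)"
  have g_meas: "g \<in> borel_measurable (leb n)"
    unfolding g_def
    by (rule N.borel_measurable_lebesgue_integral)
      (use measurable_compose[OF Hm2 f_meas] in \<open>simp add: split_def\<close>)
  have N1': "measure N (Rn n) = 1" using N1 by (simp add: measure_def spaceN)
  have g01: "0 \<le> g x \<and> g x \<le> 1" if x: "x \<in> Rn n" for x
  proof
    show "0 \<le> g x" unfolding g_def using f01 by (intro integral_nonneg_AE) simp
    have "g x \<le> (\<integral>w. 1 \<partial>N)" unfolding g_def
      using f01 by (intro integral_mono fHi x) simp_all
    then show "g x \<le> 1" by (simp add: N1' spaceN)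
  qed
  have g_star: "g x \<le> g (dil n s x)" if x: "x \<in> Rn n" and s: "0 \<le> s" "s \<le> 1" for x s
    unfolding g_def reflect_dil
  proof (rule integral_mono)
    show "integrable N (\<lambda>w. f (?H w x))" by (rule fHi[OF x])
    show "integrable N (\<lambda>w. f (dil n s (?H w x)))" using fHi[of "dil n s x"] by (simp add: reflect_dil)
    show "f (?H w x) \<le> f (dil n s (?H w x))" for w by (rule f_star[OF _ s]) simp
  qed
  have g_inv: "g x = g y"
    if x: "x \<in> Rn n" and y: "y \<in> Rn n" and xy: "\<And>i. i < m \<Longrightarrow> x i = y i" "inner_Rn n x x = inner_Rn n y y" for x y
  proof -
    let ?u = "line_point n y x (-1)"
    let ?T = "reflect n ?u"
    have u0: "?u i = 0" if "i < m" "i < n" for i using xy(1)[OF that(1)] that(2) by simp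
    have Tx: "?T x = y" by (rule reflect_difference[OF x y xy(2)])
    have Tm: "?T \<in> leb n \<rightarrow>\<^sub>M leb n"
      by (intro measurable_reflect measurable_const_leb measurable_ident_sets) simp_all
    have TmN: "?T \<in> N \<rightarrow>\<^sub>M N" using Tm setsN by (simp cong: measurable_cong_sets)
    have tT: "inner_Rn n (tail n m (?T w)) (tail n m (?T w)) = inner_Rn n (tail n m w) (tail n m w)" for w
      by (simp only: tail_reflect[of m n ?u, OF u0] inner_reflect_reflect)
    have TW: "?T w \<in> W \<longleftrightarrow> w \<in> W" if "w \<in> Rn n" for w
      using that by (simp add: W_def tT inner_reflect_reflect del: inner_line_point_left inner_line_point_right)
    \<comment> \<open>T preserves Lebesgue measure and maps W to itself, as it changes neither the
      norm of w nor that of its tail.\<close>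
    have distrN: "distr N N ?T = N"
    proof (rule measure_eqI)
      fix A assume "A \<in> sets (distr N N ?T)"
      then have A: "A \<in> sets (leb n)" using setsN by simp
      have TA: "?T -` A \<inter> Rn n \<in> sets (leb n)" using measurable_sets[OF Tm A] by (simp add: space_leb)
      have "emeasure (distr N N ?T) A = emeasure N (?T -` A \<inter> Rn n)"
        using A setsN by (simp add: emeasure_distr[OF TmN] spaceN)
      also have "\<dots> = emeasure (leb n) (W \<inter> (?T -` A \<inter> Rn n)) / emeasure (leb n) W"
        unfolding N_def by (rule emeasure_uniform_measure[OF W TA])
      also have "W \<inter> (?T -` A \<inter> Rn n) = ?T -` (W \<inter> A) \<inter> space (leb n)"
        using TW by (auto simp: space_leb W_def)
      also have "emeasure (leb n) (?T -` (W \<inter> A) \<inter> space (leb n)) = emeasure (distr (leb n) (leb n) ?T) (W \<inter> A)"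
        using W A by (intro emeasure_distr[OF Tm, symmetric]) auto
      also have "distr (leb n) (leb n) ?T = leb n" by (rule distr_reflect) simp
      also have "emeasure (leb n) (W \<inter> A) / emeasure (leb n) W = emeasure N A"
        unfolding N_def by (rule emeasure_uniform_measure[OF W A, symmetric])
      finally show "emeasure (distr N N ?T) A = emeasure N A" .
    qed simp
    \<comment> \<open>At level \<open>Suc m\<close>, f sees the norm and the coordinates up to m.
      Those below m are untouched by both reflections; the m-th is <x, tail (T w)> / |tail w| = <T
      x, tail w> / |tail w| with T x = y.\<close>
    have key: "f (?H (?T w) x) = f (?H w y)" if w: "w \<in> W" for w
    proof (rule f_inv)
      have t: "inner_Rn n (tail n m w) (tail n m w) \<noteq> 0" using w by (auto simp: W_def)
      have tT': "inner_Rn n (tail n m (?T w)) (tail n m (?T w)) \<noteq> 0" using t unfolding tT .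
      fix i assume i: "i < Suc m"
      show "?H (?T w) x i = ?H w y i"
      proof (cases "i = m")
        case True
        have "inner_Rn n x (tail n m (?T w)) = inner_Rn n y (tail n m w)"
          by (simp only: tail_reflect[of m n ?u, OF u0] inner_reflect_swap[symmetric] Tx)
        then show ?thesis
          by (simp only: True reflect_hdir(2)[OF m tT'] reflect_hdir(2)[OF m t] tT)
      next
        case False
        then have "i < m" using i by simp
        then show ?thesis by (simp only: reflect_hdir(1)[OF m tT'] reflect_hdir(1)[OF m t] xy(1))
      qed
    qed (simp_all only: inner_reflect_reflect xy reflect_in_Rn)
    have "g x = (\<integral>w. f (?H w x) \<partial>distr N N ?T)" by (simp add: g_def distrN)
    also have "\<dots> = (\<integral>w. f (?H (?T w) x) \<partial>N)"
      by (rule integral_distr[OF TmN fHm[OF x]])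
    also have "\<dots> = (\<integral>w. f (?H w y) \<partial>N)"
    proof (rule integral_cong_AE)
      show "(\<lambda>w. f (?H (?T w) x)) \<in> borel_measurable N" by (rule measurable_compose[OF TmN fHm[OF x]])
      show "AE w in N. f (?H (?T w) x) = f (?H w y)" using W_ae by eventually_elim (rule key)
    qed (rule fHm[OF y])
    also have "\<dots> = g y" by (simp add: g_def)
    finally show ?thesis .
  qed
  have i_meas: "(\<lambda>x. indicator K x :: real) \<in> borel_measurable (leb n)" using K_meas by simp
  have diff_meas: "(\<lambda>p. ennreal \<bar>f (?H (snd p) (fst p)) - indicator K (fst p)\<bar>) \<in> borel_measurable (leb n \<Otimes>\<^sub>M N)"
    by (intro measurable_compose[OF _ measurable_ennreal] borel_measurable_abs borel_measurable_diff
        measurable_compose[OF Hm2 f_meas] measurable_compose[OF measurable_fst i_meas])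
  have "(\<integral>\<^sup>+x. ennreal \<bar>g x - indicator K x\<bar> \<partial>leb n)
      \<le> (\<integral>\<^sup>+x. (\<integral>\<^sup>+w. ennreal \<bar>f (?H w x) - indicator K x\<bar> \<partial>N) \<partial>leb n)"
  proof (rule nn_integral_mono)
    fix x assume "x \<in> space (leb n)"
    then have x: "x \<in> Rn n" by (simp add: space_leb)
    have i: "integrable N (\<lambda>w. f (?H w x) - indicator K x)"
      by (intro Bochner_Integration.integrable_diff fHi x N.integrable_const)
    have "g x - indicator K x = (\<integral>w. f (?H w x) - indicator K x \<partial>N)"
      unfolding g_def by (subst Bochner_Integration.integral_diff[OF fHi[OF x]]) (simp_all add: N1' spaceN)
    then show "ennreal \<bar>g x - indicator K x\<bar> \<le> (\<integral>\<^sup>+w. ennreal \<bar>f (?H w x) - indicator K x\<bar> \<partial>N)"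
      using integral_norm_bound_ennreal[OF i] by simp
  qed
  also have "\<dots> = (\<integral>\<^sup>+w. (\<integral>\<^sup>+x. ennreal \<bar>f (?H w x) - indicator K x\<bar> \<partial>leb n) \<partial>N)"
    using P.Fubini'[of "\<lambda>x w. ennreal \<bar>f (?H w x) - indicator K x\<bar>"] diff_meas by (simp add: split_def)
  also have "\<dots> \<le> (\<integral>\<^sup>+w. ennreal (real (n - Suc m) * \<delta>) + ennreal \<delta> \<partial>N)"
  proof (rule nn_integral_mono)
    fix w
    have m1: "(\<lambda>x. ennreal \<bar>f x - indicator K x\<bar>) \<in> borel_measurable (leb n)"
      using f_meas i_meas by measurable
    have m2: "(\<lambda>x. ennreal \<bar>indicator K (?H w x) - indicator K x\<bar>) \<in> borel_measurable (leb n)"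
      using measurable_compose[OF Hmx i_meas] i_meas by measurable
    \<comment> \<open>With H the reflection for w: f \<circ> H is as close to 1_K \<circ> H as f is
      to 1_K because H preserves the measure, and passing from 1_K \<circ> H to 1_K costs one
      \<delta>.\<close>
    have "(\<integral>\<^sup>+x. ennreal \<bar>f (?H w x) - indicator K x\<bar> \<partial>leb n)
        \<le> (\<integral>\<^sup>+x. ennreal \<bar>f (?H w x) - indicator K (?H w x)\<bar> + ennreal \<bar>indicator K (?H w x) - indicator K x\<bar> \<partial>leb n)"
      by (intro nn_integral_mono) (simp add: ennreal_plus[symmetric] del: ennreal_plus)
    also have "\<dots> = (\<integral>\<^sup>+x. ennreal \<bar>f (?H w x) - indicator K (?H w x)\<bar> \<partial>leb n)
        + (\<integral>\<^sup>+x. ennreal \<bar>indicator K (?H w x) - indicator K x\<bar> \<partial>leb n)"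
      by (rule nn_integral_add[OF measurable_compose[OF Hmx m1] m2])
    also have "(\<integral>\<^sup>+x. ennreal \<bar>f (?H w x) - indicator K (?H w x)\<bar> \<partial>leb n)
        = (\<integral>\<^sup>+x. ennreal \<bar>f x - indicator K x\<bar> \<partial>leb n)"
      by (rule nn_integral_reflect[OF _ m1]) simp
    finally show "(\<integral>\<^sup>+x. ennreal \<bar>f (?H w x) - indicator K x\<bar> \<partial>leb n) \<le> ennreal (real (n - Suc m) * \<delta>) + ennreal \<delta>"
      using add_mono[OF f_dist inv[of "hdir n m w"]] by simp
  qed
  also have "\<dots> = ennreal (real (n - m) * \<delta>)"
  proof -
    have "real (n - Suc m) * \<delta> + \<delta> = real (n - m) * \<delta>"
      using m by (simp add: of_nat_diff algebra_simps)
    then show ?thesis using delta0 N1 by (simp add: ennreal_plus[symmetric] del: ennreal_plus)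
  qed
  finally have "averaged m g"
    unfolding averaged_def using g_meas g01 g_star g_inv by blast
  then show ?thesis by blast
qed

lemma averaged_exists: "m \<le> n \<Longrightarrow> \<exists>f. averaged m f"
proof (induction m rule: inc_induct)
  case base
  show ?case using averaged_indicator by blast
next
  case (step m)
  then show ?case using averaged_step by blast
qed

text \<open>The set B of points with f \<ge> 1/2 is nested with the unit ball, since f is radial and
  does not increase along rays. Nested sets differ by the difference of their volumes, and |D_n| =
  |K|, so |B \<Delta> D_n| \<le> |K \<Delta> B|. A Markov-type estimate bounds |K \<Delta> B| by
  2*n*\<delta>, and the triangle inequality doubles this.\<close>

lemma close_to_ball:
  assumes vol: "emeasure (leb n) K = emeasure (leb n) (ball_Rn n 1)"
  shows "emeasure (leb n) (sym_diff K (ball_Rn n 1)) \<le> ennreal (4 * real n * \<delta>)"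
proof -
  obtain f where f: "averaged 0 f" using averaged_exists[of 0] by auto
  have f_meas: "f \<in> borel_measurable (leb n)"
    and f_star: "\<And>x s. x \<in> Rn n \<Longrightarrow> 0 \<le> s \<Longrightarrow> s \<le> 1 \<Longrightarrow> f x \<le> f (dil n s x)"
    and f_dist: "(\<integral>\<^sup>+x. ennreal \<bar>f x - indicator K x\<bar> \<partial>leb n) \<le> ennreal (real (n - 0) * \<delta>)"
    and inv0: "\<forall>x\<in>Rn n. \<forall>y\<in>Rn n. (\<forall>i<0::nat. x i = y i) \<longrightarrow> inner_Rn n x x = inner_Rn n y y \<longrightarrow> f x = f y"
    using f unfolding averaged_def by blast+
  have f_inv: "f x = f y" if "x \<in> Rn n" "y \<in> Rn n" "inner_Rn n x x = inner_Rn n y y" for x y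
    using inv0 that by (metis not_less0)
  define B where "B = {x \<in> Rn n. 1 / 2 \<le> f x}"
  let ?D = "ball_Rn n 1"
  have B: "B \<in> sets (leb n)"
  proof -
    have "{x \<in> space (leb n). 1 / 2 \<le> f x} \<in> sets (leb n)" using f_meas by measurable
    then show ?thesis by (simp add: B_def space_leb)
  qed
  have B_down: "y \<in> B" if x: "x \<in> B" and y: "y \<in> Rn n" and le: "inner_Rn n y y \<le> inner_Rn n x x" for x y
  proof (cases "inner_Rn n x x = 0")
    case True
    then have "inner_Rn n x x = inner_Rn n y y" using le inner_Rn_nonneg[of n y] by linarith
    then have "f x = f y" using x y by (intro f_inv) (simp_all add: B_def)
    then show ?thesis using x y by (simp add: B_def)
  next
    case False
    \<comment> \<open>Shrinking x to the norm of y does not lower f; after that, f being radial, the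
      value at y is the same.\<close>
    define s where "s = sqrt (inner_Rn n y y / inner_Rn n x x)"
    have pos: "inner_Rn n x x > 0" using False inner_Rn_nonneg[of n x] by linarith
    have s: "0 \<le> s" "s \<le> 1" using le pos by (simp_all add: s_def)
    have "s * s = inner_Rn n y y / inner_Rn n x x" using pos by (simp add: s_def)
    then have "inner_Rn n (dil n s x) (dil n s x) = inner_Rn n y y"
      using pos by (simp add: mult.assoc[symmetric])
    then have "f (dil n s x) = f y" using y by (intro f_inv) simp_all
    then show ?thesis using f_star[of x s] s x y by (simp add: B_def)
  qed
  have KB: "emeasure (leb n) (sym_diff K B) \<le> ennreal (2 * (real n * \<delta>))"
  proof -
    have "emeasure (leb n) (sym_diff K B) = (\<integral>\<^sup>+x. indicator (sym_diff K B) x \<partial>leb n)"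
      using K_meas B by simp
    also have "\<dots> \<le> (\<integral>\<^sup>+x. 2 * ennreal \<bar>f x - indicator K x\<bar> \<partial>leb n)"
    proof (rule nn_integral_mono)
      fix x assume "x \<in> space (leb n)"
      then have x: "x \<in> Rn n" by (simp add: space_leb)
      show "indicator (sym_diff K B) x \<le> 2 * ennreal \<bar>f x - indicator K x\<bar>"
      proof (cases "x \<in> sym_diff K B")
        case True
        then have "x \<in> K \<and> f x < 1 / 2 \<or> x \<notin> K \<and> 1 / 2 \<le> f x"
          using x unfolding B_def by (simp add: not_le) linarith
        then have "1 \<le> 2 * \<bar>f x - indicator K x\<bar>"
        proof (elim disjE conjE)
          assume "x \<in> K" "f x < 1 / 2"
          then have e: "\<bar>f x - indicator K x\<bar> = 1 - f x" by simp
          show ?thesis unfolding e using \<open>f x < 1 / 2\<close> by simp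
        next
          assume "x \<notin> K" "1 / 2 \<le> f x"
          then have e: "\<bar>f x - indicator K x\<bar> = f x" by simp
          show ?thesis unfolding e using \<open>1 / 2 \<le> f x\<close> by simp
        qed
        then have "ennreal 1 \<le> ennreal (2 * \<bar>f x - indicator K x\<bar>)" by (rule ennreal_leI)
        then show ?thesis using True by (simp add: ennreal_mult)
      qed simp
    qed
    also have "\<dots> = 2 * (\<integral>\<^sup>+x. ennreal \<bar>f x - indicator K x\<bar> \<partial>leb n)"
    proof (rule nn_integral_cmult)
      have "(\<lambda>x. indicator K x :: real) \<in> borel_measurable (leb n)" using K_meas by simp
      then show "(\<lambda>x. ennreal \<bar>f x - indicator K x\<bar>) \<in> borel_measurable (leb n)"
        using f_meas by measurable
    qed
    also have "\<dots> \<le> 2 * ennreal (real n * \<delta>)" using mult_left_mono[OF f_dist, of 2] by simp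
    also have "\<dots> = ennreal (2 * (real n * \<delta>))" using delta0 by (simp add: ennreal_mult)
    finally show ?thesis .
  qed
  have D: "?D \<in> sets (leb n)" by (rule ball_measurable)
  have Dfin: "emeasure (leb n) ?D < \<infinity>" by (rule emeasure_ball_finite)
  have nested: "B \<subseteq> ?D \<or> ?D \<subseteq> B"
  proof (cases "B \<subseteq> ?D")
    case False
    then obtain x where x: "x \<in> B" "x \<notin> ?D" by blast
    then have "1 < inner_Rn n x x" by (simp add: B_def ball_Rn_def not_le)
    then have "?D \<subseteq> B" using B_down[OF x(1)] by (fastforce simp: ball_Rn_def)
    then show ?thesis ..
  qed simp
  have BD: "emeasure (leb n) (sym_diff B ?D) \<le> emeasure (leb n) (sym_diff K B)"
    using nested
  proof
    assume sub: "B \<subseteq> ?D"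
    have fin: "emeasure (leb n) B \<noteq> \<infinity>" using emeasure_mono[OF sub D] Dfin by (auto simp: top_unique)
    have "emeasure (leb n) (sym_diff B ?D) = emeasure (leb n) (?D - B)" using sub by (simp add: Diff_eq_empty_iff[THEN iffD2])
    also have "\<dots> = emeasure (leb n) K - emeasure (leb n) B" using emeasure_Diff[OF fin D B sub] vol by simp
    also have "\<dots> \<le> emeasure (leb n) (K - B)"
    proof -
      have "emeasure (leb n) K \<le> emeasure (leb n) (B \<union> (K - B))" using B K_meas by (intro emeasure_mono) auto
      also have "\<dots> \<le> emeasure (leb n) B + emeasure (leb n) (K - B)" using B K_meas by (intro emeasure_subadditive) auto
      finally show ?thesis using fin by (simp add: ennreal_minus_le_iff)
    qed
    also have "\<dots> \<le> emeasure (leb n) (sym_diff K B)" using B K_meas by (intro emeasure_mono) auto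
    finally show ?thesis .
  next
    assume sub: "?D \<subseteq> B"
    have "emeasure (leb n) (sym_diff B ?D) = emeasure (leb n) (B - ?D)" using sub by (simp add: Diff_eq_empty_iff[THEN iffD2])
    also have "\<dots> = emeasure (leb n) B - emeasure (leb n) K" using emeasure_Diff[OF _ B D sub] Dfin vol by simp
    also have "\<dots> \<le> emeasure (leb n) (B - K)"
    proof -
      have "emeasure (leb n) B \<le> emeasure (leb n) (K \<union> (B - K))" using B K_meas by (intro emeasure_mono) auto
      also have "\<dots> \<le> emeasure (leb n) K + emeasure (leb n) (B - K)" using B K_meas by (intro emeasure_subadditive) auto
      finally show ?thesis using Dfin vol by (auto simp add: ennreal_minus_le_iff)
    qed
    also have "\<dots> \<le> emeasure (leb n) (sym_diff K B)" using B K_meas by (intro emeasure_mono) auto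
    finally show ?thesis .
  qed
  have "emeasure (leb n) (sym_diff K ?D) \<le> emeasure (leb n) (sym_diff K B \<union> sym_diff B ?D)"
    using K_meas B D by (intro emeasure_mono) auto
  also have "\<dots> \<le> emeasure (leb n) (sym_diff K B) + emeasure (leb n) (sym_diff B ?D)"
    using K_meas B D by (intro emeasure_subadditive) auto
  also have "\<dots> \<le> ennreal (2 * (real n * \<delta>)) + ennreal (2 * (real n * \<delta>))"
    using KB BD by (intro add_mono) auto
  also have "\<dots> = ennreal (4 * real n * \<delta>)"
    using delta0 by (simp add: ennreal_plus[symmetric] del: ennreal_plus)
  finally show ?thesis .
qed

end

section \<open>Descent of the second moment\<close>

lemma dil_image:
  assumes "c > 0" "A \<subseteq> Rn n"
  shows "dil n c ` A = {x \<in> Rn n. dil n (1 / c) x \<in> A}"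
proof (intro set_eqI iffI)
  fix x assume "x \<in> dil n c ` A"
  then obtain a where a: "a \<in> A" "x = dil n c a" by blast
  have "dil n (1 / c) (dil n c a) = a"
    by (rule Rn_eqI[of _ n]) (use a assms in auto)
  then show "x \<in> {x \<in> Rn n. dil n (1 / c) x \<in> A}" using a by simp
next
  fix x assume x: "x \<in> {x \<in> Rn n. dil n (1 / c) x \<in> A}"
  have "dil n c (dil n (1 / c) x) = x"
    by (rule Rn_eqI[of _ n]) (use x assms(1) in simp_all)
  then show "x \<in> dil n c ` A" using x by (metis (mono_tags, lifting) image_eqI mem_Collect_eq)
qed

lemma dil_image_measurable:
  assumes "c > 0" "A \<in> sets (leb n)"
  shows "dil n c ` A \<in> sets (leb n)"
proof -
  have "dil n (1 / c) \<in> leb n \<rightarrow>\<^sub>M leb n"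
    using measurable_dil[OF measurable_ident_sets[OF refl] measurable_const] by simp
  from measurable_sets[OF this assms(2)]
  have "{x \<in> Rn n. dil n (1 / c) x \<in> A} \<in> sets (leb n)"
    by (simp add: space_leb vimage_def Int_def conj_commute)
  then show ?thesis
    using dil_image[OF assms(1)] sets.sets_into_space[OF assms(2)] by (simp add: space_leb)
qed

lemma emeasure_dil:
  assumes c: "c > 0" and A: "A \<in> sets (leb n)"
  shows "emeasure (leb n) (dil n c ` A) = ennreal (c ^ n) * emeasure (leb n) A"
proof -
  have sub: "A \<subseteq> Rn n" using sets.sets_into_space[OF A] by (simp add: space_leb)
  have m: "dil n c ` A \<in> sets (leb n)" by (rule dil_image_measurable[OF c A])
  have *: "dil n c x \<in> dil n c ` A \<longleftrightarrow> x \<in> A" if "x \<in> Rn n" for x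
  proof -
    have "dil n (1 / c) (dil n c x) = x" by (rule Rn_eqI[of _ n]) (use that c in simp_all)
    then show ?thesis by (simp add: dil_image[OF c sub])
  qed
  have "emeasure (leb n) (dil n c ` A) = (\<integral>\<^sup>+x. indicator (dil n c ` A) x \<partial>leb n)" using m by simp
  also have "\<dots> = ennreal (c ^ n) * (\<integral>\<^sup>+x. indicator (dil n c ` A) (dil n c x) \<partial>leb n)"
    by (rule nn_integral_leb_dil[OF c]) (use m in simp)
  also have "(\<integral>\<^sup>+x. indicator (dil n c ` A) (dil n c x) \<partial>leb n) = (\<integral>\<^sup>+x. indicator A x \<partial>leb n)"
    by (intro nn_integral_cong) (simp add: indicator_def * space_leb)
  finally show ?thesis using A by simp
qed

lemma dil_ball:
  assumes "c > 0"
  shows "dil n c ` ball_Rn n r = ball_Rn n (c * r)"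
proof -
  have "ball_Rn n r \<subseteq> Rn n" by (auto simp: ball_Rn_def)
  moreover have "1 / c * (1 / c * inner_Rn n x x) \<le> r\<^sup>2 \<longleftrightarrow> inner_Rn n x x \<le> (c * r)\<^sup>2" for x
    using assms by (simp add: field_simps power2_eq_square)
  ultimately show ?thesis using dil_image[OF assms, of "ball_Rn n r" n] by (simp add: ball_Rn_def)
qed

lemma emeasure_ball: "r > 0 \<Longrightarrow> emeasure (leb n) (ball_Rn n r) = ennreal (r ^ n) * emeasure (leb n) (ball_Rn n 1)"
  using emeasure_dil[of r "ball_Rn n 1" n] dil_ball[of r n 1] by (simp add: ball_measurable)

lemma emeasure_ball_pos:
  assumes "n > 0"
  shows "emeasure (leb n) (ball_Rn n 1) > 0"
proof -
  interpret product_sigma_finite "\<lambda>_::nat. lborel :: real measure" ..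
  let ?B = "PiE {..<n} (\<lambda>_. {0..1 / real n})"
  have "?B \<subseteq> ball_Rn n 1"
  proof
    fix w assume w: "w \<in> ?B"
    have wi: "0 \<le> w i" "w i \<le> 1 / real n" if "i < n" for i
      using PiE_mem[OF w, of i] that by simp_all
    have "inner_Rn n w w \<le> (\<Sum>i<n. 1 / real n)" unfolding inner_Rn_def
    proof (rule sum_mono)
      fix i assume i: "i \<in> {..<n}"
      have "1 / real n \<le> 1" using i by simp
      then have "w i \<le> 1" using wi(2)[of i] i by (meson lessThan_iff order_trans)
      then have "w i * w i \<le> w i * 1" using wi(1)[of i] i by (intro mult_left_mono) simp_all
      then show "w i * w i \<le> 1 / real n" using wi(2)[of i] i by simp
    qed
    then have "inner_Rn n w w \<le> 1" using assms by simp
    moreover have "w \<in> Rn n" using w by (auto simp: PiE_def)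
    ultimately show "w \<in> ball_Rn n 1" by (simp add: ball_Rn_def)
  qed
  then have "emeasure (leb n) ?B \<le> emeasure (leb n) (ball_Rn n 1)"
    by (rule emeasure_mono) (rule ball_measurable)
  moreover have "emeasure (leb n) ?B = (\<Prod>i\<in>{..<n}. emeasure lborel {0..1 / real n})"
    by (intro emeasure_PiM) simp_all
  moreover have "emeasure lborel {0..1 / real n} \<noteq> 0"
    using assms by simp
  ultimately have "emeasure (leb n) (ball_Rn n 1) \<noteq> 0" by auto
  then show ?thesis by (simp only: zero_less_iff_neq_zero not_False_eq_True)
qed

section \<open>Choice of a direction and iteration\<close>

lemma convex_star:
  assumes "convex_Rn n K" "(\<lambda>i\<in>{..<n}. 0) \<in> K" "x \<in> K" "0 \<le> s" "s \<le> 1"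
  shows "dil n s x \<in> K"
proof -
  have "(\<lambda>i\<in>{..<n}. (1 - s) * (\<lambda>i\<in>{..<n}. 0) i + s * x i) \<in> K"
    using assms by (intro convex_RnD)
  also have "(\<lambda>i\<in>{..<n}. (1 - s) * (\<lambda>i\<in>{..<n}. 0) i + s * x i) = dil n s x"
    by (rule Rn_eqI[of _ n]) simp_all
  finally show ?thesis .
qed

text \<open>The reflection is an involution preserving the measure, so as much volume enters K as
  leaves it; hence the factor 2. For z = 0 the reflection is the identity and costs nothing.\<close>

lemma near_invariantI:
  assumes K: "K \<in> sets (leb n)"
    and star: "\<And>x s. x \<in> K \<Longrightarrow> 0 \<le> s \<Longrightarrow> s \<le> 1 \<Longrightarrow> dil n s x \<in> K"
    and \<eta>: "0 \<le> \<eta>"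
    and u: "\<And>u. u \<in> Rn n \<Longrightarrow> inner_Rn n u u = 1 \<Longrightarrow>
      emeasure (leb n) (K - {x \<in> Rn n. reflect n u x \<in> K}) \<le> ennreal \<eta>"
  shows "near_invariant n K (2 * \<eta>)"
proof
  fix z assume z: "z \<in> Rn n"
  show "(\<integral>\<^sup>+x. ennreal \<bar>indicator K (reflect n z x) - indicator K x\<bar> \<partial>leb n) \<le> ennreal (2 * \<eta>)"
  proof (cases "inner_Rn n z z = 0")
    case True
    then have "z i = 0" if "i < n" for i using that by (simp add: inner_Rn_eq_0)
    then have "reflect n z x = x" if "x \<in> Rn n" for x
      using that by (intro Rn_eqI[of _ n]) (simp_all add: reflect_nth)
    then have "(\<integral>\<^sup>+x. ennreal \<bar>indicator K (reflect n z x) - indicator K x\<bar> \<partial>leb n) = (\<integral>\<^sup>+x. 0 \<partial>leb n)"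
      by (intro nn_integral_cong) (simp add: space_leb)
    then show ?thesis by simp
  next
    case False
    define v where "v = dil n (1 / sqrt (inner_Rn n z z)) z"
    have v: "v \<in> Rn n" "inner_Rn n v v = 1" and zv: "reflect n z = reflect n v"
      using reflect_normalize[OF False] by (auto simp: v_def)
    let ?E = "K - {x \<in> Rn n. reflect n v x \<in> K}"
    have E: "?E \<in> sets (leb n)"
    proof -
      have "reflect n v \<in> leb n \<rightarrow>\<^sub>M leb n"
        using measurable_reflect[OF measurable_const_leb[OF v(1)] measurable_ident_sets[OF refl]] by simp
      from measurable_sets[OF this K] have "{x \<in> Rn n. reflect n v x \<in> K} \<in> sets (leb n)"
        by (simp add: space_leb vimage_def Int_def conj_commute)
      then show ?thesis using K by auto
    qed
    have Em: "(indicator ?E :: _ \<Rightarrow> ennreal) \<in> borel_measurable (leb n)" using E by simp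
    have Rm: "(\<lambda>x. reflect n v x) \<in> leb n \<rightarrow>\<^sub>M leb n"
      by (intro measurable_reflect measurable_const_leb measurable_ident_sets v) simp
    have "(\<integral>\<^sup>+x. ennreal \<bar>indicator K (reflect n z x) - indicator K x\<bar> \<partial>leb n)
       \<le> (\<integral>\<^sup>+x. indicator ?E x + indicator ?E (reflect n v x) \<partial>leb n)"
    proof (rule nn_integral_mono)
      fix x assume "x \<in> space (leb n)"
      then have x: "x \<in> Rn n" by (simp add: space_leb)
      then have "reflect n v (reflect n v x) = x" by (rule reflect_reflect)
      then show "ennreal \<bar>indicator K (reflect n z x) - indicator K x\<bar> \<le> indicator ?E x + indicator ?E (reflect n v x)"
        using x by (cases "x \<in> K"; cases "reflect n v x \<in> K") (simp_all add: zv)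
    qed
    also have "\<dots> = (\<integral>\<^sup>+x. indicator ?E x \<partial>leb n) + (\<integral>\<^sup>+x. indicator ?E (reflect n v x) \<partial>leb n)"
      by (rule nn_integral_add[OF Em measurable_compose[OF Rm Em]])
    also have "(\<integral>\<^sup>+x. indicator ?E (reflect n v x) \<partial>leb n) = (\<integral>\<^sup>+x. indicator ?E x \<partial>leb n)"
      by (rule nn_integral_reflect[OF v(1) Em])
    also have "(\<integral>\<^sup>+x. indicator ?E x \<partial>leb n) = emeasure (leb n) ?E" using E by simp
    also have "emeasure (leb n) ?E + emeasure (leb n) ?E \<le> ennreal \<eta> + ennreal \<eta>"
      using u[OF v] by (intro add_mono)
    also have "\<dots> = ennreal (2 * \<eta>)" using \<eta> by (simp add: ennreal_plus[symmetric] del: ennreal_plus)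
    finally show ?thesis .
  qed
qed (use assms in auto)

lemma origin_in_ball: "(\<lambda>i\<in>{..<n}. 0) \<in> ball_Rn n r"
  by (simp add: ball_Rn_def inner_Rn_def)

text \<open>A point and its mirror image serve as witnesses. Together with \<open>symm_mono\<close>
  this carries the inner ball of radius 1/n through the whole descent.\<close>

lemma ball_subset_symm:
  assumes u: "u \<in> Rn n" "inner_Rn n u u = 1"
  shows "ball_Rn n r \<subseteq> symm n u (ball_Rn n r)"
proof
  fix x assume x: "x \<in> ball_Rn n r"
  define t where "t = inner_Rn n x u"
  have xR: "x \<in> Rn n" using x by (simp add: ball_Rn_def)
  have 1: "line_point n u x 0 \<in> ball_Rn n r" using x xR by (simp add: line_point_0)
  have "line_point n u x (- 2 * t) = reflect n u x" using u by (simp add: reflect_unit t_def)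
  then have 2: "line_point n u x (- 2 * t) \<in> ball_Rn n r"
    using x by (simp add: ball_Rn_def inner_reflect_reflect)
  show "x \<in> symm n u (ball_Rn n r)"
  proof (cases "t \<ge> 0")
    case True
    then show ?thesis using 1 2 xR by (intro symmI[of x n u "- 2 * t" _ 0]) (simp_all add: t_def)
  next
    case False
    then show ?thesis using 1 2 xR by (intro symmI[of x n u 0 _ "- 2 * t"]) (simp_all add: t_def)
  qed
qed

text \<open>If for every u the part of K not covered by its mirror image had volume at most e*v,
  then K would be near invariant with \<delta> = 2*e*v, and \<open>close_to_ball\<close> would give
  8*n*e*v, against the assumption. So some direction has a large asymmetric part, which
  \<open>moment_symm\<close> turns into a decrease.\<close>

lemma exists_decreasing_direction:
  assumes n: "n > 0" and K: "convex_body n K" "ball_Rn n (1 / real n) \<subseteq> K"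
    and vol: "emeasure (leb n) K = ennreal v" "emeasure (leb n) (ball_Rn n 1) = ennreal v" and v: "v > 0"
    and e: "0 < e" "e \<le> 1"
    and far: "emeasure (leb n) (sym_diff K (ball_Rn n 1)) > ennreal (8 * real n * (e * v))"
  obtains u where "u \<in> unit_sphere_Rn n"
    "moment n (symm n u K) + ennreal (e ^ 4 / (32 * real n ^ 4) * v) \<le> moment n K"
proof -
  note Kd = convex_bodyD[OF K(1)]
  have star: "dil n s x \<in> K" if "x \<in> K" "0 \<le> s" "s \<le> 1" for s x
    using convex_star[OF Kd(2) _ that] K(2) origin_in_ball by blast
  have "\<exists>u. u \<in> Rn n \<and> inner_Rn n u u = 1 \<and>
      emeasure (leb n) (K - {x \<in> Rn n. reflect n u x \<in> K}) > ennreal (e * v)"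
  proof (rule ccontr)
    assume "\<not> ?thesis"
    then have *: "\<And>u. u \<in> Rn n \<Longrightarrow> inner_Rn n u u = 1 \<Longrightarrow>
        emeasure (leb n) (K - {x \<in> Rn n. reflect n u x \<in> K}) \<le> ennreal (e * v)"
      by (meson not_less)
    have "near_invariant n K (2 * (e * v))"
      by (rule near_invariantI[OF Kd(4) star _ *]) (use e v in auto)
    from near_invariant.close_to_ball[OF this] vol
    have "emeasure (leb n) (sym_diff K (ball_Rn n 1)) \<le> ennreal (4 * real n * (2 * (e * v)))" by simp
    also have "4 * real n * (2 * (e * v)) = 8 * real n * (e * v)" by simp
    finally show False using far by (meson leD)
  qed
  then obtain u where u: "u \<in> Rn n" "inner_Rn n u u = 1"
    and gt: "emeasure (leb n) (K - {x \<in> Rn n. reflect n u x \<in> K}) \<ge> ennreal (e * v)"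
    by (auto simp: less_imp_le)
  \<comment> \<open>Each error term becomes a quarter of the gain: n*lam*v = e*v/4 bounds the volume
    outside the shrunken body, and kap*v = e*v/4. What is left is kap*s^2*e*v/2 with s = e/(2*n^2),
    that is, e^4*v/(32*n^4).\<close>
  define lam where "lam = e / (4 * real n)"
  define kap where "kap = e / 4"
  define s where "s = 2 * (1 / real n) * lam"
  have n1: "real n \<ge> 1" using n by simp
  have lam: "0 < lam" "lam < 1" using e n1 by (simp_all add: lam_def field_simps)
  have kap: "0 < kap" using e by (simp add: kap_def)
  have L: "dil n (1 - lam) ` K \<in> sets (leb n)" using lam Kd(4) by (intro dil_image_measurable) simp_all
  have LK: "dil n (1 - lam) ` K \<subseteq> K" using lam by (auto intro!: star)
  have diff: "emeasure (leb n) (K - dil n (1 - lam) ` K) \<le> ennreal (real n * lam * v)"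
  proof -
    have eL: "emeasure (leb n) (dil n (1 - lam) ` K) = ennreal ((1 - lam) ^ n * v)"
      using emeasure_dil[of "1 - lam" K n] lam Kd(4) vol v by (simp add: ennreal_mult)
    have "emeasure (leb n) (K - dil n (1 - lam) ` K) = ennreal v - ennreal ((1 - lam) ^ n * v)"
      using emeasure_Diff[OF _ Kd(4) L LK] vol eL by simp
    also have "\<dots> = ennreal (v - (1 - lam) ^ n * v)" using lam v by (simp add: ennreal_minus)
    also have "\<dots> \<le> ennreal (real n * lam * v)"
    proof (rule ennreal_leI)
      have "1 + real n * (- lam) \<le> (1 + (- lam)) ^ n" using lam by (intro Bernoulli_inequality) simp
      then have "(1 - real n * lam) * v \<le> (1 - lam) ^ n * v" using v by (intro mult_right_mono) simp_all
      then show "v - (1 - lam) ^ n * v \<le> real n * lam * v" by (simp add: algebra_simps)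
    qed
    finally show ?thesis .
  qed
  define b where "b = kap * s\<^sup>2 * (e / 2) * v"
  have b0: "0 \<le> b" using kap e v by (simp add: b_def)
  have "ennreal (kap * s\<^sup>2) * ennreal (e * v) + moment n (symm n u K)
      \<le> ennreal (kap * s\<^sup>2) * emeasure (leb n) (K - {x \<in> Rn n. reflect n u x \<in> K}) + moment n (symm n u K)"
    by (intro add_right_mono mult_left_mono gt) simp
  also have "\<dots> \<le> ennreal (kap * s\<^sup>2) * emeasure (leb n) (K - dil n (1 - lam) ` K)
      + ennreal (kap\<^sup>2 * s\<^sup>2) * emeasure (leb n) K + moment n K"
    using lam n by (intro moment_symm[OF K(1) K(2) _ u _ _ kap s_def L]) simp_all
  also have "\<dots> \<le> ennreal (kap * s\<^sup>2) * ennreal (real n * lam * v) + ennreal (kap\<^sup>2 * s\<^sup>2) * ennreal v + moment n K"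
    unfolding vol by (intro add_right_mono mult_left_mono diff) simp
  also have "\<dots> = ennreal b + moment n K"
  proof -
    have "kap * s\<^sup>2 * (real n * lam * v) + kap\<^sup>2 * s\<^sup>2 * v = b"
      using n by (simp add: b_def kap_def lam_def power2_eq_square field_simps)
    then show ?thesis using kap lam v by (simp add: ennreal_mult[symmetric] ennreal_plus[symmetric] del: ennreal_plus)
  qed
  \<comment> \<open>The gain is twice b and the errors add up to b; cancelling the finite b leaves a
    decrease by b.\<close>
  also have "ennreal (kap * s\<^sup>2) * ennreal (e * v) = ennreal b + ennreal b"
    using kap e v b0 by (simp add: ennreal_mult[symmetric] ennreal_plus[symmetric] b_def del: ennreal_plus)
  finally have "ennreal b + (moment n (symm n u K) + ennreal b) \<le> ennreal b + moment n K"
    by (simp add: ac_simps)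
  then have "moment n (symm n u K) + ennreal b \<le> moment n K"
    by (simp add: ennreal_add_left_cancel_le)
  moreover have "b = e ^ 4 / (32 * real n ^ 4) * v"
    using n by (simp add: b_def kap_def s_def lam_def power2_eq_square power4_eq_xxxx field_simps)
  ultimately show ?thesis using that[of u] u by (simp add: unit_sphere_iff)
qed

text \<open>j is a budget, the moment counted in units of the guaranteed decrease. As long as the
  body is far from the ball, a symmetrization spends one unit, and at j = 0 the moment is zero, so
  that a further decrease is impossible.\<close>

lemma symmetrize_bounded_moment:
  assumes n: "n > 0" and K: "convex_body n K" "ball_Rn n (1 / real n) \<subseteq> K"
    and vol: "emeasure (leb n) K = ennreal v" "emeasure (leb n) (ball_Rn n 1) = ennreal v" and v: "v > 0"
    and e: "0 < e" "e \<le> 1"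
    and M: "moment n K \<le> ennreal (real j * (e ^ 4 / (32 * real n ^ 4) * v))"
  shows "\<exists>us. set us \<subseteq> unit_sphere_Rn n \<and> length us \<le> j \<and>
    emeasure (leb n) (sym_diff (fold (symm n) us K) (ball_Rn n 1)) \<le> ennreal (8 * real n * (e * v))"
  using K vol(1) M
proof (induction j arbitrary: K)
  case 0
  show ?case
  proof (cases "emeasure (leb n) (sym_diff K (ball_Rn n 1)) \<le> ennreal (8 * real n * (e * v))")
    case True
    then show ?thesis by (intro exI[of _ "[]"]) simp
  next
    case False
    then have far: "emeasure (leb n) (sym_diff K (ball_Rn n 1)) > ennreal (8 * real n * (e * v))"
      by (simp only: not_le)
    obtain u where "moment n (symm n u K) + ennreal (e ^ 4 / (32 * real n ^ 4) * v) \<le> moment n K"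
      by (rule exists_decreasing_direction[OF n 0(1-3) vol(2) v e far])
    then have "ennreal (e ^ 4 / (32 * real n ^ 4) * v) \<le> 0" using 0(4) by simp
    moreover have "e ^ 4 / (32 * real n ^ 4) * v > 0" using e v n by simp
    ultimately show ?thesis by (simp add: ennreal_eq_0_iff)
  qed
next
  case (Suc j)
  let ?t = "e ^ 4 / (32 * real n ^ 4) * v"
  have t0: "0 \<le> ?t" using e v by simp
  show ?case
  proof (cases "emeasure (leb n) (sym_diff K (ball_Rn n 1)) \<le> ennreal (8 * real n * (e * v))")
    case True
    then show ?thesis by (intro exI[of _ "[]"]) simp
  next
    case False
    then have far: "emeasure (leb n) (sym_diff K (ball_Rn n 1)) > ennreal (8 * real n * (e * v))"
      by (simp only: not_le)
    obtain u where u: "u \<in> unit_sphere_Rn n" "moment n (symm n u K) + ennreal ?t \<le> moment n K"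
      by (rule exists_decreasing_direction[OF n Suc.prems(1-3) vol(2) v e far])
    have u': "u \<in> Rn n" "inner_Rn n u u = 1" using u(1) by (simp_all add: unit_sphere_iff)
    have "ennreal ?t + moment n (symm n u K) \<le> ennreal (real (Suc j) * ?t)"
      using order.trans[OF u(2) Suc.prems(4)] by (simp only: add.commute)
    also have "real (Suc j) * ?t = ?t + real j * ?t" by (simp only: of_nat_Suc distrib_right mult_1_left)
    also have "ennreal (?t + real j * ?t) = ennreal ?t + ennreal (real j * ?t)"
      by (rule ennreal_plus[OF t0 mult_nonneg_nonneg[OF of_nat_0_le_iff t0]])
    finally have "moment n (symm n u K) \<le> ennreal (real j * ?t)"
      by (simp only: ennreal_add_left_cancel_le) simp
    moreover have "ball_Rn n (1 / real n) \<subseteq> symm n u K"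
      using ball_subset_symm[OF u'] symm_mono[OF Suc.prems(2)] by blast
    moreover have "emeasure (leb n) (symm n u K) = ennreal v"
      using emeasure_symm[OF Suc.prems(1) u'] Suc.prems(3) by simp
    ultimately obtain us where "set us \<subseteq> unit_sphere_Rn n" "length us \<le> j"
      "emeasure (leb n) (sym_diff (fold (symm n) us (symm n u K)) (ball_Rn n 1)) \<le> ennreal (8 * real n * (e * v))"
      using Suc.IH[OF convex_body_symm[OF Suc.prems(1) u']] by blast
    then show ?thesis using u(1) by (intro exI[of _ "u # us"]) simp
  qed
qed

section \<open>Reaching a position between two balls\<close>

definition axis_Rn :: "nat \<Rightarrow> nat \<Rightarrow> (nat \<Rightarrow> real)" where
  "axis_Rn n i = (\<lambda>j\<in>{..<n}. if j = i then 1 else 0)"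

lemma axis_in_Rn [simp]: "axis_Rn n i \<in> Rn n" by (simp add: axis_Rn_def)

lemma axis_nth: "j < n \<Longrightarrow> axis_Rn n i j = (if j = i then 1 else 0)"
  by (simp add: axis_Rn_def)

lemma inner_axis:
  assumes "i < n"
  shows "inner_Rn n x (axis_Rn n i) = x i"
proof -
  have "inner_Rn n x (axis_Rn n i) = (\<Sum>j<n. if j = i then x j else 0)"
    unfolding inner_Rn_def by (rule sum.cong) (simp_all add: axis_nth)
  then show ?thesis using assms by simp
qed

lemma axis_unit_sphere: "i < n \<Longrightarrow> axis_Rn n i \<in> unit_sphere_Rn n"
  by (simp add: unit_sphere_iff inner_axis axis_nth)

lemma reflect_axis:
  assumes "i < n" "j < n"
  shows "reflect n (axis_Rn n i) x j = (if j = i then - x j else x j)"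
  using assms by (simp add: reflect_nth inner_axis axis_nth)

lemma symm_reflect_self:
  assumes u: "u \<in> Rn n" "inner_Rn n u u = 1" and x: "x \<in> symm n u K"
  shows "reflect n u x \<in> symm n u K"
proof -
  obtain a b where ab: "line_point n u x a \<in> K" "line_point n u x b \<in> K" "2 * \<bar>inner_Rn n x u\<bar> \<le> b - a"
    using x by (rule symmE)
  define t where "t = inner_Rn n x u"
  have R: "reflect n u x = line_point n u x (- 2 * t)" using u by (simp add: reflect_unit t_def)
  have "inner_Rn n (reflect n u x) u = - t" unfolding R using u by (simp add: t_def)
  then have "2 * \<bar>inner_Rn n (reflect n u x) u\<bar> \<le> (b + 2 * t) - (a + 2 * t)"
    using ab(3) by (simp add: t_def)
  moreover have "line_point n u (reflect n u x) (a + 2 * t) \<in> K" "line_point n u (reflect n u x) (b + 2 * t) \<in> K"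
    using ab by (simp_all add: R)
  ultimately show ?thesis by (intro symmI[of _ n u "a + 2 * t" K "b + 2 * t"]) simp_all
qed

text \<open>The reflection in v preserves the direction u and the height <x,u>, so it takes
  witnesses to witnesses. Symmetrizing along a further axis hence keeps the symmetries obtained
  before.\<close>

lemma symm_reflect_orthogonal:
  assumes uv: "inner_Rn n u v = 0" and K: "\<And>x. x \<in> K \<Longrightarrow> reflect n v x \<in> K" and x: "x \<in> symm n u K"
  shows "reflect n v x \<in> symm n u K"
proof -
  obtain a b where ab: "line_point n u x a \<in> K" "line_point n u x b \<in> K" "2 * \<bar>inner_Rn n x u\<bar> \<le> b - a"
    using x by (rule symmE)
  have R: "reflect n v (line_point n u x a) = line_point n u (reflect n v x) a" for a
    by (rule Rn_eqI[of _ n]) (simp_all add: reflect_nth uv)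
  have "inner_Rn n (reflect n v x) u = inner_Rn n x u"
    using uv by (simp add: inner_reflect_left inner_Rn_commute[of n v u])
  then show ?thesis
    using K[OF ab(1)] K[OF ab(2)] ab(3) unfolding R
    by (intro symmI[of "reflect n v x" n u a K b]) simp_all
qed

definition unconditional :: "nat \<Rightarrow> (nat \<Rightarrow> real) set \<Rightarrow> bool" where
  "unconditional n K \<longleftrightarrow> (\<forall>i<n. \<forall>x\<in>K. reflect n (axis_Rn n i) x \<in> K)"

lemma unconditional_fold:
  "unconditional n (fold (symm n) (map (axis_Rn n) [0..<n]) K)"
proof -
  have "\<forall>i<m. \<forall>x\<in>fold (symm n) (map (axis_Rn n) [0..<m]) K.
      reflect n (axis_Rn n i) x \<in> fold (symm n) (map (axis_Rn n) [0..<m]) K" if "m \<le> n" for m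
    using that
  proof (induction m)
    case (Suc m)
    let ?L = "fold (symm n) (map (axis_Rn n) [0..<m]) K"
    have F: "fold (symm n) (map (axis_Rn n) [0..<Suc m]) K = symm n (axis_Rn n m) ?L" by simp
    show ?case unfolding F
    proof (intro allI impI ballI)
      fix i x assume i: "i < Suc m" and x: "x \<in> symm n (axis_Rn n m) ?L"
      show "reflect n (axis_Rn n i) x \<in> symm n (axis_Rn n m) ?L"
      proof (cases "i = m")
        case True
        show ?thesis unfolding True
          by (rule symm_reflect_self[OF _ _ x]) (use Suc.prems in \<open>simp_all add: inner_axis axis_nth\<close>)
      next
        case False
        then show ?thesis using x Suc i
          by (intro symm_reflect_orthogonal) (simp_all add: inner_axis axis_nth)
      qed
    qed
  qed simp
  then show ?thesis by (auto simp: unconditional_def)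
qed

text \<open>The midpoint of a point and its mirror image along the i-th axis has i-th coordinate
  zero and the same other coordinates; this is repeated over J.\<close>

lemma unconditional_zero_coords:
  assumes K: "convex_Rn n K" "K \<subseteq> Rn n" "unconditional n K" and x: "x \<in> K" and J: "finite J" "J \<subseteq> {..<n}"
  shows "(\<lambda>j\<in>{..<n}. if j \<in> J then 0 else x j) \<in> K"
  using J
proof (induction J)
  case empty
  have "(\<lambda>j\<in>{..<n}. if j \<in> {} then 0 else x j) = x" by (rule Rn_eqI[of _ n]) (use x K in auto)
  then show ?case using x by simp
next
  case (insert i J)
  let ?y = "\<lambda>j\<in>{..<n}. if j \<in> J then 0 else x j"
  have y: "?y \<in> K" and i: "i < n" using insert.IH insert.prems by blast+
  have "reflect n (axis_Rn n i) ?y \<in> K" using K(3) i y by (auto simp: unconditional_def)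
  then have "(\<lambda>k\<in>{..<n}. (1 - 1/2) * ?y k + 1/2 * reflect n (axis_Rn n i) ?y k) \<in> K"
    by (intro convex_RnD[OF K(1) y, where t = "1/2"]) simp_all
  also have "(\<lambda>k\<in>{..<n}. (1 - 1/2) * ?y k + 1/2 * reflect n (axis_Rn n i) ?y k)
      = (\<lambda>j\<in>{..<n}. if j \<in> insert i J then 0 else x j)"
    by (rule Rn_eqI[of _ n]) (use i in \<open>simp_all add: reflect_axis\<close>)
  finally show ?case .
qed

text \<open>a i is the maximum of the i-th coordinate on K. Deleting the other coordinates of a
  maximal point leaves a i times the unit vector inside K; the ball in K makes a i positive.\<close>

lemma unconditional_extents:
  assumes K: "convex_body n K" "unconditional n K"
  obtains a where "\<And>i. i < n \<Longrightarrow> 0 < a i" "\<And>i. i < n \<Longrightarrow> dil n (a i) (axis_Rn n i) \<in> K"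
    "\<And>i x. i < n \<Longrightarrow> x \<in> K \<Longrightarrow> \<bar>x i\<bar> \<le> a i"
proof -
  note Kd = convex_bodyD[OF K(1)]
  obtain x0 r where x0: "x0 \<in> Rn n" and r: "r > 0" and
    "\<forall>x\<in>Rn n. inner_Rn n (line_point n x0 x (-1)) (line_point n x0 x (-1)) \<le> r\<^sup>2 \<longrightarrow> x \<in> K"
    using Kd(5) unfolding has_ball_def by blast
  then have B: "x \<in> K"
    if "x \<in> Rn n" "inner_Rn n (line_point n x0 x (-1)) (line_point n x0 x (-1)) \<le> r\<^sup>2" for x
    using that by blast
  have "\<exists>a>0. dil n a (axis_Rn n i) \<in> K \<and> (\<forall>x\<in>K. \<bar>x i\<bar> \<le> a)" if i: "i < n" for i
  proof -
    have cl: "line_point n (axis_Rn n i) x0 t \<in> K" if "\<bar>t\<bar> \<le> r" for t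
    proof (rule B)
      have "line_point n x0 (line_point n (axis_Rn n i) x0 t) (-1) = dil n t (axis_Rn n i)"
        by (rule Rn_eqI[of _ n]) simp_all
      moreover have "inner_Rn n (dil n t (axis_Rn n i)) (dil n t (axis_Rn n i)) = t\<^sup>2"
        using i by (simp add: inner_axis axis_nth power2_eq_square)
      moreover have "t\<^sup>2 \<le> r\<^sup>2" using that r by (simp add: abs_le_square_iff[symmetric])
      ultimately show "inner_Rn n (line_point n x0 (line_point n (axis_Rn n i) x0 t) (-1))
          (line_point n x0 (line_point n (axis_Rn n i) x0 t) (-1)) \<le> r\<^sup>2" by simp
    qed simp
    have ne: "K \<noteq> {}" using cl[of 0] r by auto
    have "compactin euclideanreal ((\<lambda>x. x i) ` K)"
      by (rule image_compactin[OF Kd(1)]) (rule continuous_map_coord[OF continuous_map_id[unfolded id_def] i])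
    then have "compact ((\<lambda>x. x i) ` K)" by simp
    then obtain x where x: "x \<in> K" "\<And>y. y \<in> K \<Longrightarrow> y i \<le> x i"
      using compact_attains_sup[of "(\<lambda>x. x i) ` K"] ne by auto
    have bd: "\<bar>y i\<bar> \<le> x i" if "y \<in> K" for y
    proof -
      have "reflect n (axis_Rn n i) y \<in> K" using K(2) i that by (auto simp: unconditional_def)
      then have "- y i \<le> x i" using x(2) i by (fastforce simp: reflect_axis)
      then show ?thesis using x(2)[OF that] by simp
    qed
    have "\<bar>x0 i + r\<bar> \<le> x i" "\<bar>x0 i - r\<bar> \<le> x i"
      using bd[OF cl[of r]] bd[OF cl[of "- r"]] i r by (simp_all add: axis_nth)
    then have pos: "x i > 0" using r by linarith
    have "(\<lambda>j\<in>{..<n}. if j \<in> {..<n} - {i} then 0 else x j) \<in> K"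
      by (rule unconditional_zero_coords[OF Kd(2,3) K(2) x(1)]) auto
    also have "(\<lambda>j\<in>{..<n}. if j \<in> {..<n} - {i} then 0 else x j) = dil n (x i) (axis_Rn n i)"
      by (rule Rn_eqI[of _ n]) (simp_all add: axis_nth)
    finally show ?thesis using pos bd by blast
  qed
  then obtain a where "\<forall>i<n. 0 < a i \<and> dil n (a i) (axis_Rn n i) \<in> K \<and> (\<forall>x\<in>K. \<bar>x i\<bar> \<le> a i)"
    by metis
  then show ?thesis using that by blast
qed

text \<open>Induction on the support: with l = |x j| / a j, the point x lies on the segment from y,
  which has smaller support, to a vertex on the j-th axis.\<close>

lemma cross_polytope_subset:
  assumes K: "convex_Rn n K" "(\<lambda>i\<in>{..<n}. 0) \<in> K"
    and a: "\<And>i. i < n \<Longrightarrow> 0 < a i" "\<And>i. i < n \<Longrightarrow> dil n (a i) (axis_Rn n i) \<in> K"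
      "\<And>i. i < n \<Longrightarrow> dil n (- a i) (axis_Rn n i) \<in> K"
    and J: "finite J" "J \<subseteq> {..<n}"
    and x: "x \<in> Rn n" "\<And>i. i < n \<Longrightarrow> i \<notin> J \<Longrightarrow> x i = 0" "(\<Sum>i\<in>J. \<bar>x i\<bar> / a i) \<le> 1"
  shows "x \<in> K"
  using J x
proof (induction J arbitrary: x)
  case empty
  have "x = (\<lambda>i\<in>{..<n}. 0)" by (rule Rn_eqI[of _ n]) (use empty in simp_all)
  then show ?case using K(2) by metis
next
  case (insert j J)
  have j: "j < n" and JR: "J \<subseteq> {..<n}" using insert by auto
  define l where "l = \<bar>x j\<bar> / a j"
  have s: "l + (\<Sum>i\<in>J. \<bar>x i\<bar> / a i) \<le> 1" using insert by (simp add: l_def)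
  have nn: "0 \<le> (\<Sum>i\<in>J. \<bar>x i\<bar> / a i)"
    using a(1) JR by (intro sum_nonneg divide_nonneg_pos) auto
  have l: "0 \<le> l" "l \<le> 1" using s nn a(1)[OF j] by (simp add: l_def) (use s nn in linarith)
  \<comment> \<open>For l = 1 all other coordinates of x vanish, and division by zero yields y = 0,
    which is a point of K; so (1 - l) * y still reproduces them.\<close>
  define y where "y = (\<lambda>i\<in>{..<n}. if i = j then 0 else x i / (1 - l))"
  have xy: "(1 - l) * y i = x i" if "i < n" "i \<noteq> j" for i
  proof (cases "l = 1")
    case True
    then have z: "(\<Sum>i\<in>J. \<bar>x i\<bar> / a i) = 0" using s nn by simp
    have "x i = 0"
    proof (cases "i \<in> J")
      case True
      have "\<bar>x i\<bar> / a i = 0"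
        using sum_nonneg_eq_0_iff[of J "\<lambda>i. \<bar>x i\<bar> / a i"] z insert.hyps(1) a(1) JR True
        by (metis (no_types, lifting) abs_ge_zero divide_nonneg_pos lessThan_iff subsetD)
      then show ?thesis using a(1)[OF that(1)] by simp
    qed (use insert.prems(3) that in auto)
    then show ?thesis using that by (simp add: y_def)
  qed (use that in \<open>simp add: y_def\<close>)
  have "y \<in> K"
  proof (rule insert.IH[OF JR])
    show "y \<in> Rn n" by (simp add: y_def)
    show "y i = 0" if "i < n" "i \<notin> J" for i using insert.prems(3)[of i] that by (simp add: y_def)
    have "(\<Sum>i\<in>J. \<bar>y i\<bar> / a i) = (\<Sum>i\<in>J. \<bar>x i\<bar> / a i) / (1 - l)"
      unfolding sum_divide_distrib
      by (rule sum.cong) (use insert.hyps(2) JR l in \<open>auto simp: y_def abs_divide\<close>)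
    also have "\<dots> \<le> 1" using s l by (cases "l = 1") (simp_all add: divide_le_eq)
    finally show "(\<Sum>i\<in>J. \<bar>y i\<bar> / a i) \<le> 1" .
  qed
  moreover define z where "z = (if 0 \<le> x j then a j else - a j)"
  have zK: "dil n z (axis_Rn n j) \<in> K" using a(2,3) j by (simp add: z_def)
  ultimately have "(\<lambda>i\<in>{..<n}. (1 - l) * y i + l * dil n z (axis_Rn n j) i) \<in> K"
    using K(1) l by (intro convex_RnD) simp_all
  also have "(\<lambda>i\<in>{..<n}. (1 - l) * y i + l * dil n z (axis_Rn n j) i) = x"
  proof (rule Rn_eqI[of _ n])
    fix i assume i: "i < n"
    show "(\<lambda>i\<in>{..<n}. (1 - l) * y i + l * dil n z (axis_Rn n j) i) i = x i"
    proof (cases "i = j")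
      case True
      then show ?thesis using i a(1)[OF j] by (simp add: y_def axis_nth z_def l_def)
    next
      case False
      then show ?thesis using i xy by (simp add: axis_nth)
    qed
  qed (use insert.prems in simp_all)
  finally show ?case .
qed

text \<open>For an orthonormal basis v and positive parameters this is the ellipsoid with semi-axes
  \<rho> * a i. The scale \<rho> is kept apart from a so that homothetic ellipsoids can be treated
  by the same directions.\<close>

definition ellipsoid :: "nat \<Rightarrow> (nat \<Rightarrow> nat \<Rightarrow> real) \<Rightarrow> (nat \<Rightarrow> real) \<Rightarrow> real \<Rightarrow> (nat \<Rightarrow> real) set" where
  "ellipsoid n v a \<rho> = {x \<in> Rn n. (\<Sum>i<n. (inner_Rn n x (v i))\<^sup>2 / (a i)\<^sup>2) \<le> \<rho>\<^sup>2}"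

text \<open>K lies in the box and contains the cross-polytope with the half-widths a i. The outer
  ellipsoid contains the box; the inner one lies in the cross-polytope by the Cauchy-Schwarz
  inequality. Each comparison costs a factor sqrt n.\<close>

lemma unconditional_ellipsoid:
  assumes n: "n > 0" and K: "convex_body n K" "unconditional n K"
  obtains a where "\<And>i. i < n \<Longrightarrow> 0 < a i"
    "ellipsoid n (axis_Rn n) a (1 / sqrt (real n)) \<subseteq> K" "K \<subseteq> ellipsoid n (axis_Rn n) a (sqrt (real n))"
proof -
  note Kd = convex_bodyD[OF K(1)]
  obtain a where a: "\<And>i. i < n \<Longrightarrow> 0 < a i" "\<And>i. i < n \<Longrightarrow> dil n (a i) (axis_Rn n i) \<in> K"
    "\<And>i x. i < n \<Longrightarrow> x \<in> K \<Longrightarrow> \<bar>x i\<bar> \<le> a i" using unconditional_extents[OF K] by metis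
  have E: "x \<in> ellipsoid n (axis_Rn n) a \<rho> \<longleftrightarrow> x \<in> Rn n \<and> (\<Sum>i<n. (\<bar>x i\<bar> / a i)\<^sup>2) \<le> \<rho>\<^sup>2" for x \<rho>
    by (simp add: ellipsoid_def inner_axis power_divide)
  have neg: "dil n (- a i) (axis_Rn n i) \<in> K" if "i < n" for i
  proof -
    have "reflect n (axis_Rn n i) (dil n (a i) (axis_Rn n i)) \<in> K"
      using K(2) a(2) that by (auto simp: unconditional_def)
    also have "reflect n (axis_Rn n i) (dil n (a i) (axis_Rn n i)) = dil n (- a i) (axis_Rn n i)"
      by (rule Rn_eqI[of _ n]) (use that in \<open>simp_all add: reflect_axis axis_nth\<close>)
    finally show ?thesis .
  qed
  have zero: "(\<lambda>i\<in>{..<n}. 0) \<in> K"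
  proof -
    have "(\<lambda>j\<in>{..<n}. if j \<in> {..<n} then 0 else dil n (a 0) (axis_Rn n 0) j) \<in> K"
      by (rule unconditional_zero_coords[OF Kd(2,3) K(2) a(2)[OF n]]) auto
    also have "(\<lambda>j\<in>{..<n}. if j \<in> {..<n} then 0 else dil n (a 0) (axis_Rn n 0) j) = (\<lambda>i\<in>{..<n}. 0)"
      by (rule Rn_eqI[of _ n]) simp_all
    finally show ?thesis .
  qed
  have "x \<in> K" if "x \<in> ellipsoid n (axis_Rn n) a (1 / sqrt (real n))" for x
  proof (rule cross_polytope_subset[OF Kd(2) zero a(1,2) neg, of "{..<n}"])
    have x: "x \<in> Rn n" "(\<Sum>i<n. (\<bar>x i\<bar> / a i)\<^sup>2) \<le> 1 / real n"
      using that by (simp_all add: E power_divide)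
    show "x \<in> Rn n" by (rule x)
    have "(\<Sum>i<n. \<bar>x i\<bar> / a i * 1)\<^sup>2 \<le> (\<Sum>i<n. (\<bar>x i\<bar> / a i)\<^sup>2) * (\<Sum>i<n. 1\<^sup>2)"
      by (rule Cauchy_Schwarz_ineq_sum)
    also have "\<dots> \<le> 1 / real n * real n" using x(2) by (intro mult_mono) simp_all
    also have "\<dots> = 1" using n by simp
    finally have "(\<Sum>i<n. \<bar>x i\<bar> / a i)\<^sup>2 \<le> 1\<^sup>2" by simp
    then show "(\<Sum>i<n. \<bar>x i\<bar> / a i) \<le> 1" by (rule power2_le_imp_le) simp
  qed auto
  moreover have "x \<in> ellipsoid n (axis_Rn n) a (sqrt (real n))" if x: "x \<in> K" for x
  proof -
    have "(\<Sum>i<n. (\<bar>x i\<bar> / a i)\<^sup>2) \<le> (\<Sum>i<n. 1)"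
    proof (rule sum_mono)
      fix i assume "i \<in> {..<n}"
      then have "\<bar>x i\<bar> / a i \<le> 1" "0 \<le> \<bar>x i\<bar> / a i" using a(1)[of i] a(3)[of i x] x by (simp_all add: divide_le_eq)
      then show "(\<bar>x i\<bar> / a i)\<^sup>2 \<le> 1" by (simp add: power_le_one)
    qed
    then show ?thesis using x Kd(3) by (auto simp: E)
  qed
  ultimately show ?thesis using that[of a] a(1) by blast
qed

text \<open>An orthonormal basis. Completeness is recorded as Parseval's identity, which a rotation
  inside the plane of two basis vectors visibly preserves.\<close>

definition frame :: "nat \<Rightarrow> (nat \<Rightarrow> nat \<Rightarrow> real) \<Rightarrow> bool" where
  "frame n v \<longleftrightarrow> (\<forall>i<n. v i \<in> Rn n) \<and> (\<forall>i<n. \<forall>j<n. inner_Rn n (v i) (v j) = (if i = j then 1 else 0)) \<and>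
     (\<forall>x\<in>Rn n. (\<Sum>i<n. (inner_Rn n x (v i))\<^sup>2) = inner_Rn n x x)"

lemma frame_axis: "frame n (axis_Rn n)"
  by (auto simp: frame_def inner_axis axis_nth inner_Rn_def[of n x x for x] power2_eq_square)

text \<open>The parameters t with q * (X + t + h)^2 \<le> d form an interval whose half-length is
  independent of h; symmetrizing it just drops h. The formulation with squares includes d < 0, where
  both sides fail.\<close>

lemma chord_condition:
  fixes q X h d :: real
  assumes q: "q > 0"
  shows "(\<exists>\<alpha> \<beta>. q * (X + \<alpha> + h)\<^sup>2 \<le> d \<and> q * (X + \<beta> + h)\<^sup>2 \<le> d \<and> 2 * \<bar>X\<bar> \<le> \<beta> - \<alpha>) \<longleftrightarrow> q * X\<^sup>2 \<le> d"
proof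
  assume "\<exists>\<alpha> \<beta>. q * (X + \<alpha> + h)\<^sup>2 \<le> d \<and> q * (X + \<beta> + h)\<^sup>2 \<le> d \<and> 2 * \<bar>X\<bar> \<le> \<beta> - \<alpha>"
  then obtain \<alpha> \<beta> where ab: "q * (X + \<alpha> + h)\<^sup>2 \<le> d" "q * (X + \<beta> + h)\<^sup>2 \<le> d" "2 * \<bar>X\<bar> \<le> \<beta> - \<alpha>" by blast
  have "(2 * \<bar>X\<bar>)\<^sup>2 \<le> (\<beta> - \<alpha>)\<^sup>2" using ab(3) by (intro power_mono) simp_all
  also have "\<dots> \<le> 2 * (X + \<alpha> + h)\<^sup>2 + 2 * (X + \<beta> + h)\<^sup>2"
    using zero_le_power2[of "(X + \<alpha> + h) + (X + \<beta> + h)"] by (simp add: power2_eq_square algebra_simps)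
  finally have "4 * X\<^sup>2 \<le> 2 * (X + \<alpha> + h)\<^sup>2 + 2 * (X + \<beta> + h)\<^sup>2" by (simp add: power_mult_distrib)
  then have "q * (4 * X\<^sup>2) \<le> q * (2 * (X + \<alpha> + h)\<^sup>2 + 2 * (X + \<beta> + h)\<^sup>2)"
    using q by (intro mult_left_mono) simp_all
  then have "4 * (q * X\<^sup>2) \<le> 2 * (q * (X + \<alpha> + h)\<^sup>2) + 2 * (q * (X + \<beta> + h)\<^sup>2)"
    by (simp add: algebra_simps)
  then show "q * X\<^sup>2 \<le> d" using ab by linarith
next
  assume *: "q * X\<^sup>2 \<le> d"
  show "\<exists>\<alpha> \<beta>. q * (X + \<alpha> + h)\<^sup>2 \<le> d \<and> q * (X + \<beta> + h)\<^sup>2 \<le> d \<and> 2 * \<bar>X\<bar> \<le> \<beta> - \<alpha>"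
    by (rule exI[of _ "- X - h - \<bar>X\<bar>"], rule exI[of _ "- X - h + \<bar>X\<bar>"]) (use * in simp)
qed

lemma sum_split_two:
  fixes f :: "nat \<Rightarrow> real"
  assumes "i < n" "j < n" "i \<noteq> j"
  shows "(\<Sum>k<n. f k) = f i + f j + (\<Sum>k\<in>{..<n} - {i, j}. f k)"
proof -
  have "(\<Sum>k<n. f k) = f i + (\<Sum>k\<in>{..<n} - {i}. f k)" using assms by (intro sum.remove) auto
  also have "(\<Sum>k\<in>{..<n} - {i}. f k) = f j + (\<Sum>k\<in>{..<n} - {i} - {j}. f k)"
    using assms by (intro sum.remove) auto
  also have "{..<n} - {i} - {j} = {..<n} - {i, j}" by auto
  finally show ?thesis by simp
qed

text \<open>(C, S) is a point of the unit circle at which the quadratic form with eigenvalues p and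
  s takes the value q; it is written down explicitly instead of using continuity.\<close>

lemma interpolation_angle:
  fixes p q s :: real
  assumes "p \<le> q" "q \<le> s"
  obtains C S where "C\<^sup>2 + S\<^sup>2 = 1" "p * C\<^sup>2 + s * S\<^sup>2 = q"
proof (cases "p = s")
  case True
  then show ?thesis using that[of 1 0] assms by simp
next
  case False
  define C where "C = sqrt ((s - q) / (s - p))"
  define S where "S = sqrt ((q - p) / (s - p))"
  have d: "s - p > 0" using assms False by simp
  have C: "C\<^sup>2 = (s - q) / (s - p)" and S: "S\<^sup>2 = (q - p) / (s - p)"
    using assms d by (simp_all add: C_def S_def)
  have "C\<^sup>2 + S\<^sup>2 = 1" unfolding C S using d by (simp add: add_divide_distrib[symmetric])
  moreover have "p * C\<^sup>2 + s * S\<^sup>2 = q"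
  proof -
    have "p * C\<^sup>2 + s * S\<^sup>2 = (p * (s - q) + s * (q - p)) / (s - p)"
      unfolding C S by (simp add: add_divide_distrib)
    also have "p * (s - q) + s * (q - p) = q * (s - p)" by (simp add: algebra_simps)
    finally show ?thesis using d by simp
  qed
  ultimately show ?thesis by (rule that)
qed

(* In the plane of the i-th and j-th axes, u points to where the ellipse has radius r. The
   symmetral then has r as semi-axis along u, and the area of the planar section is kept. *)
lemma symm_ellipsoid:
  assumes fr: "frame n v" and a: "\<And>k. k < n \<Longrightarrow> 0 < a k"
    and ij: "i < n" "j < n" "i \<noteq> j" and r: "0 < r" "a j \<le> r" "r \<le> a i"
  obtains u w where "u \<in> unit_sphere_Rn n" "frame n (v(i := u, j := w))"
    "\<forall>\<rho>. symm n u (ellipsoid n v a \<rho>) = ellipsoid n (v(i := u, j := w)) (a(i := r, j := a i * a j / r)) \<rho>"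
proof -
  \<comment> \<open>The quadratic form of the ellipse has coefficients p and s along the old axes; q
    is the value it must take at u for the ellipse to have radius r there.\<close>
  define p where "p = 1 / (a i)\<^sup>2"
  define q where "q = 1 / r\<^sup>2"
  define s where "s = 1 / (a j)\<^sup>2"
  have ai: "a i > 0" and aj: "a j > 0" using a ij by auto
  have q0: "q > 0" using r by (simp add: q_def)
  have pq: "p \<le> q" "q \<le> s"
    using r ai aj by (auto simp: p_def q_def s_def intro!: divide_left_mono power_mono)
  obtain C S where CS: "C\<^sup>2 + S\<^sup>2 = 1" "p * C\<^sup>2 + s * S\<^sup>2 = q" using interpolation_angle[OF pq] by blast
  define u where "u = line_point n (v j) (dil n C (v i)) S"
  define w where "w = line_point n (v j) (dil n (- S) (v i)) C"
  have vR: "v k \<in> Rn n" if "k < n" for k using fr that by (simp add: frame_def)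
  have orth: "inner_Rn n (v k) (v l) = (if k = l then 1 else 0)" if "k < n" "l < n" for k l
    using fr that by (simp add: frame_def)
  have parseval: "(\<Sum>k<n. (inner_Rn n x (v k))\<^sup>2) = inner_Rn n x x" if "x \<in> Rn n" for x
    using fr that by (simp add: frame_def)
  have xu: "inner_Rn n x u = C * inner_Rn n x (v i) + S * inner_Rn n x (v j)" for x
    by (simp add: u_def)
  have xw: "inner_Rn n x w = - S * inner_Rn n x (v i) + C * inner_Rn n x (v j)" for x
    by (simp add: w_def)
  have uv: "inner_Rn n u (v k) = C * (if k = i then 1 else 0) + S * (if k = j then 1 else 0)" if "k < n" for k
    using that ij orth[of i k] orth[of j k] by (auto simp: u_def)
  have wv: "inner_Rn n w (v k) = - S * (if k = i then 1 else 0) + C * (if k = j then 1 else 0)" if "k < n" for k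
    using that ij orth[of i k] orth[of j k] by (auto simp: w_def)
  have uu: "inner_Rn n u u = 1" and uw: "inner_Rn n u w = 0" and ww: "inner_Rn n w w = 1"
    using CS(1) ij by (simp_all add: xu xw uv wv power2_eq_square)
  have uR: "u \<in> Rn n" "w \<in> Rn n" by (simp_all add: u_def w_def)
  have vi: "inner_Rn n x (v i) = C * inner_Rn n x u - S * inner_Rn n x w" for x
  proof -
    have "C * inner_Rn n x u - S * inner_Rn n x w = (C\<^sup>2 + S\<^sup>2) * inner_Rn n x (v i)"
      unfolding xu xw by (simp add: power2_eq_square algebra_simps)
    then show ?thesis using CS(1) by simp
  qed
  have vj: "inner_Rn n x (v j) = S * inner_Rn n x u + C * inner_Rn n x w" for x
  proof -
    have "S * inner_Rn n x u + C * inner_Rn n x w = (C\<^sup>2 + S\<^sup>2) * inner_Rn n x (v j)"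
      unfolding xu xw by (simp add: power2_eq_square algebra_simps)
    then show ?thesis using CS(1) by simp
  qed
  let ?v = "v(i := u, j := w)" and ?a = "a(i := r, j := a i * a j / r)"
  let ?rest = "{..<n} - {i, j}"
  have split: "(\<Sum>k<n. f k) = f i + f j + (\<Sum>k\<in>?rest. f k)" for f :: "nat \<Rightarrow> real"
    by (rule sum_split_two[OF ij])
  have frame': "frame n ?v"
    unfolding frame_def
  proof (intro conjI allI impI ballI)
    show "?v k \<in> Rn n" if "k < n" for k using vR[OF that] uR by simp
    show "inner_Rn n (?v k) (?v l) = (if k = l then 1 else 0)" if "k < n" "l < n" for k l
      using that orth[OF that] uu uw ww uv wv inner_Rn_commute[of n w u]
        inner_Rn_commute[of n "v k" u] inner_Rn_commute[of n "v k" w] ij by auto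
    show "(\<Sum>k<n. (inner_Rn n x (?v k))\<^sup>2) = inner_Rn n x x" if x: "x \<in> Rn n" for x
    proof -
      have "(\<Sum>k<n. (inner_Rn n x (?v k))\<^sup>2)
          = (inner_Rn n x u)\<^sup>2 + (inner_Rn n x w)\<^sup>2 + (\<Sum>k\<in>?rest. (inner_Rn n x (v k))\<^sup>2)"
        unfolding split using ij by simp
      also have "(inner_Rn n x u)\<^sup>2 + (inner_Rn n x w)\<^sup>2 = (C\<^sup>2 + S\<^sup>2) * ((inner_Rn n x (v i))\<^sup>2 + (inner_Rn n x (v j))\<^sup>2)"
        unfolding xu xw by (simp add: power2_eq_square algebra_simps)
      also have "\<dots> + (\<Sum>k\<in>?rest. (inner_Rn n x (v k))\<^sup>2) = inner_Rn n x x"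
        unfolding parseval[OF x, symmetric] CS(1) by (simp add: split[of "\<lambda>k. (inner_Rn n x (v k))\<^sup>2"])
      finally show ?thesis .
    qed
  qed
  \<comment> \<open>The 2x2 determinant of the form is invariant under the rotation to the basis u,
    w.\<close>
  have det: "q * (p * S\<^sup>2 + s * C\<^sup>2) - (C * S * (s - p))\<^sup>2 = p * s"
  proof -
    have "q * (p * S\<^sup>2 + s * C\<^sup>2) - (C * S * (s - p))\<^sup>2 = p * s * (C\<^sup>2 + S\<^sup>2)\<^sup>2"
      unfolding CS(2)[symmetric] by (simp add: power2_eq_square algebra_simps)
    then show ?thesis using CS(1) by simp
  qed
  \<comment> \<open>Completing the square in the coordinate X along u: the multiple of Y added to X
    is the shift that symmetrization removes, and p*s/q is the inverse square of the new semi-axis a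
    i * a j / r.\<close>
  have form: "p * (C * X - S * Y)\<^sup>2 + s * (S * X + C * Y)\<^sup>2
      = q * (X + C * S * (s - p) / q * Y)\<^sup>2 + p * s / q * Y\<^sup>2" for X Y
  proof -
    have "p * (C * X - S * Y)\<^sup>2 + s * (S * X + C * Y)\<^sup>2
        = (p * C\<^sup>2 + s * S\<^sup>2) * X\<^sup>2 + 2 * (C * S * (s - p)) * X * Y + (p * S\<^sup>2 + s * C\<^sup>2) * Y\<^sup>2"
      by (simp add: power2_eq_square algebra_simps)
    also have "\<dots> = q * X\<^sup>2 + 2 * (C * S * (s - p)) * X * Y + (p * s + (C * S * (s - p))\<^sup>2) / q * Y\<^sup>2"
    proof -
      have "p * S\<^sup>2 + s * C\<^sup>2 = (p * s + (C * S * (s - p))\<^sup>2) / q" using det q0 by (simp add: field_simps)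
      then show ?thesis unfolding CS(2) by simp
    qed
    also have "\<dots> = q * (X + C * S * (s - p) / q * Y)\<^sup>2 + p * s / q * Y\<^sup>2"
    proof -
      have "q * X\<^sup>2 + 2 * b * X * Y + (p * s + b\<^sup>2) / q * Y\<^sup>2 = q * (X + b / q * Y)\<^sup>2 + p * s / q * Y\<^sup>2" for b
        using q0 by (simp add: power2_eq_square field_simps)
      then show ?thesis .
    qed
    finally show ?thesis .
  qed
  have main: "symm n u (ellipsoid n v a \<rho>) = ellipsoid n ?v ?a \<rho>" for \<rho>
  proof (rule set_eqI)
    fix x
    show "x \<in> symm n u (ellipsoid n v a \<rho>) \<longleftrightarrow> x \<in> ellipsoid n ?v ?a \<rho>"
    proof (cases "x \<in> Rn n")
      case True
      define X where "X = inner_Rn n x u"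
      define Y where "Y = inner_Rn n x w"
      define R where "R = (\<Sum>k\<in>?rest. (inner_Rn n x (v k))\<^sup>2 / (a k)\<^sup>2)"
      define h where "h = C * S * (s - p) / q * Y"
      define d where "d = \<rho>\<^sup>2 - p * s / q * Y\<^sup>2 - R"
      have mem: "line_point n u x t \<in> ellipsoid n v a \<rho> \<longleftrightarrow> q * (X + t + h)\<^sup>2 \<le> d" for t
      proof -
        let ?z = "line_point n u x t"
        have zX: "inner_Rn n ?z u = X + t" "inner_Rn n ?z w = Y" using uu uw by (simp_all add: X_def Y_def)
        have rest: "(\<Sum>k\<in>?rest. (inner_Rn n ?z (v k))\<^sup>2 / (a k)\<^sup>2) = R"
          unfolding R_def by (rule sum.cong) (simp_all add: uv)
        have "(\<Sum>k<n. (inner_Rn n ?z (v k))\<^sup>2 / (a k)\<^sup>2)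
            = p * (inner_Rn n ?z (v i))\<^sup>2 + s * (inner_Rn n ?z (v j))\<^sup>2 + R"
          unfolding split rest by (simp add: p_def s_def)
        also have "\<dots> = q * (X + t + h)\<^sup>2 + p * s / q * Y\<^sup>2 + R"
          unfolding vi[of ?z] vj[of ?z] zX form h_def ..
        finally show ?thesis by (auto simp: ellipsoid_def d_def)
      qed
      have "x \<in> symm n u (ellipsoid n v a \<rho>) \<longleftrightarrow>
          (\<exists>\<alpha> \<beta>. q * (X + \<alpha> + h)\<^sup>2 \<le> d \<and> q * (X + \<beta> + h)\<^sup>2 \<le> d \<and> 2 * \<bar>X\<bar> \<le> \<beta> - \<alpha>)"
        using True by (simp add: symm_def mem X_def)
      also have "\<dots> \<longleftrightarrow> q * X\<^sup>2 \<le> d" by (rule chord_condition[OF q0])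
      also have "\<dots> \<longleftrightarrow> (\<Sum>k<n. (inner_Rn n x (?v k))\<^sup>2 / (?a k)\<^sup>2) \<le> \<rho>\<^sup>2"
      proof -
        have "(\<Sum>k\<in>?rest. (inner_Rn n x (?v k))\<^sup>2 / (?a k)\<^sup>2) = R"
          unfolding R_def by (rule sum.cong) auto
        then have "(\<Sum>k<n. (inner_Rn n x (?v k))\<^sup>2 / (?a k)\<^sup>2) = X\<^sup>2 / r\<^sup>2 + Y\<^sup>2 / (a i * a j / r)\<^sup>2 + R"
          unfolding split using ij by (simp add: X_def Y_def)
        also have "X\<^sup>2 / r\<^sup>2 = q * X\<^sup>2" by (simp add: q_def)
        also have "Y\<^sup>2 / (a i * a j / r)\<^sup>2 = p * s / q * Y\<^sup>2"
          by (simp add: p_def s_def q_def power_divide power_mult_distrib)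
        finally have e: "(\<Sum>k<n. (inner_Rn n x (?v k))\<^sup>2 / (?a k)\<^sup>2) = q * X\<^sup>2 + p * s / q * Y\<^sup>2 + R" .
        show ?thesis unfolding e d_def by auto
      qed
      also have "\<dots> \<longleftrightarrow> x \<in> ellipsoid n ?v ?a \<rho>" using True by (simp add: ellipsoid_def)
      finally show ?thesis .
    next
      case False
      then show ?thesis by (simp add: symm_def ellipsoid_def)
    qed
  qed
  show ?thesis using that[of u w] frame' main uR(1) uu by (simp add: unit_sphere_iff)
qed

lemma exists_above_geometric_mean:
  fixes a :: "nat \<Rightarrow> real"
  assumes a: "\<And>i. i < n \<Longrightarrow> 0 < a i" and prod: "(\<Prod>i<n. a i) = r ^ n" and k: "k < n" "a k \<noteq> r" and r: "0 < r"
  shows "\<exists>i<n. r < a i" "\<exists>j<n. a j < r"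
proof -
  have split: "(\<Prod>i<n. a i) = a k * (\<Prod>i\<in>{..<n} - {k}. a i)" using k by (intro prod.remove) auto
  have c: "r ^ n = r * (\<Prod>i\<in>{..<n} - {k}. r)"
    using k by (simp add: card_Diff_singleton power_Suc[symmetric] del: power_Suc)
  show "\<exists>i<n. r < a i"
  proof (rule ccontr)
    assume "\<not> ?thesis"
    then have le: "a i \<le> r" if "i < n" for i using that by (meson not_less)
    then have "a k < r" using k by (simp add: less_le)
    have "(\<Prod>i<n. a i) \<le> a k * (\<Prod>i\<in>{..<n} - {k}. r)"
      unfolding split using a le k by (intro mult_left_mono prod_mono) (auto simp: less_imp_le)
    also have "\<dots> < r * (\<Prod>i\<in>{..<n} - {k}. r)"
      using \<open>a k < r\<close> r by (intro mult_strict_right_mono prod_pos) simp_all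
    finally show False using prod c by simp
  qed
  show "\<exists>j<n. a j < r"
  proof (rule ccontr)
    assume "\<not> ?thesis"
    then have le: "r \<le> a i" if "i < n" for i using that by (meson not_less)
    then have "r < a k" using k by (simp add: less_le)
    have "r * (\<Prod>i\<in>{..<n} - {k}. r) < a k * (\<Prod>i\<in>{..<n} - {k}. r)"
      using \<open>r < a k\<close> r by (intro mult_strict_right_mono prod_pos) simp_all
    also have "\<dots> \<le> (\<Prod>i<n. a i)"
      unfolding split using a le k r by (intro mult_left_mono prod_mono) (auto simp: less_imp_le)
    finally show False using prod c by simp
  qed
qed

text \<open>r is the geometric mean of the a i. Unless all of them equal r, one is above and one
  below, and a symmetrization in their plane sets the first to r and changes the other so that the
  product is kept. The number of parameters different from r drops each time.\<close>

lemma ellipsoid_to_ball: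
  assumes "frame n v" "\<And>i. i < n \<Longrightarrow> 0 < a i" "(\<Prod>i<n. a i) = r ^ n" and r: "0 < r"
  shows "\<exists>us. set us \<subseteq> unit_sphere_Rn n \<and> length us \<le> card {i. i < n \<and> a i \<noteq> r} \<and>
    (\<forall>\<rho>. fold (symm n) us (ellipsoid n v a \<rho>) = ball_Rn n (\<rho> * r))"
  using assms(1-3)
proof (induction "card {i. i < n \<and> a i \<noteq> r}" arbitrary: v a rule: less_induct)
  case less
  show ?case
  proof (cases "\<exists>k<n. a k \<noteq> r")
    case False
    have "ellipsoid n v a \<rho> = ball_Rn n (\<rho> * r)" for \<rho>
    proof -
      have "(\<Sum>i<n. (inner_Rn n x (v i))\<^sup>2 / (a i)\<^sup>2) \<le> \<rho>\<^sup>2 \<longleftrightarrow> inner_Rn n x x \<le> (\<rho> * r)\<^sup>2" if "x \<in> Rn n" for x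
      proof -
        have "(\<Sum>i<n. (inner_Rn n x (v i))\<^sup>2 / (a i)\<^sup>2) = (\<Sum>i<n. (inner_Rn n x (v i))\<^sup>2) / r\<^sup>2"
          unfolding sum_divide_distrib using False by (intro sum.cong) auto
        also have "\<dots> = inner_Rn n x x / r\<^sup>2" using less.prems(1) that by (simp add: frame_def)
        finally show ?thesis using r by (simp add: divide_le_eq power_mult_distrib)
      qed
      then show ?thesis by (auto simp: ellipsoid_def ball_Rn_def)
    qed
    then show ?thesis by (intro exI[of _ "[]"]) simp
  next
    case True
    then obtain i j where ij: "i < n" "r < a i" "j < n" "a j < r"
      using exists_above_geometric_mean[OF less.prems(2,3) _ _ r] by blast
    then have ne: "i \<noteq> j" by auto
    obtain u w where uw: "u \<in> unit_sphere_Rn n" "frame n (v(i := u, j := w))"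
      "\<forall>\<rho>. symm n u (ellipsoid n v a \<rho>) = ellipsoid n (v(i := u, j := w)) (a(i := r, j := a i * a j / r)) \<rho>"
      by (rule symm_ellipsoid[OF less.prems(1,2) ij(1,3) ne r less_imp_le[OF ij(4)] less_imp_le[OF ij(2)]])
    let ?a = "a(i := r, j := a i * a j / r)"
    have pos: "0 < ?a k" if "k < n" for k using less.prems(2) that ij r by simp
    have prod: "(\<Prod>k<n. ?a k) = r ^ n"
    proof -
      have sp: "(\<Prod>k<n. f k) = f i * (f j * (\<Prod>k\<in>{..<n} - {i} - {j}. f k))" for f :: "nat \<Rightarrow> real"
        using ij ne by (subst prod.remove[of _ i]; simp?; subst prod.remove[of _ j]; simp?)
      have "(\<Prod>k\<in>{..<n} - {i} - {j}. ?a k) = (\<Prod>k\<in>{..<n} - {i} - {j}. a k)"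
        by (rule prod.cong) auto
      then have "(\<Prod>k<n. ?a k) = (\<Prod>k<n. a k)" unfolding sp[of ?a] sp[of a] using ne r by simp
      then show ?thesis using less.prems(3) by simp
    qed
    have "{k. k < n \<and> ?a k \<noteq> r} \<subset> {k. k < n \<and> a k \<noteq> r}" using ij ne by auto
    then have lt: "card {k. k < n \<and> ?a k \<noteq> r} < card {k. k < n \<and> a k \<noteq> r}"
      by (intro psubset_card_mono) simp_all
    obtain us where us: "set us \<subseteq> unit_sphere_Rn n" "length us \<le> card {k. k < n \<and> ?a k \<noteq> r}"
      "\<forall>\<rho>. fold (symm n) us (ellipsoid n (v(i := u, j := w)) ?a \<rho>) = ball_Rn n (\<rho> * r)"
      using less.hyps[OF lt uw(2) pos prod] by blast
    show ?thesis
      by (rule exI[of _ "u # us"]) (use us uw lt in simp)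
  qed
qed

section \<open>Polynomial position and the final count\<close>

lemma fold_symm_mono: "K \<subseteq> L \<Longrightarrow> fold (symm n) us K \<subseteq> fold (symm n) us L"
  by (induction us arbitrary: K L) (simp_all add: symm_mono)

lemma emeasure_fold_symm:
  assumes "convex_body n K" "set us \<subseteq> unit_sphere_Rn n"
  shows "emeasure (leb n) (fold (symm n) us K) = emeasure (leb n) K"
  using assms
proof (induction us arbitrary: K)
  case (Cons u us)
  then have u: "u \<in> Rn n" "inner_Rn n u u = 1" by (simp_all add: unit_sphere_iff)
  show ?case
    using Cons.IH[OF convex_body_symm[OF Cons.prems(1) u]] Cons.prems emeasure_symm[OF Cons.prems(1) u] by simp
qed simp

lemma convex_body_fold_symm:
  "convex_body n K \<Longrightarrow> set us \<subseteq> unit_sphere_Rn n \<Longrightarrow> convex_body n (fold (symm n) us K)"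
  using steiner_seq_convex_body by blast

text \<open>The same symmetrizations turn both sandwiching ellipsoids into balls, of radii r/sqrt n
  and r*sqrt n. Nothing is known about r in advance, but |K| = |D_n| forces the inner radius to be
  at most 1 and the outer one at least 1, so 1/sqrt n \<le> r \<le> sqrt n.\<close>

lemma symmetrize_to_polynomial_position:
  assumes n: "n > 0" and K: "convex_body n K"
    and vol: "emeasure (leb n) K = emeasure (leb n) (ball_Rn n 1)"
  obtains us where "set us \<subseteq> unit_sphere_Rn n" "length us \<le> 2 * n"
    "ball_Rn n (1 / real n) \<subseteq> fold (symm n) us K" "fold (symm n) us K \<subseteq> ball_Rn n (real n)"
proof -
  let ?V = "emeasure (leb n) (ball_Rn n 1)"
  define us1 where "us1 = map (axis_Rn n) [0..<n]"
  define K1 where "K1 = fold (symm n) us1 K"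
  have us1: "set us1 \<subseteq> unit_sphere_Rn n" by (auto simp: us1_def axis_unit_sphere)
  have K1: "convex_body n K1" unfolding K1_def by (rule convex_body_fold_symm[OF K us1])
  have "unconditional n K1" unfolding K1_def us1_def by (rule unconditional_fold)
  then obtain a where a: "\<And>i. i < n \<Longrightarrow> 0 < a i"
    "ellipsoid n (axis_Rn n) a (1 / sqrt (real n)) \<subseteq> K1" "K1 \<subseteq> ellipsoid n (axis_Rn n) a (sqrt (real n))"
    using unconditional_ellipsoid[OF n K1] by metis
  define r where "r = root n (\<Prod>i<n. a i)"
  have pp: "(\<Prod>i<n. a i) > 0" using a(1) by (intro prod_pos) simp
  have r: "r > 0" "r ^ n = (\<Prod>i<n. a i)" using n pp by (simp_all add: r_def)
  obtain us2 where us2: "set us2 \<subseteq> unit_sphere_Rn n" "length us2 \<le> card {i. i < n \<and> a i \<noteq> r}"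
    "\<forall>\<rho>. fold (symm n) us2 (ellipsoid n (axis_Rn n) a \<rho>) = ball_Rn n (\<rho> * r)"
    using ellipsoid_to_ball[OF frame_axis a(1) r(2)[symmetric] r(1)] by blast
  define K2 where "K2 = fold (symm n) us2 K1"
  have K2: "convex_body n K2" unfolding K2_def by (rule convex_body_fold_symm[OF K1 us2(1)])
  have V2: "emeasure (leb n) K2 = ?V"
    using emeasure_fold_symm[OF K1 us2(1)] emeasure_fold_symm[OF K us1] vol by (simp add: K2_def K1_def)
  have sub: "ball_Rn n (1 / sqrt (real n) * r) \<subseteq> K2" "K2 \<subseteq> ball_Rn n (sqrt (real n) * r)"
    unfolding K2_def us2(3)[rule_format, symmetric] by (intro fold_symm_mono a)+
  have sn: "sqrt (real n) > 0" "sqrt (real n) * sqrt (real n) = real n" using n by simp_all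
  have V0: "?V > 0" "?V < \<infinity>" using emeasure_ball_pos[OF n] emeasure_ball_finite by auto
  have cancel: "a \<le> b" if "a * ?V \<le> b * ?V" for a b
    using ennreal_mult_le_mult_iff[of ?V a b] that V0 by (simp add: mult.commute)
  have scale: "c ^ n \<le> 1 \<longleftrightarrow> c \<le> 1" "1 \<le> c ^ n \<longleftrightarrow> 1 \<le> c" if "c > 0" for c :: real
    using that n power_mono_iff[of c 1 n] power_mono_iff[of 1 c n] by simp_all
  have up: "1 \<le> sqrt (real n) * r"
  proof -
    have "?V \<le> ennreal ((sqrt (real n) * r) ^ n) * ?V"
      using emeasure_mono[OF sub(2) ball_measurable] emeasure_ball[of "sqrt (real n) * r" n] sn r V2 by simp
    then have "1 * ?V \<le> ennreal ((sqrt (real n) * r) ^ n) * ?V" by simp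
    then have "1 \<le> ennreal ((sqrt (real n) * r) ^ n)" by (rule cancel)
    then show ?thesis using scale sn r by simp
  qed
  have lo: "1 / sqrt (real n) * r \<le> 1"
  proof -
    have "ennreal ((1 / sqrt (real n) * r) ^ n) * ?V \<le> 1 * ?V"
      using emeasure_mono[OF sub(1), of "leb n"] convex_bodyD(4)[OF K2]
        emeasure_ball[of "1 / sqrt (real n) * r" n] sn r V2 by simp
    then have "ennreal ((1 / sqrt (real n) * r) ^ n) \<le> 1" by (rule cancel)
    then show ?thesis using scale[of "1 / sqrt (real n) * r"] sn r by simp
  qed
  have mono: "ball_Rn n s \<subseteq> ball_Rn n t" if "0 \<le> s" "s \<le> t" for s t
    using power_mono[OF that(2,1), of 2] unfolding ball_Rn_def by (blast intro: order_trans)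
  have "1 / real n \<le> 1 / sqrt (real n) * r"
  proof -
    have "1 / real n = 1 / sqrt (real n) * (1 / sqrt (real n))" using sn by (simp add: real_div_sqrt)
    also have "\<dots> \<le> 1 / sqrt (real n) * r" using up sn by (intro mult_left_mono) (simp_all add: divide_le_eq mult.commute)
    finally show ?thesis .
  qed
  then have 1: "ball_Rn n (1 / real n) \<subseteq> K2" using sub(1) mono[of "1 / real n"] by force
  have "sqrt (real n) * r \<le> sqrt (real n) * sqrt (real n)"
    using lo sn by (intro mult_left_mono) (simp_all add: divide_le_eq)
  then have 2: "K2 \<subseteq> ball_Rn n (real n)" using sub(2) mono[of "sqrt (real n) * r" "real n"] sn r by force
  have "card {i. i < n \<and> a i \<noteq> r} \<le> card {..<n}" by (intro card_mono) auto
  then have "length (us1 @ us2) \<le> 2 * n" using us2(2) by (simp add: us1_def)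
  then show ?thesis
    using that[of "us1 @ us2"] us1 us2(1) 1 2 by (simp add: K1_def K2_def)
qed

lemma moment_ball_bound:
  assumes "K \<in> sets (leb n)" "K \<subseteq> ball_Rn n R"
  shows "moment n K \<le> ennreal (R\<^sup>2) * emeasure (leb n) K"
proof -
  have "moment n K \<le> (\<integral>\<^sup>+x. ennreal (R\<^sup>2) * indicator K x \<partial>leb n)"
    unfolding moment_def using assms(2)
    by (intro nn_integral_mono) (auto simp: ball_Rn_def indicator_def intro!: ennreal_leI)
  then show ?thesis using assms(1) by (simp add: nn_integral_cmult)
qed

theorem theorem1p2:
  shows "\<exists>c::real. c > 0 \<and>
    (\<forall>n\<ge>2. \<forall>K. \<forall>\<epsilon>::real.
       convex_body n K \<longrightarrow> vol n K = vol n (unit_ball_Rn n) \<longrightarrow> 0 < \<epsilon> \<longrightarrow> \<epsilon> < 1 \<longrightarrow>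
       (\<exists>us. set us \<subseteq> unit_sphere_Rn n \<and>
          real (length us) \<le>
            c * (real n ^ 13 * ln (real n) ^ 3 / \<epsilon> powr (4 + 2 / ln (real n))) \<and>
          convex_body n (steiner_seq n us K) \<and>
          vol n (sym_diff (steiner_seq n us K) (unit_ball_Rn n)) / vol n (unit_ball_Rn n) < \<epsilon>))"
proof (intro exI[of _ "2 ^ 22"] conjI allI impI)
  fix n :: nat and K :: "(nat \<Rightarrow> real) set" and \<epsilon> :: real
  assume n2: "2 \<le> n" and K: "convex_body n K" and vol: "vol n K = vol n (unit_ball_Rn n)"
    and eps: "0 < \<epsilon>" "\<epsilon> < 1"
  have n: "n > 0" using n2 by simp
  define v where "v = vol n (unit_ball_Rn n)"
  have Bv: "emeasure (leb n) (ball_Rn n 1) = ennreal v"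
    using emeasure_ball_finite[of n 1] by (simp add: v_def vol_def unit_ball_eq emeasure_eq_ennreal_measure)
  have v: "v > 0"
    using emeasure_ball_pos[OF n] unfolding Bv by simp
  obtain R where R: "K \<subseteq> ball_Rn n R" using compactin_bounded[OF convex_bodyD(1)[OF K]] by blast
  have Kfin: "emeasure (leb n) K < \<infinity>"
    using emeasure_mono[OF R ball_measurable] emeasure_ball_finite[of n R] by (rule le_less_trans)
  then have Kv: "emeasure (leb n) K = ennreal v"
    using vol by (simp add: v_def vol_def emeasure_eq_ennreal_measure)
  obtain us1 where us1: "set us1 \<subseteq> unit_sphere_Rn n" "length us1 \<le> 2 * n"
    "ball_Rn n (1 / real n) \<subseteq> fold (symm n) us1 K" "fold (symm n) us1 K \<subseteq> ball_Rn n (real n)"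
    using symmetrize_to_polynomial_position[OF n K] Kv Bv by metis
  define K1 where "K1 = fold (symm n) us1 K"
  have K1: "convex_body n K1" unfolding K1_def by (rule convex_body_fold_symm[OF K us1(1)])
  have K1v: "emeasure (leb n) K1 = ennreal v"
    unfolding K1_def using emeasure_fold_symm[OF K us1(1)] Kv by simp
  \<comment> \<open>This makes the attainable error 8*n*e*v equal to half of \<epsilon>*v, which
    leaves room for the strict inequality.\<close>
  define e where "e = \<epsilon> / (16 * real n)"
  have e: "0 < e" "e \<le> 1" using eps n by (simp_all add: e_def divide_le_eq)
  define \<tau> where "\<tau> = e ^ 4 / (32 * real n ^ 4)"
  have t0: "\<tau> > 0" using e n by (simp add: \<tau>_def)
  define j where "j = nat \<lceil>(real n)\<^sup>2 / \<tau>\<rceil>"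
  have j: "(real n)\<^sup>2 / \<tau> \<le> real j" "real j \<le> (real n)\<^sup>2 / \<tau> + 1"
    using t0 by (simp_all add: j_def of_nat_ceiling)
  have "moment n K1 \<le> ennreal ((real n)\<^sup>2) * ennreal v"
    using moment_ball_bound[OF convex_bodyD(4)[OF K1] us1(4)[folded K1_def]] K1v by simp
  also have "\<dots> = ennreal ((real n)\<^sup>2 * v)" using v by (simp add: ennreal_mult)
  also have "\<dots> \<le> ennreal (real j * (\<tau> * v))"
  proof (rule ennreal_leI)
    have "(real n)\<^sup>2 \<le> real j * \<tau>" using j(1) t0 by (simp add: divide_le_eq)
    then show "(real n)\<^sup>2 * v \<le> real j * (\<tau> * v)" using v by (simp add: mult.assoc[symmetric])
  qed
  finally obtain us2 where us2: "set us2 \<subseteq> unit_sphere_Rn n" "length us2 \<le> j"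
    "emeasure (leb n) (sym_diff (fold (symm n) us2 K1) (ball_Rn n 1)) \<le> ennreal (8 * real n * (e * v))"
    using symmetrize_bounded_moment[OF n K1 us1(3)[folded K1_def] K1v Bv v e] unfolding \<tau>_def by blast
  let ?us = "us1 @ us2"
  have us: "set ?us \<subseteq> unit_sphere_Rn n" using us1 us2 by simp
  note S = steiner_seq_convex_body[OF K us]
  have far: "vol n (sym_diff (steiner_seq n ?us K) (unit_ball_Rn n)) \<le> \<epsilon> / 2 * v"
  proof -
    have "emeasure (leb n) (sym_diff (steiner_seq n ?us K) (unit_ball_Rn n)) \<le> ennreal (8 * real n * (e * v))"
      using us2(3) S by (simp add: K1_def unit_ball_eq)
    also have "8 * real n * (e * v) = \<epsilon> / 2 * v" using n by (simp add: e_def)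
    finally show ?thesis unfolding vol_def measure_def using eps v by (intro enn2real_leI) simp_all
  qed
  have "vol n (sym_diff (steiner_seq n ?us K) (unit_ball_Rn n)) / v < \<epsilon>"
    using le_less_trans[OF far, of "\<epsilon> * v"] eps v by (simp add: divide_less_eq)
  moreover have "real (length ?us) \<le> 2 ^ 22 * (real n ^ 13 * ln (real n) ^ 3 / \<epsilon> powr (4 + 2 / ln (real n)))"
  proof -
    have nr: "real n \<ge> 2" using n2 by simp
    have ln2: "ln (real n) \<ge> 1 / 2"
    proof -
      have "1 / 2 \<le> ln (2::real)" using ln2_ge_two_thirds by linarith
      also have "\<dots> \<le> ln (real n)" using nr by simp
      finally show ?thesis .
    qed
    have key: "1 \<le> (real n * ln (real n)) ^ 3"
    proof (rule one_le_power)
      have "2 * (1 / 2) \<le> real n * ln (real n)" using nr ln2 by (intro mult_mono) simp_all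
      then show "1 \<le> real n * ln (real n)" by simp
    qed
    have pw: "\<epsilon> powr (4 + 2 / ln (real n)) \<le> \<epsilon> ^ 4"
    proof -
      have "\<epsilon> powr (4 + 2 / ln (real n)) \<le> \<epsilon> powr 4" using eps ln2 by (intro powr_mono') simp_all
      also have "\<dots> = \<epsilon> ^ 4" using eps powr_realpow[of \<epsilon> 4] by simp
      finally show ?thesis .
    qed
    have e4: "0 < \<epsilon> ^ 4" "\<epsilon> ^ 4 \<le> 1" using eps by (simp_all add: power_le_one)
    have "real (length ?us) \<le> 2 * real n + ((real n)\<^sup>2 / \<tau> + 1)"
      using us1(2) us2(2) j(2) by simp
    \<comment> \<open>The factor 2^21 is 2^5 from \<tau> times 16^4 from e^4; n^10 consists of n^2
      from the moment, n^4 from \<tau> and n^4 from e^4.\<close>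
    also have "(real n)\<^sup>2 / \<tau> = 2 ^ 21 * (real n ^ 10 / \<epsilon> ^ 4)"
      using n eps by (simp add: \<tau>_def e_def power_divide power_mult_distrib field_simps power_add[symmetric])
    also have "2 * real n + (2 ^ 21 * (real n ^ 10 / \<epsilon> ^ 4) + 1) \<le> 2 ^ 22 * (real n ^ 10 / \<epsilon> ^ 4)"
    proof -
      define A where "A = real n ^ 10 / \<epsilon> ^ 4"
      have "real n ^ 1 \<le> real n ^ 10" using nr by (intro power_increasing) simp_all
      also have "real n ^ 10 \<le> A"
        using e4 by (simp add: A_def le_divide_eq mult_left_le)
      finally have "2 * real n + (2 ^ 21 * A + 1) \<le> 2 ^ 22 * A" using nr by simp
      then show ?thesis by (simp only: A_def)
    qed
    \<comment> \<open>The count reached is below the required one, since (n log n)^3 \<ge> 1 and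
      \<epsilon>^(2/log n) \<le> 1 for n \<ge> 2.\<close>
    also have "\<dots> \<le> 2 ^ 22 * (real n ^ 13 * ln (real n) ^ 3 / \<epsilon> powr (4 + 2 / ln (real n)))"
    proof (rule mult_left_mono)
      have "real n ^ 10 * 1 \<le> real n ^ 10 * (real n * ln (real n)) ^ 3" by (rule mult_left_mono[OF key]) simp
      also have "\<dots> = real n ^ 13 * ln (real n) ^ 3" by (simp add: power_mult_distrib power_add[symmetric])
      finally show "real n ^ 10 / \<epsilon> ^ 4 \<le> real n ^ 13 * ln (real n) ^ 3 / \<epsilon> powr (4 + 2 / ln (real n))"
        using pw eps ln2 by (intro frac_le) simp_all
    qed simp
    finally show ?thesis .
  qed
  ultimately show "\<exists>us. set us \<subseteq> unit_sphere_Rn n \<and>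
          real (length us) \<le> 2 ^ 22 * (real n ^ 13 * ln (real n) ^ 3 / \<epsilon> powr (4 + 2 / ln (real n))) \<and>
          convex_body n (steiner_seq n us K) \<and>
          vol n (sym_diff (steiner_seq n us K) (unit_ball_Rn n)) / vol n (unit_ball_Rn n) < \<epsilon>"
    using us S unfolding v_def by (intro exI[of _ ?us]) simp
qed simp

end
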